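(* Let $\bar\rho$ be the liquid Lane--Emden profile with adiabatic index $\gamma\in[1,2]$ and radius $R$. Consider the system for the perturbation $\boldsymbol\theta(\mathbf x,t)=\boldsymbol\eta(\mathbf x,t)-\mathbf x$ of the flow map, $$\partial_t^2\boldsymbol\theta+\bar\rho^{-1}\partial_k\big(\bar\rho^\gamma(A^kJ^{1-\gamma}-I^k)\big)+A\nabla\psi-\nabla\mathcal K\bar\rho=\mathbf 0\ \text{ on }B_R,\qquad J=1\ \text{ on }\partial B_R .$$ Its formal linearisation (the first-order part in $\boldsymbol\theta$, i.e. the derivative at $\varepsilon=0$ after replacing $\boldsymbol\theta$ by $\varepsilon\boldsymbol\theta$) reads $$\partial_t^2\boldsymbol\theta+\mathbf L\boldsymbol\theta=\mathbf 0\ \text{ on }B_R,\qquad \nabla\cdot\boldsymbol\theta=0\ \text{ on }\partial B_R,$$ where $$\mathbf L\boldsymbol\theta:=-\nabla\Big((\gamma\bar\rho^{\gamma-2}+\mathcal K)\nabla\cdot(\bar\rho\boldsymbol\theta)+\int_{\partial B_R}\frac{\boldsymbol\theta(\mathbf z)}{|\mathbf x-\mathbf z|}\cdot d\mathbf S(\mathbf z)\Big)=-\nabla\Big(\big(\gamma\bar\rho^{\gamma-2}+\mathcal K-\bar\rho'(R)^{-1}\mathcal K_\partial\big)\nabla\cdot(\bar\rho\boldsymbol\theta)\Big)$$ (the second expression for $\mathbf L\boldsymbol\theta$ being for $\boldsymbol\theta$ satisfying the boundary condition $\nabla\cdot\boldsymbol\theta=0$ on $\partial B_R$).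
   Context: Liquid Lane--Emden profile: fix $\gamma\in[1,2]$ and a central density $\bar\rho(0)>1$. Let $f_0$ be the unique decreasing positive radial solution, with $f_0(0)=\bar\rho(0)$ and $f_0'(0)=0$, of $\frac{\gamma}{\gamma-1}\Delta f_0^{\gamma-1}+4\pi f_0=0$ if $\gamma>1$, and of $\Delta\ln f_0+4\pi f_0=0$ if $\gamma=1$, where $\Delta=r^{-2}\partial_r(r^2\partial_r)$. Let $R>0$ be the radius with $f_0(R)=1$, and set $\bar\rho(r)=f_0(r)\mathbf 1_{[0,R]}(r)$, $\bar\rho(\mathbf x)=\bar\rho(|\mathbf x|)$. Thus $\bar\rho^{-1}\nabla(\bar\rho^\gamma)+\nabla\mathcal K\bar\rho=\mathbf 0$ on $B_R$ and $\bar\rho(R)=1$; $\bar\rho'(R)$ is the one-sided derivative from inside. $B_R\subset\mathbb R^3$ is the ball of radius $R$ centred at the origin. Operators: $\mathcal K f(\mathbf x)=-\int_{B_R}\frac{f(\mathbf y)}{|\mathbf x-\mathbf y|}\,d\mathbf y$, $\mathcal K_\partial f(\mathbf x)=-\int_{\partial B_R}\frac{f(\mathbf y)}{|\mathbf x-\mathbf y|}\,dS(\mathbf y)$. Lagrangian quantities: $\boldsymbol\eta(\mathbf x,t)=\mathbf x+\boldsymbol\theta(\mathbf x,t)$ is the flow map on $B_R$; $A=(\nabla\boldsymbol\eta)^{-1}$ with components $A^k_i$, where $(\nabla\boldsymbol\eta)^k_i=\partial_i\eta^k$ (so $A^k_i\partial_k\eta^j=\delta^j_i$); $J=\det\nabla\boldsymbol\eta$;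 $A^k$ is the vector with components $A^k_i$, $i=1,2,3$, and $I^k$ the vector with components $\delta^k_i$; $(A\nabla\psi)_i=A^k_i\partial_k\psi$; repeated indices are summed. The potential is $\psi(\mathbf x)=-\int_{B_R}\frac{\bar\rho(\mathbf z)}{|\boldsymbol\eta(\mathbf x)-\boldsymbol\eta(\mathbf z)|}\,d\mathbf z$. The perturbation $\boldsymbol\theta$ is taken sufficiently regular for the formal computation. *)

theory Defs
  imports "HOL-Analysis.Analysis"
begin

section \<open>Differential operators on a set\<close>

text \<open>
  All spatial derivatives are Frechet derivatives relative to a set \<open>S\<close>, which will be the closed
  ball \<open>cball 0 R\<close>. At interior points these are the ordinary derivatives; at points of the
  boundary sphere they are the derivatives from inside. (The ball is convex with nonempty interior,
  so they are unique there as well.) Hence a perturbation needs to be given on the closed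
  ball only, and the jump of the density across the sphere is not seen.
\<close>

definition partial_on :: "(real^3) set \<Rightarrow> 3 \<Rightarrow> (real^3 \<Rightarrow> 'b::real_normed_vector) \<Rightarrow> real^3 \<Rightarrow> 'b"
  where "partial_on S k f x = frechet_derivative f (at x within S) (axis k 1)"

definition grad_on :: "(real^3) set \<Rightarrow> (real^3 \<Rightarrow> real) \<Rightarrow> real^3 \<Rightarrow> real^3"
  where "grad_on S f x = (\<chi> i. partial_on S i f x)"

definition div_on :: "(real^3) set \<Rightarrow> (real^3 \<Rightarrow> real^3) \<Rightarrow> real^3 \<Rightarrow> real"
  where "div_on S F x = (\<Sum>k\<in>UNIV. partial_on S k (\<lambda>y. F y $ k) x)"

definition C1_on :: "'a::real_normed_vector set \<Rightarrow> ('a \<Rightarrow> 'b::real_normed_vector) \<Rightarrow> bool"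
  where "C1_on S f \<longleftrightarrow>
    (\<exists>f' :: 'a \<Rightarrow> 'a \<Rightarrow>\<^sub>L 'b.
      (\<forall>x\<in>S. (f has_derivative blinfun_apply (f' x)) (at x within S)) \<and> continuous_on S f')"

definition C2_on :: "'a::real_normed_vector set \<Rightarrow> ('a \<Rightarrow> 'b::real_normed_vector) \<Rightarrow> bool"
  where "C2_on S f \<longleftrightarrow>
    (\<exists>f' :: 'a \<Rightarrow> 'a \<Rightarrow>\<^sub>L 'b.
      (\<forall>x\<in>S. (f has_derivative blinfun_apply (f' x)) (at x within S)) \<and> C1_on S f')"

definition time_deriv2 :: "(real \<Rightarrow> 'b::real_normed_vector) \<Rightarrow> real \<Rightarrow> 'b"
  where "time_deriv2 u t = vector_derivative (\<lambda>s. vector_derivative u (at s)) (at t)"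

definition twice_differentiable_on :: "(real \<Rightarrow> 'b::real_normed_vector) \<Rightarrow> real set \<Rightarrow> bool"
    (infix "twice'_differentiable'_on" 50)
  where "u twice_differentiable_on T \<longleftrightarrow>
    u differentiable_on T \<and> (\<lambda>s. vector_derivative u (at s)) differentiable_on T"

section \<open>The surface integral over the sphere and the potentials\<close>

text \<open>
  The surface integral is taken in the usual polar parametrisation of the sphere of radius \<open>R\<close>
  centred at the origin, whose area element is \<open>R\<^sup>2 sin \<phi> d\<phi> d\<omega>\<close>.
\<close>

definition sphere_point :: "real \<Rightarrow> real \<Rightarrow> real \<Rightarrow> real^3"
  where "sphere_point R \<phi> \<omega> =
    R *\<^sub>R vector [sin \<phi> * cos \<omega>, sin \<phi> * sin \<omega>, cos \<phi>]"

definition sphere_integral :: "real \<Rightarrow> (real^3 \<Rightarrow> real) \<Rightarrow> real"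
  where "sphere_integral R f =
    set_lebesgue_integral lborel ({0..pi} \<times> {0..2 * pi})
      (\<lambda>(\<phi>, \<omega>). f (sphere_point R \<phi> \<omega>) * (R\<^sup>2 * sin \<phi>))"

text \<open>\<open>z /\<^sub>R R\<close> is the outward unit normal at \<open>z\<close>.\<close>

definition sphere_flux :: "real \<Rightarrow> (real^3 \<Rightarrow> real^3) \<Rightarrow> real"
  where "sphere_flux R F = sphere_integral R (\<lambda>z. F z \<bullet> (z /\<^sub>R R))"

definition Kpot :: "real \<Rightarrow> (real^3 \<Rightarrow> real) \<Rightarrow> real^3 \<Rightarrow> real"
  where "Kpot R f x = - set_lebesgue_integral lborel (ball 0 R) (\<lambda>y. f y / norm (x - y))"

definition Kpot_bdry :: "real \<Rightarrow> (real^3 \<Rightarrow> real) \<Rightarrow> real^3 \<Rightarrow> real"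
  where "Kpot_bdry R f x = - sphere_integral R (\<lambda>y. f y / norm (x - y))"

section \<open>The liquid Lane--Emden profile\<close>

definition radial_laplacian :: "(real \<Rightarrow> real) \<Rightarrow> real \<Rightarrow> real"
  where "radial_laplacian u r = deriv (\<lambda>s. s\<^sup>2 * deriv u s) r / r\<^sup>2"

text \<open>
  \<open>lane_emden \<gamma> c a f\<close>: on the interval \<open>[0, a)\<close> the function \<open>f\<close> is a decreasing positive
  solution with central value \<open>c\<close>. The solution may vanish at a finite radius, which
  is why its interval of positivity is not taken to be all of \<open>[0, \<infinity>)\<close>.
\<close>

definition lane_emden :: "real \<Rightarrow> real \<Rightarrow> real \<Rightarrow> (real \<Rightarrow> real) \<Rightarrow> bool"
  where "lane_emden \<gamma> c a f \<longleftrightarrow>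
    f 0 = c \<and> (f has_real_derivative 0) (at 0 within {0..<a}) \<and>
    (\<forall>r\<in>{0..<a}. 0 < f r) \<and> strict_antimono_on {0..<a} f \<and>
    f twice_differentiable_on {0<..<a} \<and>
    (\<forall>r\<in>{0<..<a}.
      (if \<gamma> = 1 then radial_laplacian (\<lambda>s. ln (f s)) r
       else \<gamma> / (\<gamma> - 1) * radial_laplacian (\<lambda>s. f s powr (\<gamma> - 1)) r)
      + 4 * pi * f r = 0)"

definition liquid_profile :: "real \<Rightarrow> (real \<Rightarrow> real) \<Rightarrow> real \<Rightarrow> real"
  where "liquid_profile R f r = f r * indicator {0..R} r"

definition liquid_density :: "real \<Rightarrow> (real \<Rightarrow> real) \<Rightarrow> real^3 \<Rightarrow> real"
  where "liquid_density R f x = liquid_profile R f (norm x)"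

definition liquid_slope :: "real \<Rightarrow> (real \<Rightarrow> real) \<Rightarrow> real"
  where "liquid_slope R f = vector_derivative (liquid_profile R f) (at R within {0..R})"

section \<open>The nonlinear system in Lagrangian coordinates\<close>

definition flow_map :: "(real^3 \<Rightarrow> real^3) \<Rightarrow> real^3 \<Rightarrow> real^3"
  where "flow_map \<theta> x = x + \<theta> x"

text \<open>
  \<open>jacobian \<eta> net $ k $ i\<close> is the derivative of the \<open>k\<close>-th component of \<open>\<eta>\<close> in direction \<open>i\<close>, so
  that \<open>A\<^sup>k\<^sub>i\<close> is \<open>inv_grad R \<eta> x $ k $ i\<close> and the vector \<open>A\<^sup>k\<close> is the row \<open>inv_grad R \<eta> x $ k\<close>.
\<close>

definition grad_flow :: "real \<Rightarrow> (real^3 \<Rightarrow> real^3) \<Rightarrow> real^3 \<Rightarrow> real^3^3"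
  where "grad_flow R \<eta> x = jacobian \<eta> (at x within cball 0 R)"

definition inv_grad :: "real \<Rightarrow> (real^3 \<Rightarrow> real^3) \<Rightarrow> real^3 \<Rightarrow> real^3^3"
  where "inv_grad R \<eta> x = matrix_inv (grad_flow R \<eta> x)"

definition jac_det :: "real \<Rightarrow> (real^3 \<Rightarrow> real^3) \<Rightarrow> real^3 \<Rightarrow> real"
  where "jac_det R \<eta> x = det (grad_flow R \<eta> x)"

definition lagr_potential :: "real \<Rightarrow> (real^3 \<Rightarrow> real) \<Rightarrow> (real^3 \<Rightarrow> real^3) \<Rightarrow> real^3 \<Rightarrow> real"
  where "lagr_potential R \<rho> \<eta> x =
    - set_lebesgue_integral lborel (ball 0 R) (\<lambda>z. \<rho> z / norm (\<eta> x - \<eta> z))"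

definition pressure_term ::
    "real \<Rightarrow> real \<Rightarrow> (real^3 \<Rightarrow> real) \<Rightarrow> (real^3 \<Rightarrow> real^3) \<Rightarrow> real^3 \<Rightarrow> real^3"
  where "pressure_term \<gamma> R \<rho> \<eta> x =
    inverse (\<rho> x) *\<^sub>R
      (\<Sum>k\<in>UNIV. partial_on (cball 0 R) k
        (\<lambda>y. \<rho> y powr \<gamma> *\<^sub>R (jac_det R \<eta> y powr (1 - \<gamma>) *\<^sub>R inv_grad R \<eta> y $ k - axis k 1)) x)"

definition gravity_term ::
    "real \<Rightarrow> (real^3 \<Rightarrow> real) \<Rightarrow> (real^3 \<Rightarrow> real^3) \<Rightarrow> real^3 \<Rightarrow> real^3"
  where "gravity_term R \<rho> \<eta> x =
    (\<Sum>k\<in>UNIV. partial_on (cball 0 R) k (lagr_potential R \<rho> \<eta>) x *\<^sub>R inv_grad R \<eta> x $ k)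
    - grad_on (cball 0 R) (Kpot R \<rho>) x"

definition momentum_lhs ::
    "real \<Rightarrow> real \<Rightarrow> (real^3 \<Rightarrow> real) \<Rightarrow> (real \<Rightarrow> real^3 \<Rightarrow> real^3) \<Rightarrow> real \<Rightarrow> real^3 \<Rightarrow> real^3"
  where "momentum_lhs \<gamma> R \<rho> \<theta> t x =
    time_deriv2 (\<lambda>s. \<theta> s x) t + pressure_term \<gamma> R \<rho> (flow_map (\<theta> t)) x
    + gravity_term R \<rho> (flow_map (\<theta> t)) x"

section \<open>The two expressions for the linearised operator\<close>

definition lin_op ::
    "real \<Rightarrow> real \<Rightarrow> (real^3 \<Rightarrow> real) \<Rightarrow> (real^3 \<Rightarrow> real^3) \<Rightarrow> real^3 \<Rightarrow> real^3"
  where "lin_op \<gamma> R \<rho> \<theta> x =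
    - grad_on (cball 0 R)
        (\<lambda>y. \<gamma> * \<rho> y powr (\<gamma> - 2) * div_on (cball 0 R) (\<lambda>z. \<rho> z *\<^sub>R \<theta> z) y
           + Kpot R (div_on (cball 0 R) (\<lambda>z. \<rho> z *\<^sub>R \<theta> z)) y
           + sphere_flux R (\<lambda>z. \<theta> z /\<^sub>R norm (y - z))) x"

text \<open>In \<open>lin_op_div\<close> the parameter \<open>\<sigma>\<close> is the slope of the density at the boundary.\<close>

definition lin_op_div ::
    "real \<Rightarrow> real \<Rightarrow> (real^3 \<Rightarrow> real) \<Rightarrow> real \<Rightarrow> (real^3 \<Rightarrow> real^3) \<Rightarrow> real^3 \<Rightarrow> real^3"
  where "lin_op_div \<gamma> R \<rho> \<sigma> \<theta> x =
    - grad_on (cball 0 R)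
        (\<lambda>y. \<gamma> * \<rho> y powr (\<gamma> - 2) * div_on (cball 0 R) (\<lambda>z. \<rho> z *\<^sub>R \<theta> z) y
           + Kpot R (div_on (cball 0 R) (\<lambda>z. \<rho> z *\<^sub>R \<theta> z)) y
           - inverse \<sigma> * Kpot_bdry R (div_on (cball 0 R) (\<lambda>z. \<rho> z *\<^sub>R \<theta> z)) y) x"

end

theory Submission
  imports Defs
begin

text \<open>
  Write \<open>\<Phi>(w) = - 1 / |w|\<close>, so that \<open>\<nabla>\<Phi>(w) = w / |w|\<^sup>3\<close>, and let \<open>g = - \<nabla>K\<rho>\<close> be the gravitational field of
  the star at rest. By equilibrium \<open>g\<close> is also \<open>\<rho>\<^sup>-\<^sup>1 \<nabla>\<rho>\<^sup>\<gamma>\<close>. Fix an interior point \<open>x\<close>, replace \<open>\<theta>\<close> by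
  \<open>\<epsilon>\<theta>\<close>, and differentiate the two force terms at \<open>\<epsilon> = 0\<close>.

  \<^bold>\<open>Pressure.\<close> The row \<open>A\<^sup>k\<close> is the \<open>k\<close>-th row of the adjugate of \<open>\<nabla>\<eta>\<close> divided by \<open>J\<close>, and that row is
  the cross product of two of the columns \<open>e\<^sub>j + \<epsilon> \<partial>\<^sub>j\<theta>\<close>. The flux \<open>\<rho>\<^sup>\<gamma>(A\<^sup>k J\<^bsup>1-\<gamma>\<^esup> - I\<^sup>k)\<close> is thus an explicit
  function of \<open>\<epsilon>\<close> and of the first derivatives of \<open>\<theta>\<close> (\<open>pressure_term_derivative\<close>). Since
  \<open>\<partial>\<^sub>k\<partial>\<^sub>i\<theta>\<^sup>k = \<partial>\<^sub>i\<partial>\<^sub>k\<theta>\<^sup>k\<close> (\<open>second_derivative_symmetric\<close>), its linear part is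
  \<open>- \<nabla>(\<gamma>\<rho>\<^bsup>\<gamma>-1\<^esup> div \<theta>) - (\<nabla>\<theta>) g\<close>, where \<open>((\<nabla>\<theta>) g)\<^sub>i = \<partial>\<^sub>i\<theta> \<bullet> g\<close>.

  \<^bold>\<open>Gravity.\<close> By the chain rule \<open>A\<nabla>\<psi>\<close> at \<open>x\<close> is \<open>\<integral> \<rho>(z) \<nabla>\<Phi>(\<eta>(x) - \<eta>(z)) dz\<close>. Its derivative at \<open>\<epsilon> = 0\<close> is
  \<open>T = \<integral> \<rho>(z) D\<^sup>2\<Phi>(x - z)(\<theta>(x) - \<theta>(z)) dz\<close>, which converges because \<open>\<theta>\<close> is Lipschitz
  (\<open>gravity_term_derivative\<close>).

  \<^bold>\<open>The operator.\<close> As \<open>\<rho> = 1\<close> on the sphere, the divergence theorem against the kernel \<open>1 / |y - z|\<close>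
  (\<open>singular_divergence\<close>) turns the two nonlocal terms of \<open>L\<theta>\<close> into \<open>\<integral> \<rho>\<theta> \<bullet> \<nabla>\<Phi>(y - z) dz\<close>. The density of this
  integral does not vanish at \<open>z = y\<close>, so it cannot be differentiated under the integral sign. Splitting off
  the value of \<open>\<theta>\<close> at the fixed point \<open>x\<close> repairs this: the integral equals \<open>- \<theta>(x) \<bullet> g(y) - Q(y)\<close> with
  \<open>Q(y) = \<integral> \<rho>(z) (\<theta>(x) - \<theta>(z)) \<bullet> \<nabla>\<Phi>(y - z) dz\<close>, and in \<open>Q\<close> the weight vanishes at \<open>z = x\<close>, so that
  \<open>\<nabla>Q(x) = T\<close> (\<open>force_against_displacement_has_derivative\<close>). Since
  \<open>\<gamma>\<rho>\<^bsup>\<gamma>-2\<^esup> div(\<rho>\<theta>) = \<gamma>\<rho>\<^bsup>\<gamma>-1\<^esup> div \<theta> + \<theta> \<bullet> g\<close>, the function under the gradient in \<open>L\<theta>\<close> is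
  \<open>\<gamma>\<rho>\<^bsup>\<gamma>-1\<^esup> div \<theta> + (\<theta>(y) - \<theta>(x)) \<bullet> g(y) - Q(y)\<close> (\<open>lin_op_potential\<close>). In its gradient at \<open>x\<close> the second
  derivatives of \<open>K\<rho>\<close> are multiplied by \<open>\<theta>(x) - \<theta>(x) = 0\<close>, and what is left is minus the sum of the two
  linear parts above.

  \<^bold>\<open>What makes this rigorous.\<close> The Lane--Emden equation gives \<open>\<rho>\<^sup>-\<^sup>1 \<nabla>\<rho>\<^sup>\<gamma> = - m(|x|) x / |x|\<^sup>3\<close>, with
  \<open>m(r)\<close> the mass inside radius \<open>r\<close>, and the shell theorem, computed in spherical coordinates, gives the same
  value for \<open>- \<nabla>K\<rho>\<close> (\<open>gravity_eq_force\<close>). The spatial derivatives of potentials come from one device: the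
  Taylor remainders under the integral are at most
  \<open>C |h|\<^bsup>3/2\<^esup> (|x - z|\<^bsup>-5/2\<^esup> + |y - z|\<^bsup>-5/2\<^esup>)\<close> with \<open>h = y - x\<close>, and \<open>|x - z|\<^bsup>-5/2\<^esup>\<close> has an integral over the
  ball that is bounded uniformly in \<open>x\<close>.

  \<^bold>\<open>The second form.\<close> If \<open>div \<theta> = 0\<close> on the sphere then \<open>div(\<rho>\<theta>) = \<rho>'(R) \<theta> \<bullet> n\<close> there, and \<open>\<rho>'(R) < 0\<close>, so the
  surface integral of \<open>\<theta> \<bullet> n / |x - z|\<close> is a multiple of \<open>K\<^sub>\<partial>\<close> (\<open>lin_op_eq_lin_op_div\<close>).
\<close>


section \<open>Spherical coordinates on a ball\<close>

lemma vec3_eq: "(vector [a,b,c] :: real^3) = a *\<^sub>R axis 1 1 + b *\<^sub>R axis 2 1 + c *\<^sub>R axis 3 1"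
  by (simp add: vec_eq_iff forall_3 axis_def)

lemma Basis_real3: "(Basis :: (real^3) set) = {axis 1 1, axis 2 1, axis 3 1}"
  by (auto simp: Basis_vec_def axis_def) (metis exhaust_3)+

lemma axis3_distinct: "axis 1 1 \<noteq> (axis 2 1 :: real^3)" "axis 1 1 \<noteq> (axis 3 1 :: real^3)" "axis 2 1 \<noteq> (axis 3 1 :: real^3)"
  by (simp_all add: axis_eq_axis)

lemma continuous_vec3 [continuous_intros]:
  assumes "continuous_on S f" "continuous_on S g" "continuous_on S h"
  shows "continuous_on S (\<lambda>x. vector [f x, g x, h x] :: real^3)"
  unfolding vec3_eq by (intro continuous_intros assms)

lemma vec3_measurable: "(\<lambda>(a,b,c). vector [a,b,c] :: real^3) \<in> borel_measurable borel"
  unfolding case_prod_beta by (intro borel_measurable_continuous_onI continuous_intros)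

text \<open>
  Spherical coordinates combine a change of variables in \<open>real^3\<close> with iterated integration over a product.
  This identification of the two Lebesgue measures moves integrals from one space to the other.
\<close>

lemma lborel_vec3:
  "distr (lborel :: (real \<times> real \<times> real) measure) borel (\<lambda>(a,b,c). vector [a,b,c] :: real^3) = lborel"
    (is "distr ?L borel ?f = _")
proof (rule lborel_eqI [symmetric])
  fix l u :: "real^3" assume lu: "\<And>b. b \<in> Basis \<Longrightarrow> l \<bullet> b \<le> u \<bullet> b"
  have le: "l $ 1 \<le> u $ 1" "l $ 2 \<le> u $ 2" "l $ 3 \<le> u $ 3"
    using lu[of "axis 1 1"] lu[of "axis 2 1"] lu[of "axis 3 1"]
    by (auto simp: Basis_real3 inner_axis)
  have "?f -` box l u \<inter> space ?L = {l$1<..<u$1} \<times> {l$2<..<u$2} \<times> {l$3<..<u$3}"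
    by (auto simp: mem_box_cart forall_3)
  hence "emeasure (distr ?L borel ?f) (box l u)
      = emeasure (lborel \<Otimes>\<^sub>M (lborel \<Otimes>\<^sub>M lborel)) ({l$1<..<u$1} \<times> {l$2<..<u$2} \<times> {l$3<..<u$3})"
    using vec3_measurable by (simp add: emeasure_distr lborel_prod)
  also have "\<dots> = ennreal (u$1 - l$1) * (ennreal (u$2 - l$2) * ennreal (u$3 - l$3))"
    using le by (simp add: lborel.emeasure_pair_measure_Times lborel_pair.emeasure_pair_measure_Times)
  also have "\<dots> = ennreal (\<Prod>b\<in>Basis. (u - l) \<bullet> b)"
    using le by (simp add: Basis_real3 axis3_distinct inner_axis ennreal_mult)
  finally show "emeasure (distr ?L borel ?f) (box l u) = (\<Prod>b\<in>Basis. (u - l) \<bullet> b)" .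
qed simp

lemma lborel_vec3_integrable_iff:
  fixes f :: "real^3 \<Rightarrow> real"
  assumes "f \<in> borel_measurable borel"
  shows "integrable lborel f \<longleftrightarrow> integrable lborel (\<lambda>(a,b,c). f (vector [a,b,c]))"
proof -
  have "integrable lborel f \<longleftrightarrow>
    integrable (distr (lborel :: (real \<times> real \<times> real) measure) borel (\<lambda>(a,b,c). vector [a,b,c])) f"
    by (simp add: lborel_vec3)
  also have "\<dots> \<longleftrightarrow> integrable lborel (\<lambda>(a,b,c). f (vector [a,b,c]))"
    using assms vec3_measurable by (subst integrable_distr_eq) (auto simp: split_def)
  finally show ?thesis .
qed

lemma lborel_vec3_integral:
  fixes f :: "real^3 \<Rightarrow> real"
  assumes "f \<in> borel_measurable borel"
  shows "integral\<^sup>L lborel f = integral\<^sup>L lborel (\<lambda>(a,b,c). f (vector [a,b,c]))"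
proof -
  have "integral\<^sup>L lborel f =
    integral\<^sup>L (distr (lborel :: (real \<times> real \<times> real) measure) borel (\<lambda>(a,b,c). vector [a,b,c])) f"
    by (simp add: lborel_vec3)
  also have "\<dots> = integral\<^sup>L lborel (\<lambda>(a,b,c). f (vector [a,b,c]))"
    using assms vec3_measurable by (subst integral_distr) (auto simp: split_def)
  finally show ?thesis .
qed

definition spherical_coords :: "real^3 \<Rightarrow> real^3" where
  "spherical_coords u = sphere_point (u$1) (u$2) (u$3)"

definition spherical_coords_deriv :: "real^3 \<Rightarrow> real^3 \<Rightarrow> real^3" where
  "spherical_coords_deriv u h = vector
     [h$1 * sin (u$2) * cos (u$3) + u$1 * cos (u$2) * cos (u$3) * h$2 - u$1 * sin (u$2) * sin (u$3) * h$3,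
      h$1 * sin (u$2) * sin (u$3) + u$1 * cos (u$2) * sin (u$3) * h$2 + u$1 * sin (u$2) * cos (u$3) * h$3,
      h$1 * cos (u$2) - u$1 * sin (u$2) * h$2]"

lemma sphere_point_eq: "sphere_point r p w = vector [r * sin p * cos w, r * sin p * sin w, r * cos p]"
  by (simp add: sphere_point_def vec_eq_iff forall_3)

lemma spherical_coords_has_derivative: "(spherical_coords has_derivative spherical_coords_deriv u) (at u within S)"
  unfolding spherical_coords_def [abs_def] sphere_point_eq spherical_coords_deriv_def vec3_eq
  by (rule derivative_eq_intros bounded_linear_imp_has_derivative bounded_linear_vec_nth refl)+
     (auto simp: algebra_simps)

lemma det_spherical_coords_deriv: "det (matrix (spherical_coords_deriv u)) = (u$1)\<^sup>2 * sin (u$2)"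
proof -
  define s c s' c' where sc: "s = sin (u$2)" "c = cos (u$2)" "s' = sin (u$3)" "c' = cos (u$3)"
  have "det (matrix (spherical_coords_deriv u)) = (u$1)\<^sup>2 * s * ((s\<^sup>2 + c\<^sup>2) * (s'\<^sup>2 + c'\<^sup>2))"
    unfolding spherical_coords_deriv_def matrix_def det_3 sc [symmetric]
    by (simp add: axis_def algebra_simps power2_eq_square)
  thus ?thesis by (simp add: sc)
qed

lemma norm_sphere_point: "norm (sphere_point r p w) = \<bar>r\<bar>"
proof -
  define s c s' c' where sc: "s = sin p" "c = cos p" "s' = sin w" "c' = cos w"
  have "(norm (sphere_point r p w))\<^sup>2 = r\<^sup>2 * (s\<^sup>2 * (s'\<^sup>2 + c'\<^sup>2) + c\<^sup>2)"
    unfolding power2_norm_eq_inner sphere_point_eq sc [symmetric]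
    by (simp add: inner_vec_def sum_3 algebra_simps power2_eq_square)
  hence "(norm (sphere_point r p w))\<^sup>2 = r\<^sup>2" by (simp add: sc)
  thus ?thesis by (metis abs_norm_cancel real_sqrt_abs)
qed

lemma inj_on_spherical_coords: "inj_on spherical_coords {u. 0 < u$1 \<and> u$2 \<in> {0<..<pi} \<and> u$3 \<in> {0<..<2*pi}}"
proof (rule inj_onI)
  fix u v :: "real^3"
  assume "u \<in> {u. 0 < u$1 \<and> u$2 \<in> {0<..<pi} \<and> u$3 \<in> {0<..<2*pi}}"
    and "v \<in> {u. 0 < u$1 \<and> u$2 \<in> {0<..<pi} \<and> u$3 \<in> {0<..<2*pi}}"
  hence u: "0 < u$1" "0 < u$2" "u$2 < pi" "0 < u$3" "u$3 < 2*pi"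
    and v: "0 < v$1" "0 < v$2" "v$2 < pi" "0 < v$3" "v$3 < 2*pi" by auto
  assume eq: "spherical_coords u = spherical_coords v"
  have "norm (spherical_coords u) = norm (spherical_coords v)" by (simp only: eq)
  hence 1: "u$1 = v$1" using u(1) v(1) by (simp add: spherical_coords_def norm_sphere_point)
  have c: "(spherical_coords u)$i = (spherical_coords v)$i" for i by (simp only: eq)
  have "cos (u$2) = cos (v$2)"
    using c[of 3] 1 u(1) by (simp add: spherical_coords_def sphere_point_eq)
  hence 2: "u$2 = v$2" using u v cos_inj_pi [of "u$2" "v$2"] by linarith
  have "sin (v$2) > 0" using v by (intro sin_gt_zero) auto
  hence "cos (u$3) = cos (v$3)" "sin (u$3) = sin (v$3)"
    using c[of 1] c[of 2] v(1) unfolding spherical_coords_def sphere_point_eq 1 2 by simp_all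
  hence "cis (u$3) = cis (v$3)" by (simp add: complex_eq_iff)
  moreover have "Arg2pi (cis (u$3)) = u$3" "Arg2pi (cis (v$3)) = v$3"
    using u(4,5) v(4,5) by (auto intro!: Arg2pi_unique [of 1] simp: cis_conv_exp)
  ultimately have 3: "u$3 = v$3" by metis
  show "u = v" using 1 2 3 by (simp add: vec_eq_iff forall_3)
qed

definition spherical_box :: "real \<Rightarrow> (real^3) set" where
  "spherical_box R = {u. u$1 \<in> {0<..<R} \<and> u$2 \<in> {0<..<pi} \<and> u$3 \<in> {0<..<2*pi}}"

text \<open>
  What the coordinates miss lies in a plane, hence in a null set.
\<close>

lemma spherical_coords_image:
  "spherical_coords ` spherical_box R \<subseteq> ball 0 R" "ball 0 R - {z. z$2 = 0} \<subseteq> spherical_coords ` spherical_box R"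
proof -
  show "spherical_coords ` spherical_box R \<subseteq> ball 0 R"
    by (auto simp: spherical_box_def spherical_coords_def norm_sphere_point)
  show "ball 0 R - {z. z$2 = 0} \<subseteq> spherical_coords ` spherical_box R"
  proof
    fix z assume "z \<in> ball 0 R - {z::real^3. z$2 = 0}"
    hence zR: "z \<in> ball 0 R" and z2: "z$2 \<noteq> 0" by auto
    define r where "r = norm z"
    have r: "0 < r" "r < R" using zR z2 by (auto simp: r_def)
    have rsq: "r\<^sup>2 = (z$1)\<^sup>2 + (z$2)\<^sup>2 + (z$3)\<^sup>2"
      unfolding r_def power2_norm_eq_inner by (simp add: inner_vec_def sum_3 power2_eq_square)
    have "(z$3)\<^sup>2 < r\<^sup>2" using rsq z2 by (simp add: sum_power2_gt_zero_iff)
    hence "\<bar>z$3\<bar> < r" using r by (simp add: abs_square_less_1 power2_less_imp_less real_less_rsqrt)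
    hence q: "-1 < z$3 / r" "z$3 / r < 1" using r(1) by (simp_all add: abs_less_iff pos_less_divide_eq pos_divide_less_eq)
    define p where "p = arccos (z$3 / r)"
    have p: "0 < p" "p < pi" "cos p = z$3 / r" unfolding p_def using q arccos_lt_bounded [of "z$3/r"] by (simp_all add: cos_arccos)
    have sp: "sin p > 0" using p by (intro sin_gt_zero) auto
    have "(r * sin p)\<^sup>2 = r\<^sup>2 - (z$3)\<^sup>2"
      using r p by (simp add: power_mult_distrib sin_squared_eq power_divide algebra_simps)
    hence e: "(z$1)\<^sup>2 + (z$2)\<^sup>2 = (r * sin p)\<^sup>2" using rsq by simp
    hence "(z$1 / (r * sin p))\<^sup>2 + (z$2 / (r * sin p))\<^sup>2 = 1"
      using r sp by (simp add: power_divide flip: add_divide_distrib)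
    then obtain w where w: "0 \<le> w" "w < 2*pi" "z$1 / (r * sin p) = cos w" "z$2 / (r * sin p) = sin w"
      by (rule sincos_total_2pi)
    have "w \<noteq> 0" using w z2 r sp by auto
    have "vector [r,p,w] \<in> spherical_box R"
      using w p r \<open>w \<noteq> 0\<close> by (simp add: spherical_box_def)
    moreover have "z$1 = r * sin p * cos w" "z$2 = r * sin p * sin w" "z$3 = r * cos p"
      using w(3,4) [symmetric] p(3) r sp by simp_all
    hence "spherical_coords (vector [r,p,w]) = z"
      by (simp add: spherical_coords_def sphere_point_eq vec_eq_iff forall_3)
    ultimately
    show "z \<in> spherical_coords ` spherical_box R" by (metis image_eqI)
  qed
qed



lemma real_change_of_variables:
  fixes f :: "real^3 \<Rightarrow> real" and g :: "real^3 \<Rightarrow> real^3"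
  assumes "S \<in> sets lebesgue" "\<And>x. x \<in> S \<Longrightarrow> (g has_derivative g' x) (at x within S)" "inj_on g S"
  shows "((\<lambda>x. \<bar>det (matrix (g' x))\<bar> * f (g x)) absolutely_integrable_on S \<and>
      integral S (\<lambda>x. \<bar>det (matrix (g' x))\<bar> * f (g x)) = b)
    \<longleftrightarrow> (f absolutely_integrable_on (g ` S) \<and> integral (g ` S) f = b)"
  using has_absolute_integral_change_of_variables [OF assms, of "\<lambda>z. vec (f z) :: real^1" "vec b"]
  by (simp add: absolutely_integrable_on_1_iff integral_on_1_eq vec_eq_iff)

lemma absolutely_integrable_lborel_iff:
  fixes f :: "'a::euclidean_space \<Rightarrow> real"
  assumes "f \<in> borel_measurable borel" "S \<in> sets borel"
  shows "f absolutely_integrable_on S \<longleftrightarrow> set_integrable lborel S f"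
  using assms unfolding set_integrable_def by (subst integrable_completion) auto

text \<open>
  Integrability is transferred in both directions, because it is proved once on the side of the ball (for
  \<open>1 / |x - z|\<close>) and once on the side of the coordinates (for powers of \<open>|z|\<close>).
\<close>

lemma ball_integral_spherical_borel:
  fixes f :: "real^3 \<Rightarrow> real" and R :: real
  assumes f: "f \<in> borel_measurable borel"
  defines "Q \<equiv> {0<..<R} \<times> {0<..<pi} \<times> {0<..<2*pi}"
  defines "F \<equiv> \<lambda>(r,p,w). f (sphere_point r p w) * (r\<^sup>2 * sin p)"
  shows "set_integrable lborel (ball 0 R) f \<longleftrightarrow> set_integrable lborel Q F" (is ?A)
    and "set_lebesgue_integral lborel (ball 0 R) f = set_lebesgue_integral lborel Q F" (is ?B)
proof -
  define \<phi> where "\<phi> u = f (spherical_coords u) * ((u$1)\<^sup>2 * sin (u$2))" for u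
  have op: "open (spherical_box R)"
  proof -
    have "spherical_box R = {u. 0 < u$1} \<inter> {u. u$1 < R} \<inter> {u. 0 < u$2} \<inter> {u. u$2 < pi} \<inter> {u. 0 < u$3} \<inter> {u. u$3 < 2*pi}"
      by (auto simp: spherical_box_def)
    also have "open \<dots>" by (intro open_Int open_Collect_less continuous_intros)
    finally show ?thesis .
  qed
  have cont_coords: "continuous_on UNIV spherical_coords"
    using spherical_coords_has_derivative by (meson differentiableI differentiable_imp_continuous_on differentiable_on_def)
  hence [measurable]: "spherical_coords \<in> borel_measurable borel" by (rule borel_measurable_continuous_onI)
  have [measurable]: "(\<lambda>u::real^3. sin (u$2)) \<in> borel_measurable borel"
    by (intro borel_measurable_continuous_onI continuous_intros)
  have \<phi>: "\<phi> \<in> borel_measurable borel" unfolding \<phi>_def using f by measurable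
  have inj: "inj_on spherical_coords (spherical_box R)"
    by (rule inj_on_subset [OF inj_on_spherical_coords]) (auto simp: spherical_box_def)
  have eq\<phi>: "\<bar>det (matrix (spherical_coords_deriv x))\<bar> * f (spherical_coords x) = \<phi> x" if "x \<in> spherical_box R" for x
    using that sin_gt_zero [of "x$2"] by (auto simp: \<phi>_def det_spherical_coords_deriv abs_mult spherical_box_def)
  have cov': "(\<phi> absolutely_integrable_on spherical_box R \<and> integral (spherical_box R) \<phi> = b)
     \<longleftrightarrow> (f absolutely_integrable_on (spherical_coords ` spherical_box R) \<and> integral (spherical_coords ` spherical_box R) f = b)" for b
  proof -
    have "(\<lambda>x. \<bar>det (matrix (spherical_coords_deriv x))\<bar> * f (spherical_coords x)) absolutely_integrable_on spherical_box R \<longleftrightarrow>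
        \<phi> absolutely_integrable_on spherical_box R"
      by (rule set_integrable_cong) (auto simp: eq\<phi>)
    moreover have "integral (spherical_box R) (\<lambda>x. \<bar>det (matrix (spherical_coords_deriv x))\<bar> * f (spherical_coords x)) = integral (spherical_box R) \<phi>"
      by (rule Henstock_Kurzweil_Integration.integral_cong) (auto simp: eq\<phi>)
    ultimately show ?thesis
      using real_change_of_variables [of "spherical_box R" spherical_coords spherical_coords_deriv f b] op inj spherical_coords_has_derivative by auto
  qed
  have null: "negligible {z::real^3. z$2 = 0}"
    using negligible_hyperplane [of "axis 2 1 :: real^3" 0] by (simp add: inner_axis inner_commute axis_eq_0_iff)
  have nd: "negligible {x \<in> spherical_coords ` spherical_box R - ball 0 R. f x \<noteq> 0}" "negligible {x \<in> ball 0 R - spherical_coords ` spherical_box R. f x \<noteq> 0}"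
    using spherical_coords_image[of R] by (auto intro!: negligible_subset [OF null])
  have ai: "f absolutely_integrable_on (spherical_coords ` spherical_box R) \<longleftrightarrow> f absolutely_integrable_on ball 0 R"
    using nd by (rule absolutely_integrable_spike_set_eq)
  have ii: "integral (spherical_coords ` spherical_box R) f = integral (ball 0 R) f"
    using nd by (rule integral_spike_set)
  have key: "(set_integrable lborel (spherical_box R) \<phi> \<and> integral (spherical_box R) \<phi> = b)
     \<longleftrightarrow> (set_integrable lborel (ball 0 R) f \<and> integral (ball 0 R) f = b)" for b
    using cov' [of b] op unfolding ai ii
    by (simp add: absolutely_integrable_lborel_iff f \<phi>)
  have key1: "set_integrable lborel (spherical_box R) \<phi> \<longleftrightarrow> set_integrable lborel (ball 0 R) f"
    using key by metis
  have m: "(\<lambda>u. indicator (spherical_box R) u *\<^sub>R \<phi> u) \<in> borel_measurable borel"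
    using op \<phi> by (intro borel_measurable_scaleR borel_measurable_indicator) auto
  have e: "(\<lambda>(a,b,c). indicator (spherical_box R) (vector [a,b,c] :: real^3) *\<^sub>R \<phi> (vector [a,b,c])) = (\<lambda>x. indicator Q x *\<^sub>R F x)"
    by (auto simp: fun_eq_iff Q_def F_def \<phi>_def spherical_box_def spherical_coords_def indicator_def)
  have key2: "set_integrable lborel (spherical_box R) \<phi> \<longleftrightarrow> set_integrable lborel Q F"
    using lborel_vec3_integrable_iff [OF m] unfolding set_integrable_def e by simp
  have key3: "set_lebesgue_integral lborel (spherical_box R) \<phi> = set_lebesgue_integral lborel Q F"
    using lborel_vec3_integral [OF m] unfolding set_lebesgue_integral_def e by simp
  show ?A using key1 key2 by simp
  show ?B
  proof (cases "set_integrable lborel (ball 0 R) f")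
    case True
    hence "set_integrable lborel (spherical_box R) \<phi>" using key1 by simp
    with True show ?thesis
      using key key3 by (metis set_borel_integral_eq_integral(2))
  next
    case False
    hence "\<not> set_integrable lborel Q F" using key1 key2 by simp
    with False show ?thesis
      unfolding set_integrable_def set_lebesgue_integral_def by (simp add: not_integrable_integral_eq)
  qed
qed

text \<open>
  The same for integrands whose measurability is known on the ball only.
\<close>

lemma ball_integral_spherical:
  fixes f :: "real^3 \<Rightarrow> real" and R :: real
  assumes f: "set_borel_measurable borel (ball 0 R) f"
  defines "Q \<equiv> {0<..<R} \<times> {0<..<pi} \<times> {0<..<2*pi}"
  defines "F \<equiv> \<lambda>(r,p,w). f (sphere_point r p w) * (r\<^sup>2 * sin p)"
  shows "set_integrable lborel (ball 0 R) f \<longleftrightarrow> set_integrable lborel Q F" (is ?A)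
    and "set_lebesgue_integral lborel (ball 0 R) f = set_lebesgue_integral lborel Q F" (is ?B)
proof -
  define g where "g = (\<lambda>z. indicator (ball 0 R) z *\<^sub>R f z)"
  have g: "g \<in> borel_measurable borel" using f by (simp add: g_def set_borel_measurable_def)
  let ?G = "\<lambda>(r,p,w). g (sphere_point r p w) * (r\<^sup>2 * sin p)"
  have eq: "x \<in> Q \<Longrightarrow> ?G x = F x" for x
    by (auto simp: Q_def F_def g_def norm_sphere_point)
  have 1: "set_integrable lborel (ball 0 R) f = set_integrable lborel (ball 0 R) g"
    "set_lebesgue_integral lborel (ball 0 R) f = set_lebesgue_integral lborel (ball 0 R) g"
    by (simp_all add: g_def set_integrable_def set_lebesgue_integral_def mult.assoc [symmetric] flip: indicator_inter_arith)
  have Q: "Q \<in> sets lborel"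
    unfolding Q_def by (auto intro!: borel_open open_Times)
  have 2: "set_integrable lborel Q ?G = set_integrable lborel Q F"
    using eq by (intro set_integrable_cong) auto
  have 3: "set_lebesgue_integral lborel Q ?G = set_lebesgue_integral lborel Q F"
    using eq Q by (intro set_lebesgue_integral_cong) auto
  show ?A using ball_integral_spherical_borel(1) [OF g, of R] 2 unfolding 1 Q_def by blast
  show ?B using ball_integral_spherical_borel(2) [OF g, of R] 3 unfolding 1 Q_def by (rule trans)
qed

lemma integrable_lborel_mult:
  fixes f :: "'a::euclidean_space \<Rightarrow> real" and g :: "'b::euclidean_space \<Rightarrow> real"
  assumes f: "integrable lborel f" and g: "integrable lborel g"
  shows "integrable lborel (\<lambda>(x,y). f x * g y)"
proof -
  have [measurable]: "f \<in> borel_measurable borel" "g \<in> borel_measurable borel"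
    using f g by (auto dest: borel_measurable_integrable)
  have "integrable (lborel \<Otimes>\<^sub>M lborel) (\<lambda>(x,y). f x * g y)"
  proof (rule lborel_pair.Fubini_integrable)
    show "(\<lambda>(x,y). f x * g y) \<in> borel_measurable (lborel \<Otimes>\<^sub>M lborel)" by measurable
    show "integrable lborel (\<lambda>x. LBINT y. norm (case (x,y) of (x,y) \<Rightarrow> f x * g y))"
      using f by (simp add: abs_mult)
    show "AE x in lborel. integrable lborel (\<lambda>y. case (x,y) of (x,y) \<Rightarrow> f x * g y)"
      using g by simp
  qed
  thus ?thesis by (simp add: lborel_prod)
qed

lemma borel_measurable_norm_powr [measurable]:
  fixes f :: "'a \<Rightarrow> 'b::euclidean_space"
  assumes "f \<in> borel_measurable M"
  shows "(\<lambda>z. norm (f z) powr s) \<in> borel_measurable M"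
  using measurable_abs_powr [of "\<lambda>z. norm (f z)" M s] assms by simp

text \<open>
  In spherical coordinates the integrand is \<open>r\<^bsup>s+2\<^esup> sin \<phi>\<close>, and \<open>s + 2 > - 1\<close>.
\<close>

lemma integrable_norm_powr_ball:
  assumes "-3 < s" "s < 0"
  shows "set_integrable lborel (ball (0::real^3) R) (\<lambda>z. norm z powr s)"
proof (cases "R > 0")
  case False
  hence "ball (0::real^3) R = {}" by simp
  thus ?thesis by (simp only: set_integrable_empty)
next
  case True
  have m: "set_borel_measurable borel (ball (0::real^3) R) (\<lambda>z. norm z powr s)"
    unfolding set_borel_measurable_def by (intro borel_measurable_scaleR borel_measurable_indicator borel_measurable_norm_powr) auto
  have 1: "set_integrable lborel {0<..<R} (\<lambda>r. r powr (s+2))"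
  proof -
    have "(\<lambda>r. r powr (s+2)) integrable_on {0..R}"
      using has_integral_powr_from_0 [of "s+2" R] assms True by (auto simp: has_integral_iff)
    hence "(\<lambda>r. r powr (s+2)) absolutely_integrable_on {0..R}"
      by (rule nonnegative_absolutely_integrable_1) auto
    hence "set_integrable lborel {0..R} (\<lambda>r. r powr (s+2))"
      by (subst (asm) absolutely_integrable_lborel_iff) auto
    thus ?thesis by (rule set_integrable_subset) auto
  qed
  have 2: "set_integrable lborel ({0<..<pi} \<times> {0<..<2*pi}) (\<lambda>(p::real,w::real). sin p)"
  proof -
    have "set_integrable lborel ({0..pi} \<times> {0..2*pi}) (\<lambda>(p::real,w::real). sin p)"
      unfolding set_integrable_def case_prod_beta
      by (intro borel_integrable_compact compact_Times continuous_intros) auto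
    thus ?thesis by (rule set_integrable_subset) (auto intro!: borel_open open_Times)
  qed
  have "integrable lborel (\<lambda>(r,x). (indicator {0<..<R} r *\<^sub>R r powr (s+2)) *
      (indicator ({0<..<pi} \<times> {0<..<2*pi}) x *\<^sub>R (\<lambda>(p::real,w::real). sin p) x))"
    using 1 2 unfolding set_integrable_def by (rule integrable_lborel_mult)
  also have "(\<lambda>(r,x). (indicator {0<..<R} r *\<^sub>R r powr (s+2)) *
      (indicator ({0<..<pi} \<times> {0<..<2*pi}) x *\<^sub>R (\<lambda>(p::real,w::real). sin p) x)) =
      (\<lambda>x. indicator ({0<..<R} \<times> {0<..<pi} \<times> {0<..<2*pi}) x *\<^sub>R
         (\<lambda>(r,p,w). norm (sphere_point r p w) powr s * (r\<^sup>2 * sin p)) x)"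
    by (auto simp: fun_eq_iff indicator_def norm_sphere_point powr_add)
  finally have "set_integrable lborel ({0<..<R} \<times> {0<..<pi} \<times> {0<..<2*pi})
      (\<lambda>(r,p,w). norm (sphere_point r p w) powr s * (r\<^sup>2 * sin p))"
    unfolding set_integrable_def .
  thus ?thesis using ball_integral_spherical(1) [OF m] by blast
qed


lemma integrable_lborel_translate:
  fixes f :: "'a::euclidean_space \<Rightarrow> real"
  assumes f: "integrable lborel f"
  shows "integrable lborel (\<lambda>z. f (z - x))" "(LBINT z. f (z - x)) = (LBINT z. f z)"
proof -
  have [measurable]: "f \<in> borel_measurable borel"
    using f by (auto dest: borel_measurable_integrable)
  have "integrable (distr lborel borel ((+) (-x))) f" using f by (simp add: lborel_distr_plus)
  thus "integrable lborel (\<lambda>z. f (z - x))"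
    by (subst (asm) integrable_distr_eq) auto
  have "(LBINT z. f z) = integral\<^sup>L (distr lborel borel ((+) (-x))) f" by (simp add: lborel_distr_plus)
  thus "(LBINT z. f (z - x)) = (LBINT z. f z)"
    by (subst (asm) integral_distr) auto
qed

text \<open>
  Uniformity in the centre is what turns pointwise remainder estimates into differentiability of the
  potentials: a ball of radius \<open>R\<close> around the origin lies in the ball of radius \<open>2R\<close> around \<open>x\<close>, and the
  integral over the latter does not depend on \<open>x\<close>.
\<close>

lemma Riesz_kernel_bound:
  assumes s: "-3 < s" "s < 0"
  obtains C where "0 \<le> C" "\<And>x::real^3. x \<in> cball 0 R \<Longrightarrow> set_integrable lborel (ball 0 R) (\<lambda>z. norm (x - z) powr s)"
    "\<And>x::real^3. x \<in> cball 0 R \<Longrightarrow> (LBINT z:ball 0 R. norm (x - z) powr s) \<le> C"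
proof -
  define f where "f = (\<lambda>z::real^3. indicator (ball 0 (2*R)) z *\<^sub>R norm z powr s)"
  have f: "integrable lborel f"
    unfolding f_def using integrable_norm_powr_ball [OF s] by (simp add: set_integrable_def)
  have le: "indicator (ball 0 R) z *\<^sub>R norm (x - z) powr s \<le> f (z - x)" if "x \<in> cball 0 R" for x z :: "real^3"
  proof -
    have "z \<in> ball 0 R \<Longrightarrow> norm (z - x) < 2 * R"
      using that norm_triangle_ineq4 [of z x] by auto
    thus ?thesis by (auto simp: f_def indicator_def norm_minus_commute)
  qed
  have int: "set_integrable lborel (ball 0 R) (\<lambda>z. norm (x - z) powr s)" if "x \<in> cball 0 R" for x :: "real^3"
    unfolding set_integrable_def
  proof (rule Bochner_Integration.integrable_bound [OF integrable_lborel_translate(1) [OF f, of x]])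
    show "(\<lambda>z. indicator (ball 0 R) z *\<^sub>R norm (x - z) powr s) \<in> borel_measurable lborel"
      by (intro borel_measurable_scaleR borel_measurable_indicator borel_measurable_norm_powr) auto
    show "AE z in lborel. norm (indicator (ball 0 R) z *\<^sub>R norm (x - z) powr s) \<le> norm (f (z - x))"
      using le [OF that] by (intro AE_I2) (simp add: order_trans [OF _ abs_ge_self])
  qed
  show ?thesis
  proof (rule that [of "LBINT z. f z"])
    show "0 \<le> (LBINT z. f z)" by (auto simp: f_def)
    fix x :: "real^3" assume x: "x \<in> cball 0 R"
    show "set_integrable lborel (ball 0 R) (\<lambda>z. norm (x - z) powr s)" by (rule int [OF x])
    show "(LBINT z:ball 0 R. norm (x - z) powr s) \<le> (LBINT z. f z)"
      unfolding set_lebesgue_integral_def integrable_lborel_translate(2) [OF f, of x, symmetric]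
      using int [OF x] unfolding set_integrable_def
      by (intro integral_mono integrable_lborel_translate(1) [OF f] le x)
  qed
qed



section \<open>Derivatives relative to the closed ball\<close>

text \<open>
  The operators are defined through derivatives relative to the closed ball. On the boundary sphere not
  every coordinate direction points into the ball, but the directions that do contain an open set, and two
  linear maps that agree on an open set are equal.
\<close>

lemma has_derivative_unique_convex:
  fixes f :: "'a::euclidean_space \<Rightarrow> 'b::real_normed_vector"
  assumes S: "convex S" "interior S \<noteq> {}" and x: "x \<in> S"
    and f': "(f has_derivative f') (at x within S)" and f'': "(f has_derivative f'') (at x within S)"
  shows "f' = f''"
proof -
  define L where "L h = f' h - f'' h" for h
  have L: "((\<lambda>x. 0) has_derivative L) (at x within S)"
    using has_derivative_diff [OF f' f''] by (simp add: L_def [abs_def])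
  interpret L: bounded_linear L using L by (rule has_derivative_bounded_linear)
  have *: "L (y - x) = 0" if y: "y \<in> S" for y
  proof -
    have "((\<lambda>t. x + t *\<^sub>R (y - x)) has_derivative (\<lambda>t. t *\<^sub>R (y - x))) (at 0 within {0..1})"
      by (auto intro!: derivative_eq_intros)
    moreover have "(\<lambda>t. x + t *\<^sub>R (y - x)) ` {0..1} \<subseteq> S"
    proof clarify
      fix t :: real assume "t \<in> {0..1}"
      hence "(1 - t) *\<^sub>R x + t *\<^sub>R y \<in> S" using S(1) x y by (intro convexD) auto
      thus "x + t *\<^sub>R (y - x) \<in> S" by (simp add: algebra_simps)
    qed
    hence "((\<lambda>x. 0) has_derivative L) (at (x + 0 *\<^sub>R (y - x)) within (\<lambda>t. x + t *\<^sub>R (y - x)) ` {0..1})"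
      using L by (auto intro: has_derivative_subset)
    ultimately have "((\<lambda>t. 0) has_derivative (\<lambda>t. L (t *\<^sub>R (y - x)))) (at 0 within {0..1})"
      by (rule has_derivative_in_compose)
    hence "((\<lambda>t. 0) has_vector_derivative L (y - x)) (at (0::real) within {0..1})"
      by (simp add: has_vector_derivative_def L.scaleR)
    moreover have "((\<lambda>t. 0::'b) has_vector_derivative 0) (at (0::real) within {0..1})" by simp
    ultimately show ?thesis
      using vector_derivative_unique_within_closed_interval [of 0 1 0 "\<lambda>t. 0::'b" "L (y - x)" 0] by simp
  qed
  obtain p e where e: "e > 0" "ball p e \<subseteq> S"
    using S(2) by (auto simp: mem_interior)
  have "L h = 0" for h
  proof (cases "h = 0")
    case False
    define k where "k = (e / (2 * norm h)) *\<^sub>R h"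
    have "p + k \<in> S" "p \<in> S" using e False by (auto simp: k_def dist_norm intro!: subsetD [OF e(2)])
    hence "L (p + k - x) = 0" "L (p - x) = 0" by (simp_all only: *)
    moreover have "L k = L (p + k - x) - L (p - x)" by (simp flip: L.diff)
    ultimately have "L k = 0" by simp
    thus ?thesis using e False by (simp add: k_def L.scaleR)
  qed (simp add: L.zero)
  thus ?thesis by (simp add: L_def fun_eq_iff)
qed

lemma frechet_derivative_cball:
  fixes f :: "'a::euclidean_space \<Rightarrow> 'b::real_normed_vector"
  assumes R: "0 < R" and x: "x \<in> cball 0 R" and f: "(f has_derivative f') (at x within cball 0 R)"
  shows "frechet_derivative f (at x within cball 0 R) = f'"
proof -
  have "(f has_derivative frechet_derivative f (at x within cball 0 R)) (at x within cball 0 R)"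
    using f by (metis differentiableI frechet_derivative_works)
  thus ?thesis using has_derivative_unique_convex [OF _ _ x _ f] R by simp
qed

lemma partial_on_eq:
  assumes "0 < R" "x \<in> cball 0 R" "(f has_derivative f') (at x within cball 0 R)"
  shows "partial_on (cball 0 R) k f x = f' (axis k 1)"
  using frechet_derivative_cball [OF assms] by (simp add: partial_on_def)

lemma div_on_eq:
  assumes "0 < R" "x \<in> cball 0 R" "(F has_derivative F') (at x within cball 0 R)"
  shows "div_on (cball 0 R) F x = (\<Sum>k\<in>UNIV. F' (axis k 1) $ k)"
  unfolding div_on_def
  by (intro sum.cong refl partial_on_eq [OF assms(1,2)])
     (rule bounded_linear.has_derivative [OF bounded_linear_vec_nth assms(3)])

section \<open>The divergence theorem on a ball\<close>

lemma set_integral_FTC: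
  fixes f F :: "real \<Rightarrow> real"
  assumes "a \<le> b" "continuous_on {a..b} f"
    and "\<And>x. x \<in> {a..b} \<Longrightarrow> (F has_real_derivative f x) (at x within {a..b})"
  shows "(LBINT x:{a<..<b}. f x) = F b - F a"
proof -
  have "(LBINT x=a..b. f x) = F b - F a"
    using assms by (intro interval_integral_FTC_finite)
      (auto simp: has_real_derivative_iff_has_vector_derivative min_def max_def)
  thus ?thesis using assms(1) by (simp add: interval_lebesgue_integral_def)
qed

text \<open>
  The orthonormal frame of spherical coordinates: radial, polar and azimuthal directions.
\<close>

definition e_r :: "real \<Rightarrow> real \<Rightarrow> real^3" where "e_r p w = vector [sin p * cos w, sin p * sin w, cos p]"
definition e_p :: "real \<Rightarrow> real \<Rightarrow> real^3" where "e_p p w = vector [cos p * cos w, cos p * sin w, - sin p]"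
definition e_w :: "real \<Rightarrow> real^3" where "e_w w = vector [- sin w, cos w, 0]"

lemma sphere_point_e_r: "sphere_point r p w = r *\<^sub>R e_r p w"
  by (simp add: sphere_point_def e_r_def)

text \<open>
  The trace does not depend on the orthonormal basis. This brings the divergence into the moving frame.
\<close>

lemma trace_spherical_frame:
  fixes L :: "real^3 \<Rightarrow> real^3"
  assumes "linear L"
  shows "(\<Sum>k\<in>UNIV. L (axis k 1) $ k) = L (e_r p w) \<bullet> e_r p w + L (e_p p w) \<bullet> e_p p w + L (e_w w) \<bullet> e_w w"
proof -
  define m where "m i j = L (axis j 1) $ i" for i j
  define sn1 cs1 sn2 cs2 where sc: "sn1 = sin p" "cs1 = cos p" "sn2 = sin w" "cs2 = cos w"
  have 1: "sn1\<^sup>2 + cs1\<^sup>2 = 1" "sn2\<^sup>2 + cs2\<^sup>2 = 1" by (simp_all add: sc)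
  have L: "L (vector [a,b,d]) = vector [m 1 1  *  a + m 1 2  *  b + m 1 3  *  d, m 2 1  *  a + m 2 2  *  b + m 2 3  *  d, m 3 1  *  a + m 3 2  *  b + m 3 3  *  d]" for a b d
    using assms by (simp add: vec3_eq linear_add linear_scale vec_eq_iff forall_3 m_def axis_def)
  have o: "(sn1 * cs2) * (sn1 * cs2) + (cs1 * cs2) * (cs1 * cs2) + sn2 * sn2 = 1" "(sn1 * sn2) * (sn1 * sn2) + (cs1 * sn2) * (cs1 * sn2) + cs2 * cs2 = 1"
     "cs1 * cs1 + sn1 * sn1 = 1" "(sn1 * cs2) * (sn1 * sn2) + (cs1 * cs2) * (cs1 * sn2) - sn2 * cs2 = 0"
    using 1 by algebra+
  have "L (e_r p w) \<bullet> e_r p w + L (e_p p w) \<bullet> e_p p w + L (e_w w) \<bullet> e_w w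
    = m 1 1  *  ((sn1 * cs2) * (sn1 * cs2) + (cs1 * cs2) * (cs1 * cs2) + sn2 * sn2) + m 2 2  *  ((sn1 * sn2) * (sn1 * sn2) + (cs1 * sn2) * (cs1 * sn2) + cs2 * cs2)
      + m 3 3  *  (cs1 * cs1 + sn1 * sn1) + (m 1 2 + m 2 1)  *  ((sn1 * cs2) * (sn1 * sn2) + (cs1 * cs2) * (cs1 * sn2) - sn2 * cs2)"
    unfolding e_r_def e_p_def e_w_def L sc [symmetric]
    by (simp add: inner_vec_def sum_3 algebra_simps)
  also have "\<dots> = m 1 1 + m 2 2 + m 3 3" unfolding o by simp
  finally show ?thesis by (simp add: sum_3 m_def)
qed



lemma has_vector_derivative_along_path:
  fixes v :: "'a::real_normed_vector \<Rightarrow> 'b::real_normed_vector"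
  assumes v: "(v has_derivative v') (at (g t) within S)" and g: "(g has_vector_derivative g') (at t within T)"
    and "g ` T \<subseteq> S"
  shows "((\<lambda>t. v (g t)) has_vector_derivative v' g') (at t within T)"
proof -
  interpret v': bounded_linear v' using v by (rule has_derivative_bounded_linear)
  have "(v has_derivative v') (at (g t) within g ` T)" using v assms(3) by (rule has_derivative_subset)
  from has_derivative_in_compose [OF g [unfolded has_vector_derivative_def] this]
  show ?thesis by (simp add: has_vector_derivative_def v'.scaleR)
qed

lemma spherical_frame_derivs:
  "((\<lambda>p. e_r p w) has_vector_derivative e_p p w) (at p within T)"
  "((\<lambda>p. e_p p w) has_vector_derivative - e_r p w) (at p within T)"
  "((\<lambda>w. e_r p w) has_vector_derivative sin p *\<^sub>R e_w w) (at w within T)"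
  "(e_w has_vector_derivative - (sin p *\<^sub>R e_r p w + cos p *\<^sub>R e_p p w)) (at w within T)"
proof -
  show "((\<lambda>p. e_r p w) has_vector_derivative e_p p w) (at p within T)"
    unfolding e_r_def e_p_def vec3_eq has_vector_derivative_def
    by (auto intro!: derivative_eq_intros simp: algebra_simps)
  show "((\<lambda>p. e_p p w) has_vector_derivative - e_r p w) (at p within T)"
    unfolding e_r_def e_p_def vec3_eq has_vector_derivative_def
    by (auto intro!: derivative_eq_intros simp: algebra_simps)
  show "((\<lambda>w. e_r p w) has_vector_derivative sin p *\<^sub>R e_w w) (at w within T)"
    unfolding e_r_def e_w_def vec3_eq has_vector_derivative_def
    by (auto intro!: derivative_eq_intros simp: algebra_simps)
  have "(e_w has_vector_derivative vector [- cos w, - sin w, 0]) (at w within T)"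
    unfolding e_w_def [abs_def] vec3_eq has_vector_derivative_def
    by (auto intro!: derivative_eq_intros simp: algebra_simps)
  also have "vector [- cos w, - sin w, 0] = - (sin p *\<^sub>R e_r p w + cos p *\<^sub>R e_p p w)"
  proof -
    have "sin p * sin p + cos p * cos p = 1" by (simp flip: power2_eq_square)
    hence k: "cos p * (cos p * a) + sin p * (sin p * a) = a" "cos p * (cos p * a) + a * (sin p * sin p) = a" for a
      by algebra+
    show ?thesis by (simp add: e_r_def e_p_def vec_eq_iff forall_3 algebra_simps k)
  qed
  finally show "(e_w has_vector_derivative - (sin p *\<^sub>R e_r p w + cos p *\<^sub>R e_p p w)) (at w within T)" .
qed

lemma continuous_e [continuous_intros]:
  fixes f g :: "'a::t2_space \<Rightarrow> real"
  assumes "continuous_on S f" "continuous_on S g"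
  shows "continuous_on S (\<lambda>x. e_r (f x) (g x))" "continuous_on S (\<lambda>x. e_p (f x) (g x))"
  unfolding e_r_def e_p_def by (intro continuous_intros assms)+

lemma continuous_e_w [continuous_intros]:
  fixes f :: "'a::t2_space \<Rightarrow> real"
  assumes "continuous_on S f"
  shows "continuous_on S (\<lambda>x. e_w (f x))"
  unfolding e_w_def by (intro continuous_intros assms)

lemma set_integral_iterate:
  fixes f :: "'a::euclidean_space \<times> 'b::euclidean_space \<Rightarrow> real"
  assumes "set_integrable lborel (A \<times> B) f"
  shows "(LBINT x:A \<times> B. f x) = (LBINT x:A. LBINT y:B. f (x, y))"
    and "(LBINT x:A \<times> B. f x) = (LBINT y:B. LBINT x:A. f (x, y))"
proof -
  have i: "integrable (lborel \<Otimes>\<^sub>M lborel) (\<lambda>x. indicator (A \<times> B) x *\<^sub>R f x)"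
    using assms by (simp add: set_integrable_def lborel_prod)
  have "(LBINT x:A \<times> B. f x) = (LBINT x. LBINT y. indicator (A \<times> B) (x, y) *\<^sub>R f (x, y))"
    using lborel_pair.integral_fst' [OF i] by (simp add: set_lebesgue_integral_def lborel_prod)
  also have "\<dots> = (LBINT x:A. LBINT y:B. f (x, y))"
    unfolding set_lebesgue_integral_def
    by (intro Bochner_Integration.integral_cong refl) (auto simp: indicator_times mult.assoc)
  finally show "(LBINT x:A \<times> B. f x) = (LBINT x:A. LBINT y:B. f (x, y))" .
  have "(LBINT x:A \<times> B. f x) = (LBINT y. LBINT x. indicator (A \<times> B) (x, y) *\<^sub>R f (x, y))"
    using lborel_pair.integral_snd [of "\<lambda>x y. indicator (A \<times> B) (x, y) *\<^sub>R f (x, y)"] i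
    by (simp add: set_lebesgue_integral_def lborel_prod case_prod_unfold)
  also have "\<dots> = (LBINT y:B. LBINT x:A. f (x, y))"
        unfolding set_lebesgue_integral_def
  proof (intro Bochner_Integration.integral_cong refl)
    fix y
    show "(LBINT x. indicator (A \<times> B) (x, y) *\<^sub>R f (x, y)) = indicator B y *\<^sub>R (LBINT x. indicator A x *\<^sub>R f (x, y))"
      by (cases "y \<in> B") (simp_all add: indicator_times)
  qed
  finally show "(LBINT x:A \<times> B. f x) = (LBINT y:B. LBINT x:A. f (x, y))" .
qed



lemma set_integrable_open_box:
  fixes g :: "real \<times> real \<times> real \<Rightarrow> real"
  assumes "continuous_on ({a..b} \<times> {c..d} \<times> {e..f}) g"
  shows "set_integrable lborel ({a<..<b} \<times> {c<..<d} \<times> {e<..<f}) g"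
proof -
  have "set_integrable lborel ({a..b} \<times> {c..d} \<times> {e..f}) g"
    unfolding set_integrable_def using assms by (intro borel_integrable_compact compact_Times) auto
  thus ?thesis by (rule set_integrable_subset) (auto intro!: borel_open open_Times)
qed

text \<open>
  Continuity on the sphere is used for measurability: passing to the open box discards a null set, and this
  leaves the integral unchanged only for measurable integrands.
\<close>

lemma sphere_integral_open_box:
  assumes "0 \<le> R" "continuous_on (sphere 0 R) f"
  shows "sphere_integral R f = (LBINT x:{0<..<pi} \<times> {0<..<2 * pi}. (\<lambda>(\<phi>, \<omega>). f (sphere_point R \<phi> \<omega>) * (R\<^sup>2 * sin \<phi>)) x)"
proof -
  let ?g = "\<lambda>(\<phi>, \<omega>). f (sphere_point R \<phi> \<omega>) * (R\<^sup>2 * sin \<phi>)"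
  let ?C = "{0..pi} \<times> {0..2 * pi}" and ?O = "{0<..<pi} \<times> {0<..<2 * pi}"
  have c: "continuous_on UNIV ?g"
    unfolding case_prod_beta sphere_point_e_r
    by (intro continuous_intros continuous_on_compose2 [OF assms(2)])
       (use assms(1) in \<open>auto simp: sphere_point_e_r [symmetric] norm_sphere_point\<close>)
  have "negligible (cbox (0,0) (pi, 2*pi) - box (0,0) (pi, 2 * pi))"
    by (rule negligible_frontier_interval)
  hence "cbox (0,0) (pi, 2*pi) - box (0,0) (pi, 2 * pi) \<in> null_sets lborel"
    by (simp add: negligible_iff_null_sets null_sets_completion_iff)
  hence N: "AE x in lborel. x \<notin> cbox (0,0) (pi, 2*pi) - box (0,0) (pi, 2 * pi)"
    by (rule AE_not_in)
  have m: "set_borel_measurable lborel S ?g" if "S \<in> sets borel" for S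
    unfolding set_borel_measurable_def using borel_measurable_continuous_onI [OF c] that
    by (intro borel_measurable_scaleR borel_measurable_indicator) auto
  have CO: "?C = cbox (0,0) (pi,2*pi)" "?O = box (0,0) (pi,2*pi)"
    by (auto simp: cbox_Pair_eq box_def Basis_prod_def)
  have ae: "AE x in lborel. (x \<in> ?O) = (x \<in> ?C)"
    unfolding CO using N by (elim eventually_mono) (use box_subset_cbox in fastforce)
  have "?C \<in> sets borel" "?O \<in> sets borel" unfolding CO by auto
  thus ?thesis
    unfolding sphere_integral_def by (intro set_integral_cong_set [OF m m ae])
qed

lemma set_integral_eq_0:
  assumes "\<And>x. x \<in> A \<Longrightarrow> f x = 0"
  shows "(LBINT x:A. f x) = 0"
proof -
  have "(\<lambda>x. indicator A x *\<^sub>R f x) = (\<lambda>x. 0)" using assms by (auto simp: fun_eq_iff indicator_def)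
  thus ?thesis by (simp add: set_lebesgue_integral_def)
qed

lemma C1_onE:
  assumes "C1_on S f"
  obtains f' :: "'a::real_normed_vector \<Rightarrow> 'a \<Rightarrow>\<^sub>L 'b::real_normed_vector"
    where "\<And>x. x \<in> S \<Longrightarrow> (f has_derivative blinfun_apply (f' x)) (at x within S)" "continuous_on S f'"
  using assms unfolding C1_on_def by blast

text \<open>
  In spherical coordinates the divergence times the area factor is a sum of three pure derivatives,
  \<open>r\<^sup>2 sin \<phi> div v = \<partial>\<^sub>r(r\<^sup>2 sin \<phi> v \<bullet> e\<^sub>r) + \<partial>\<^sub>\<phi>(r sin \<phi> v \<bullet> e\<^sub>\<phi>) + \<partial>\<^sub>\<omega>(r v \<bullet> e\<^sub>\<omega>)\<close>. Integrating each term first in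
  its own variable, the radial one leaves the flux through the sphere, the polar one vanishes because
  \<open>sin \<phi> = 0\<close> at both poles, and the azimuthal one by periodicity.
\<close>

theorem divergence_theorem_ball:
  fixes v :: "real^3 \<Rightarrow> real^3"
  assumes R: "0 < R" and v: "C1_on (cball 0 R) v"
  shows "(LBINT z:ball 0 R. div_on (cball 0 R) v z) = sphere_flux R v"
proof -
  obtain D where D: "\<And>x. x \<in> cball 0 R \<Longrightarrow> (v has_derivative blinfun_apply (D x)) (at x within cball 0 R)"
    and cD: "continuous_on (cball 0 R) D"
    using C1_onE [OF v] by metis
  have cv: "continuous_on (cball 0 R) v"
    using D by (meson continuous_on_eq_continuous_within has_derivative_continuous)
  define K where "K = {0..R} \<times> {0..pi} \<times> {0..2*pi}"
  define Q where "Q = {0<..<R} \<times> {0<..<pi} \<times> {0<..<2*pi}"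
  let ?X = "\<lambda>r p w. r *\<^sub>R e_r p w"
  have nr: "norm (e_r p w) = 1" for p w
    using norm_sphere_point [of 1 p w] by (simp add: sphere_point_e_r)
  have X: "?X r p w \<in> cball 0 R" if "r \<in> {0..R}" for r p w
    using that by (simp add: nr)
  \<comment> \<open>\<open>a\<close>, \<open>b\<close>, \<open>c\<close> are the three quantities under the derivatives, \<open>a'\<close>, \<open>b'\<close>, \<open>c'\<close> their partial derivatives.\<close>
  define a where "a r p w = r * r * sin p * (v (?X r p w) \<bullet> e_r p w)" for r p w
  define b where "b r p w = r * sin p * (v (?X r p w) \<bullet> e_p p w)" for r p w
  define c where "c r p w = r * (v (?X r p w) \<bullet> e_w w)" for r p w
  define a' where "a' r p w = 2 * r * sin p * (v (?X r p w) \<bullet> e_r p w)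
      + r * r * sin p * (D (?X r p w) (e_r p w) \<bullet> e_r p w)" for r p w
  define b' where "b' r p w = r * cos p * (v (?X r p w) \<bullet> e_p p w)
      + r * sin p * (D (?X r p w) (r *\<^sub>R e_p p w) \<bullet> e_p p w - v (?X r p w) \<bullet> e_r p w)" for r p w
  define c' where "c' r p w = r * (D (?X r p w) (r *\<^sub>R sin p *\<^sub>R e_w w) \<bullet> e_w w
      - v (?X r p w) \<bullet> (sin p *\<^sub>R e_r p w + cos p *\<^sub>R e_p p w))" for r p w
  have vr: "((\<lambda>r. v (?X r p w)) has_vector_derivative D (?X r p w) (e_r p w)) (at r within {0..R})"
    if "r \<in> {0..R}" for r p w
  proof (rule has_vector_derivative_along_path [OF D])
    show "((\<lambda>r. ?X r p w) has_vector_derivative e_r p w) (at r within {0..R})"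
      by (auto intro!: derivative_eq_intros simp: has_vector_derivative_def)
  qed (use X that in auto)
  have vp: "((\<lambda>p. v (?X r p w)) has_vector_derivative D (?X r p w) (r *\<^sub>R e_p p w)) (at p within {0..pi})"
    if "r \<in> {0..R}" for r p w
  proof (rule has_vector_derivative_along_path [OF D])
    show "((\<lambda>p. ?X r p w) has_vector_derivative r *\<^sub>R e_p p w) (at p within {0..pi})"
      by (intro bounded_linear.has_vector_derivative [OF bounded_linear_scaleR_right] spherical_frame_derivs)
  qed (use X that in auto)
  have vw: "((\<lambda>w. v (?X r p w)) has_vector_derivative D (?X r p w) (r *\<^sub>R sin p *\<^sub>R e_w w)) (at w within {0..2*pi})"
    if "r \<in> {0..R}" for r p w
  proof (rule has_vector_derivative_along_path [OF D])
    show "((\<lambda>w. ?X r p w) has_vector_derivative r *\<^sub>R sin p *\<^sub>R e_w w) (at w within {0..2*pi})"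
      by (intro bounded_linear.has_vector_derivative [OF bounded_linear_scaleR_right] spherical_frame_derivs)
  qed (use X that in auto)
  note inner_der = bounded_bilinear.has_vector_derivative [OF bounded_bilinear_inner]
  have da: "((\<lambda>r. a r p w) has_real_derivative a' r p w) (at r within {0..R})" if "r \<in> {0..R}" for r p w
  proof -
    have "((\<lambda>r. v (?X r p w) \<bullet> e_r p w) has_real_derivative (D (?X r p w) (e_r p w) \<bullet> e_r p w)) (at r within {0..R})"
      using inner_der [OF vr [OF that] has_vector_derivative_const]
      by (simp add: has_real_derivative_iff_has_vector_derivative)
    thus ?thesis unfolding a_def a'_def by (auto intro!: derivative_eq_intros)
  qed
  have db: "((\<lambda>p. b r p w) has_real_derivative b' r p w) (at p within {0..pi})" if "r \<in> {0..R}" for r p w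
  proof -
    have "((\<lambda>p. v (?X r p w) \<bullet> e_p p w) has_real_derivative
        (D (?X r p w) (r *\<^sub>R e_p p w) \<bullet> e_p p w - v (?X r p w) \<bullet> e_r p w)) (at p within {0..pi})"
      using inner_der [OF vp [OF that] spherical_frame_derivs(2)]
      by (simp add: has_real_derivative_iff_has_vector_derivative)
    thus ?thesis unfolding b_def b'_def by (auto intro!: derivative_eq_intros)
  qed
  have dc: "((\<lambda>w. c r p w) has_real_derivative c' r p w) (at w within {0..2*pi})" if "r \<in> {0..R}" for r p w
  proof -
    have "((\<lambda>w. v (?X r p w) \<bullet> e_w w) has_real_derivative
        (D (?X r p w) (r *\<^sub>R sin p *\<^sub>R e_w w) \<bullet> e_w w
         - v (?X r p w) \<bullet> (sin p *\<^sub>R e_r p w + cos p *\<^sub>R e_p p w))) (at w within {0..2*pi})"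
      using inner_der [OF vw [OF that, of p w] spherical_frame_derivs(4) [where p=p and w=w]]
      by (simp add: has_real_derivative_iff_has_vector_derivative inner_diff_right inner_minus_right inner_add_right algebra_simps)
    thus ?thesis unfolding c_def c'_def by (auto intro!: derivative_eq_intros)
  qed
  have cX: "continuous_on K (\<lambda>x. ?X (fst x) (fst (snd x)) (snd (snd x)))"
    by (intro continuous_intros)
  have XK: "(\<lambda>x. ?X (fst x) (fst (snd x)) (snd (snd x))) ` K \<subseteq> cball 0 R"
    using X by (auto simp: K_def)
  note cvX = continuous_on_compose2 [OF cv cX XK] and cDX = continuous_on_compose2 [OF cD cX XK]
  have cDe: "continuous_on K (\<lambda>x. D (?X (fst x) (fst (snd x)) (snd (snd x))) (e_r (fst (snd x)) (snd (snd x))))"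
    by (intro bounded_bilinear.continuous_on [OF bounded_bilinear_blinfun_apply] cDX continuous_intros)
  have ca': "continuous_on K (\<lambda>(r,p,w). a' r p w)"
    unfolding a'_def case_prod_beta
    by (intro cDe cvX cDX continuous_intros)
  have cb': "continuous_on K (\<lambda>(r,p,w). b' r p w)"
    unfolding b'_def case_prod_beta
    by (intro cvX cDX continuous_intros)
  have cc': "continuous_on K (\<lambda>(r,p,w). c' r p w)"
    unfolding c'_def case_prod_beta
    by (intro cvX cDX continuous_intros)
  have ia: "set_integrable lborel Q (\<lambda>(r,p,w). a' r p w)"
   and ib: "set_integrable lborel Q (\<lambda>(r,p,w). b' r p w)"
   and ic: "set_integrable lborel Q (\<lambda>(r,p,w). c' r p w)"
    using ca' cb' cc' unfolding Q_def K_def by (auto intro: set_integrable_open_box)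
  have Ia: "(LBINT x:Q. (\<lambda>(r,p,w). a' r p w) x) = sphere_flux R v"
  proof -
    have "(LBINT x:Q. (\<lambda>(r,p,w). a' r p w) x)
        = (LBINT y:{0<..<pi} \<times> {0<..<2*pi}. LBINT r:{0<..<R}. (\<lambda>(r,p,w). a' r p w) (r, y))"
      unfolding Q_def by (rule set_integral_iterate(2)) (rule ia [unfolded Q_def])
    also have "\<dots> = (LBINT y:{0<..<pi} \<times> {0<..<2*pi}. a R (fst y) (snd y))"
    proof (rule set_lebesgue_integral_cong)
      show "{0<..<pi} \<times> {0<..<2 * pi} \<in> sets lborel" by (auto intro!: borel_open open_Times)
      show "\<forall>y. y \<in> {0<..<pi} \<times> {0<..<2 * pi} \<longrightarrow>
        (LBINT r:{0<..<R}. (\<lambda>(r,p,w). a' r p w) (r, y)) = a R (fst y) (snd y)"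
      proof (clarify, simp only: prod.case fst_conv snd_conv)
        fix p w assume pw: "p \<in> {0<..<pi}" "w \<in> {0<..<2*pi}"
        have "continuous_on {0..R} (\<lambda>r. (\<lambda>(r,p,w). a' r p w) (r, p, w))"
          by (rule continuous_on_compose2 [OF ca']) (use pw in \<open>auto simp: K_def intro!: continuous_intros\<close>)
        thus "(LBINT r:{0<..<R}. a' r p w) = a R p w"
          using set_integral_FTC [of 0 R "\<lambda>r. a' r p w" "\<lambda>r. a r p w"] da R by (simp add: a_def)
      qed
    qed
    also have "\<dots> = sphere_flux R v"
      unfolding sphere_flux_def
    proof (subst sphere_integral_open_box)
      show "0 \<le> R" using R by simp
      show "continuous_on (sphere 0 R) (\<lambda>z. v z \<bullet> (z /\<^sub>R R))"
        by (intro continuous_intros continuous_on_subset [OF cv]) auto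
      show "(LBINT y:{0<..<pi} \<times> {0<..<2*pi}. a R (fst y) (snd y)) = (LBINT x:{0<..<pi} \<times> {0<..<2 * pi}.
          (\<lambda>(\<phi>, \<omega>). v (sphere_point R \<phi> \<omega>) \<bullet> (sphere_point R \<phi> \<omega> /\<^sub>R R) * (R\<^sup>2 * sin \<phi>)) x)"
        unfolding set_lebesgue_integral_def using R
        by (intro Bochner_Integration.integral_cong refl)
          (auto simp: a_def sphere_point_e_r power2_eq_square indicator_def)
    qed
    finally show ?thesis .
  qed
  have Ib: "(LBINT x:Q. (\<lambda>(r,p,w). b' r p w) x) = 0"
  proof -
    have inner: "(LBINT p:{0<..<pi}. b' r p w) = 0" if r: "r \<in> {0<..<R}" and w: "w \<in> {0<..<2*pi}" for r w
    proof -
      have "continuous_on {0..pi} (\<lambda>p. (\<lambda>(r,p,w). b' r p w) (r, p, w))"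
        by (rule continuous_on_compose2 [OF cb']) (use r w in \<open>auto simp: K_def intro!: continuous_intros\<close>)
      thus ?thesis
        using set_integral_FTC [of 0 "pi" "\<lambda>p. b' r p w" "\<lambda>p. b r p w"] db r by (simp add: b_def)
    qed
    have outer: "(LBINT y:{0<..<pi} \<times> {0<..<2*pi}. (\<lambda>(r,p,w). b' r p w) (r, y)) = 0" if r: "r \<in> {0<..<R}" for r
    proof -
      have "continuous_on ({0..pi} \<times> {0..2*pi}) (\<lambda>y. (\<lambda>(r,p,w). b' r p w) (r, y))"
        by (rule continuous_on_compose2 [OF cb']) (use r in \<open>auto simp: K_def intro!: continuous_intros\<close>)
      hence "set_integrable lborel ({0..pi} \<times> {0..2*pi}) (\<lambda>y. (\<lambda>(r,p,w). b' r p w) (r, y))"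
        unfolding set_integrable_def by (intro borel_integrable_compact compact_Times) auto
      hence "set_integrable lborel ({0<..<pi} \<times> {0<..<2*pi}) (\<lambda>y. (\<lambda>(r,p,w). b' r p w) (r, y))"
        by (rule set_integrable_subset) (auto intro!: borel_open open_Times)
      note set_integral_iterate(2) [OF this]
      also have "(LBINT w:{0<..<2*pi}. LBINT p:{0<..<pi}. (\<lambda>(r,p,w). b' r p w) (r, p, w)) = 0"
        by (rule set_integral_eq_0) (simp only: prod.case inner [OF r])
      finally show ?thesis .
    qed
    show ?thesis
      unfolding Q_def set_integral_iterate(1) [OF ib [unfolded Q_def]]
      by (rule set_integral_eq_0) (rule outer)
  qed
  have Ic: "(LBINT x:Q. (\<lambda>(r,p,w). c' r p w) x) = 0"
  proof -
    have inner: "(LBINT w:{0<..<2*pi}. c' r p w) = 0" if r: "r \<in> {0<..<R}" and p: "p \<in> {0<..<pi}" for r p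
    proof -
      have "continuous_on {0..2*pi} (\<lambda>w. (\<lambda>(r,p,w). c' r p w) (r, p, w))"
        by (rule continuous_on_compose2 [OF cc']) (use r p in \<open>auto simp: K_def intro!: continuous_intros\<close>)
      thus ?thesis
        using set_integral_FTC [of 0 "2*pi" "\<lambda>w. c' r p w" "\<lambda>w. c r p w"] dc r by (simp add: c_def e_r_def e_w_def)
    qed
    have outer: "(LBINT y:{0<..<pi} \<times> {0<..<2*pi}. (\<lambda>(r,p,w). c' r p w) (r, y)) = 0" if r: "r \<in> {0<..<R}" for r
    proof -
      have "continuous_on ({0..pi} \<times> {0..2*pi}) (\<lambda>y. (\<lambda>(r,p,w). c' r p w) (r, y))"
        by (rule continuous_on_compose2 [OF cc']) (use r in \<open>auto simp: K_def intro!: continuous_intros\<close>)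
      hence "set_integrable lborel ({0..pi} \<times> {0..2*pi}) (\<lambda>y. (\<lambda>(r,p,w). c' r p w) (r, y))"
        unfolding set_integrable_def by (intro borel_integrable_compact compact_Times) auto
      hence "set_integrable lborel ({0<..<pi} \<times> {0<..<2*pi}) (\<lambda>y. (\<lambda>(r,p,w). c' r p w) (r, y))"
        by (rule set_integrable_subset) (auto intro!: borel_open open_Times)
      note set_integral_iterate(1) [OF this]
      also have "(LBINT p:{0<..<pi}. LBINT w:{0<..<2*pi}. (\<lambda>(r,p,w). c' r p w) (r, p, w)) = 0"
        by (rule set_integral_eq_0) (simp only: prod.case inner [OF r])
      finally show ?thesis .
    qed
    show ?thesis
      unfolding Q_def set_integral_iterate(1) [OF ic [unfolded Q_def]]
      by (rule set_integral_eq_0) (rule outer)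
  qed
  have dv: "div_on (cball 0 R) v x = (\<Sum>k\<in>UNIV. D x (axis k 1) $ k)" if "x \<in> cball 0 R" for x
    using div_on_eq [OF R that D [OF that]] .
  have cdv: "continuous_on (cball 0 R) (div_on (cball 0 R) v)"
  proof -
    have "continuous_on (cball 0 R) (\<lambda>x. \<Sum>k\<in>UNIV. D x (axis k 1) $ k)"
      by (intro continuous_intros cD)
    thus ?thesis by (rule continuous_on_eq) (simp add: dv)
  qed
  have pt: "div_on (cball 0 R) v (sphere_point r p w) * (r\<^sup>2 * sin p) = a' r p w + (b' r p w + c' r p w)"
    if "(r, p, w) \<in> Q" for r p w
  proof -
    have X: "?X r p w \<in> cball 0 R" using that by (intro X) (auto simp: Q_def)
    have "div_on (cball 0 R) v (sphere_point r p w) =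
        D (?X r p w) (e_r p w) \<bullet> e_r p w + D (?X r p w) (e_p p w) \<bullet> e_p p w + D (?X r p w) (e_w w) \<bullet> e_w w"
      unfolding sphere_point_e_r dv [OF X]
      by (rule trace_spherical_frame) (simp add: blinfun.bounded_linear_right bounded_linear.linear)
    thus ?thesis
      unfolding a'_def b'_def c'_def blinfun.scaleR_right inner_add_right inner_scaleR_left inner_scaleR_right
      by (simp add: algebra_simps power2_eq_square)
  qed
  have Qm: "Q \<in> sets lborel" unfolding Q_def by (auto intro!: borel_open open_Times)
  have "set_borel_measurable borel (ball 0 R) (div_on (cball 0 R) v)"
    unfolding set_borel_measurable_def
    by (intro borel_measurable_continuous_on_indicator continuous_on_subset [OF cdv]) auto
  from ball_integral_spherical(2) [OF this]
  have "(LBINT z:ball 0 R. div_on (cball 0 R) v z)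
      = (LBINT x:Q. (\<lambda>(r,p,w). div_on (cball 0 R) v (sphere_point r p w) * (r\<^sup>2 * sin p)) x)"
    unfolding Q_def .
  also have "\<dots> = (LBINT x:Q. (\<lambda>(r,p,w). a' r p w) x + ((\<lambda>(r,p,w). b' r p w) x + (\<lambda>(r,p,w). c' r p w) x))"
    unfolding set_lebesgue_integral_def
    by (rule Bochner_Integration.integral_cong) (auto simp: pt indicator_def)
  also have "\<dots> = sphere_flux R v"
    using set_integral_add(2) [OF ia set_integral_add(1) [OF ib ic]] set_integral_add(2) [OF ib ic] Ia Ib Ic
    by simp
  finally show ?thesis .
qed



section \<open>Taylor remainders of the Newtonian kernel\<close>

text \<open>
  The gradient of \<open>w \<mapsto> - 1 / |w|\<close>.
\<close>

definition newton_force :: "real^3 \<Rightarrow> real^3" where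
  "newton_force w = w /\<^sub>R norm w ^ 3"

text \<open>
  The derivative of \<open>newton_force\<close> at \<open>w\<close> in the direction \<open>h\<close>.
\<close>

definition tidal :: "real^3 \<Rightarrow> real^3 \<Rightarrow> real^3" where
  "tidal w h = h /\<^sub>R norm w ^ 3 - (3 * (w \<bullet> h) / norm w ^ 5) *\<^sub>R w"

lemma inner_via_norms: "w \<bullet> h = ((norm (w + h))\<^sup>2 - (norm w)\<^sup>2 - (norm h)\<^sup>2) / 2"
  by (simp add: power2_norm_eq_inner inner_add_left inner_add_right inner_commute)

lemma norm_diff_le: "\<bar>norm w - norm (w + h)\<bar> \<le> norm (h :: 'a::real_normed_vector)"
  using norm_triangle_ineq3 [of w "w + h"] by simp

text \<open>
  Put \<open>a = |w|\<close> and \<open>b = |w + h|\<close>. As \<open>w \<bullet> h\<close> is a polynomial in \<open>a\<close>, \<open>b\<close> and \<open>|h|\<close>, the remainder is a rational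
  function of these three numbers, with numerator \<open>(a - b)\<^sup>2 (2a + b) - |h|\<^sup>2 b\<close>, and \<open>|a - b| \<le> |h|\<close>.
\<close>

lemma inverse_norm_remainder:
  fixes w h :: "'a::real_inner"
  assumes "w \<noteq> 0" "w + h \<noteq> 0"
  shows "\<bar>1 / norm (w + h) - 1 / norm w + (w \<bullet> h) / norm w ^ 3\<bar>
    \<le> (norm h)\<^sup>2 * (1 / (norm w ^ 2 * norm (w + h)) + 1 / norm w ^ 3)"
proof -
  define a b \<eta> where ab: "a = norm w" "b = norm (w + h)" "\<eta> = norm h"
  have pos: "0 < a" "0 < b" using assms by (auto simp: ab)
  have d: "(a - b)\<^sup>2 \<le> \<eta>\<^sup>2"
    using norm_diff_le [of w h] unfolding ab by (metis abs_le_square_iff abs_norm_cancel)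
  have eq: "1 / b - 1 / a + ((b\<^sup>2 - a\<^sup>2 - \<eta>\<^sup>2) / 2) / a ^ 3
      = ((a - b)\<^sup>2 * (2 * a + b) - \<eta>\<^sup>2 * b) / (2 * a ^ 3 * b)"
    using pos by (simp add: divide_simps) algebra
  have "\<bar>1 / b - 1 / a + ((b\<^sup>2 - a\<^sup>2 - \<eta>\<^sup>2) / 2) / a ^ 3\<bar> \<le> (\<eta>\<^sup>2 * (2 * a + b) + \<eta>\<^sup>2 * b) / (2 * a ^ 3 * b)"
  proof -
    have "\<bar>(a - b)\<^sup>2 * (2 * a + b) - \<eta>\<^sup>2 * b\<bar> \<le> \<bar>(a - b)\<^sup>2 * (2 * a + b)\<bar> + \<bar>\<eta>\<^sup>2 * b\<bar>"
      by (rule abs_triangle_ineq4)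
    also have "\<dots> \<le> \<eta>\<^sup>2 * (2 * a + b) + \<eta>\<^sup>2 * b"
      using d pos by (simp add: abs_mult mult_right_mono)
    finally show ?thesis unfolding eq using pos by (simp add: abs_mult divide_right_mono)
  qed
  also have "\<dots> = \<eta>\<^sup>2 * (1 / (a ^ 2 * b) + 1 / a ^ 3)"
    using pos by (simp add: divide_simps) algebra
  finally show ?thesis unfolding inner_via_norms [of w h] ab .
qed

text \<open>
  The remainder is a combination \<open>s h + t w\<close> whose coefficients are rational in \<open>a = |w|\<close>, \<open>b = |w + h|\<close> and
  \<open>|h|\<close>; \<open>s\<close> contains the factor \<open>a - b\<close>, and \<open>t\<close> is the difference of multiples of \<open>(a - b)\<^sup>2\<close> and of \<open>|h|\<^sup>2\<close>. The constant \<open>200\<close> is convenient, not sharp.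
\<close>

lemma newton_force_remainder:
  assumes w: "w \<noteq> 0" and h: "norm h \<le> norm w / 2"
  shows "norm (newton_force (w + h) - newton_force w - tidal w h) \<le> 200 * (norm h)\<^sup>2 / norm w ^ 4"
proof -
  define a b \<eta> where ab: "a = norm w" "b = norm (w + h)" "\<eta> = norm h"
  have d: "\<bar>a - b\<bar> \<le> \<eta>" using norm_diff_le [of w h] unfolding ab .
  have pos: "0 < a" "0 \<le> \<eta>" using w by (auto simp: ab)
  have b: "a / 2 \<le> b" "b \<le> 3 * a / 2" using d h unfolding ab by linarith+
  have b0: "0 < b" using b pos by linarith
  define s t where "s = 1 / b ^ 3 - 1 / a ^ 3" and "t = 1 / b ^ 3 - 1 / a ^ 3 + 3 * (w \<bullet> h) / a ^ 5"
  have split: "newton_force (w + h) - newton_force w - tidal w h = s *\<^sub>R h + t *\<^sub>R w"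
    unfolding newton_force_def tidal_def s_def t_def ab by (simp add: algebra_simps divide_inverse)
  have ib: "1 / b ^ 3 \<le> 8 / a ^ 3"
  proof -
    have "(a / 2) ^ 3 \<le> b ^ 3" using b pos by (intro power_mono) auto
    thus ?thesis using pos b0 by (simp add: field_simps)
  qed
  have b2: "b ^ 2 \<le> 9 / 4 * a ^ 2" using power_mono [OF b(2), of 2] b0 by (simp add: power2_eq_square)
  have b3: "b ^ 3 \<le> 27 / 8 * a ^ 3" using power_mono [OF b(2), of 3] b0 by (simp add: power3_eq_cube)
  have ab1: "a * b \<le> 3 / 2 * a ^ 2" using mult_left_mono [OF b(2), of a] pos by (simp add: power2_eq_square)
  have s: "\<bar>s\<bar> \<le> 38 * \<eta> / a ^ 4"
  proof -
    have s_eq: "s = (a - b) * (a ^ 2 + a * b + b ^ 2) * (1 / a ^ 3) * (1 / b ^ 3)"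
      using pos b0 by (simp add: s_def divide_simps) algebra
    have "\<bar>s\<bar> \<le> \<eta> * (19 / 4 * a ^ 2) * (1 / a ^ 3) * (8 / a ^ 3)"
      unfolding s_eq abs_mult using d ib b2 ab1 pos b0 by (intro mult_mono) auto
    also have "\<dots> = 38 * \<eta> / a ^ 4" using pos by (simp add: divide_simps eval_nat_numeral)
    finally show ?thesis .
  qed
  have t: "\<bar>t\<bar> \<le> 130 * \<eta>\<^sup>2 / a ^ 5"
  proof -
    define q where "q = (a - b)\<^sup>2 * (2 * a ^ 3 + 4 * a ^ 2 * b + 6 * a * b ^ 2 + 3 * b ^ 3) * (1 / (2 * a ^ 5)) * (1 / b ^ 3)"
    have t_eq: "t = q - 3 / 2 * \<eta>\<^sup>2 / a ^ 5"
      unfolding t_def q_def inner_via_norms [of w h] ab [symmetric]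
      using pos b0 by (simp add: divide_simps) algebra
    have "(a - b)\<^sup>2 \<le> \<eta>\<^sup>2" using d pos by (metis abs_le_square_iff abs_of_nonneg)
    have "a ^ 2 * b \<le> 3 / 2 * a ^ 3"
      using mult_left_mono [OF b(2), of "a^2"] by (simp add: power2_eq_square power3_eq_cube)
    moreover have "a * b ^ 2 \<le> 9 / 4 * a ^ 3"
      using mult_left_mono [OF b2, of a] pos by (simp add: power2_eq_square power3_eq_cube)
    ultimately have "2 * a ^ 3 + 4 * a ^ 2 * b + 6 * a * b ^ 2 + 3 * b ^ 3 \<le> 32 * a ^ 3"
      using b3 zero_less_power [OF pos(1), of 3] by linarith
    hence "\<bar>q\<bar> \<le> \<eta>\<^sup>2 * (32 * a ^ 3) * (1 / (2 * a ^ 5)) * (8 / a ^ 3)"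
      unfolding q_def abs_mult using \<open>(a - b)\<^sup>2 \<le> \<eta>\<^sup>2\<close> ib pos b0 by (intro mult_mono) auto
    also have "\<dots> = 128 * (\<eta>\<^sup>2 / a ^ 5)"
      using pos by (simp add: divide_simps)
    finally have q: "\<bar>q\<bar> \<le> 128 * (\<eta>\<^sup>2 / a ^ 5)" .
    have "0 \<le> \<eta>\<^sup>2 / a ^ 5" using pos by simp
    thus ?thesis using q unfolding t_eq by simp
  qed
  have "norm (s *\<^sub>R h + t *\<^sub>R w) \<le> \<bar>s\<bar> * \<eta> + \<bar>t\<bar> * a"
    by (rule order_trans [OF norm_triangle_ineq]) (simp add: ab)
  also have "\<dots> \<le> 38 * \<eta> / a ^ 4 * \<eta> + 130 * \<eta>\<^sup>2 / a ^ 5 * a"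
    using s t pos by (intro add_mono mult_right_mono) auto
  also have "\<dots> = 168 * \<eta>\<^sup>2 / a ^ 4"
    using pos by (simp add: field_simps eval_nat_numeral)
  also have "\<dots> \<le> 200 * \<eta>\<^sup>2 / a ^ 4" by (intro divide_right_mono) auto
  finally show ?thesis unfolding split unfolding ab .
qed

lemma powr_product: "0 < (x::real) \<Longrightarrow> x powr s * x powr t = x powr (s + t)"
  by (simp add: powr_add)

text \<open>
  The second-order bound \<open>|h|\<^sup>2 / a\<^sup>3\<close> is not integrable at \<open>a = 0\<close>, while the crude bound that is
  left for \<open>a < 2 |h|\<close> carries at most one power of \<open>|h|\<close>. Spending half a power of \<open>|h|\<close> gives a bound that is integrable and
  still \<open>o(|h|)\<close>.
\<close>

lemma interpolate_remainder:
  fixes a b \<eta> c E :: real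
  assumes pos: "0 < a" "0 < b" "0 \<le> \<eta>" "0 \<le> c" and d: "b \<le> a + \<eta>"
    and near: "\<eta> \<le> a / 2 \<Longrightarrow> E \<le> c * (\<eta>\<^sup>2 / a ^ 3)"
    and far: "a / 2 < \<eta> \<Longrightarrow> E \<le> c * (\<eta> / b\<^sup>2 + 1 / a + \<eta> / a\<^sup>2)"
  shows "E \<le> 5 * c * \<eta> powr (3/2) * (a powr (-5/2) + b powr (-5/2))"
proof (cases "\<eta> \<le> a / 2")
  case True
  have "\<eta>\<^sup>2 / a ^ 3 \<le> \<eta> powr (3/2) * a powr (-5/2)"
  proof (cases "\<eta> = 0")
    case False
    hence \<eta>: "0 < \<eta>" using pos by simp
    have "\<eta>\<^sup>2 / a ^ 3 = \<eta> powr (3/2) * \<eta> powr (1/2) * a powr (-3)"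
      using powr_product [OF \<eta>, of "3/2" "1/2"] \<eta> pos by (simp add: powr_minus_divide)
    also have "\<dots> \<le> \<eta> powr (3/2) * a powr (1/2) * a powr (-3)"
      using \<eta> pos True by (intro mult_right_mono mult_left_mono powr_mono2) auto
    also have "\<dots> = \<eta> powr (3/2) * a powr (-5/2)"
      using powr_product [of a "1/2" "-3"] pos by (simp add: mult.assoc)
    finally show ?thesis .
  qed simp
  also have "\<dots> \<le> 5 * \<eta> powr (3/2) * (a powr (-5/2) + b powr (-5/2))"
    by (simp add: distrib_left add_increasing2)
  finally have "c * (\<eta>\<^sup>2 / a ^ 3) \<le> c * (5 * \<eta> powr (3/2) * (a powr (-5/2) + b powr (-5/2)))"
    using pos by (intro mult_left_mono)
  thus ?thesis using near [OF True] by (simp add: mult_ac)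
next
  case False
  hence far': "E \<le> c * (\<eta> / b\<^sup>2 + 1 / a + \<eta> / a\<^sup>2)" and a2: "a \<le> 2 * \<eta>" using far by auto
  have \<eta>: "0 < \<eta>" using False pos by simp
  \<comment> \<open>Far from the second-order regime both \<open>a\<close> and \<open>b\<close> are bounded by multiples of \<open>\<eta>\<close>, so powers of them can be traded for powers of \<open>\<eta>\<close>.\<close>
  have b3: "b \<le> 3 * \<eta>" using d a2 by simp
  have 1: "\<eta> / b\<^sup>2 \<le> 2 * \<eta> powr (3/2) * b powr (-5/2)"
  proof -
    have "\<eta> / b\<^sup>2 = \<eta> powr 1 * b powr (1/2) * b powr (-5/2)"
    proof -
      have "b powr (1/2) * b powr (-5/2) = 1 / b\<^sup>2"
        using powr_product [of b "1/2" "-5/2"] pos by (simp add: powr_minus_divide)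
      thus ?thesis using \<eta> by (simp only: mult.assoc) simp
    qed
    also have "\<dots> \<le> \<eta> powr 1 * (4 * \<eta>) powr (1/2) * b powr (-5/2)"
      using pos \<eta> b3 by (intro mult_right_mono mult_left_mono powr_mono2) auto
    also have "(4 * \<eta>) powr (1/2) = 2 * \<eta> powr (1/2)"
      using \<eta> by (simp add: powr_half_sqrt real_sqrt_mult)
    also have "\<eta> powr 1 * (2 * \<eta> powr (1/2)) = 2 * (\<eta> powr 1 * \<eta> powr (1/2))" by simp
    also have "\<eta> powr 1 * \<eta> powr (1/2) = \<eta> powr (3/2)"
      using powr_product [of \<eta> 1 "1/2"] \<eta> by simp
    finally show ?thesis .
  qed
  have 2: "1 / a \<le> 3 * \<eta> powr (3/2) * a powr (-5/2)"
  proof -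
    have "1 / a = a powr (3/2) * a powr (-5/2)"
      using powr_product [of a "3/2" "-5/2"] pos by simp
    also have "\<dots> \<le> (2 * \<eta>) powr (3/2) * a powr (-5/2)"
      using pos \<eta> a2 by (intro mult_right_mono powr_mono2) auto
    also have "(2 * \<eta>) powr (3/2) = 2 powr (3/2) * \<eta> powr (3/2)"
      using \<eta> by (simp add: powr_mult)
    finally have le: "1 / a \<le> 2 powr (3/2) * (\<eta> powr (3/2) * a powr (-5/2))" by (simp add: mult.assoc)
    have "(2::real) powr (3/2) \<le> 3"
    proof -
      have "((2::real) powr (3/2))\<^sup>2 = 2 powr 3" using powr_product [of 2 "3/2" "3/2"] by (simp add: power2_eq_square)
      also have "\<dots> \<le> 3\<^sup>2" by simp
      finally show ?thesis by (rule power2_le_imp_le) simp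
    qed
    hence "2 powr (3/2) * (\<eta> powr (3/2) * a powr (-5/2)) \<le> 3 * (\<eta> powr (3/2) * a powr (-5/2))"
      by (rule mult_right_mono) simp
    with le show ?thesis by simp
  qed
  have 3: "\<eta> / a\<^sup>2 \<le> 2 * \<eta> powr (3/2) * a powr (-5/2)"
  proof -
    have "\<eta> / a\<^sup>2 = \<eta> powr 1 * a powr (1/2) * a powr (-5/2)"
    proof -
      have "a powr (1/2) * a powr (-5/2) = 1 / a\<^sup>2"
        using powr_product [of a "1/2" "-5/2"] pos by (simp add: powr_minus_divide)
      thus ?thesis using \<eta> by (simp only: mult.assoc) simp
    qed
    also have "\<dots> \<le> \<eta> powr 1 * (4 * \<eta>) powr (1/2) * a powr (-5/2)"
      using pos \<eta> a2 by (intro mult_right_mono mult_left_mono powr_mono2) auto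
    also have "(4 * \<eta>) powr (1/2) = 2 * \<eta> powr (1/2)"
      using \<eta> by (simp add: powr_half_sqrt real_sqrt_mult)
    also have "\<eta> powr 1 * (2 * \<eta> powr (1/2)) = 2 * (\<eta> powr 1 * \<eta> powr (1/2))" by simp
    also have "\<eta> powr 1 * \<eta> powr (1/2) = \<eta> powr (3/2)"
      using powr_product [of \<eta> 1 "1/2"] \<eta> by simp
    finally show ?thesis .
  qed
  have "\<eta> / b\<^sup>2 + 1 / a + \<eta> / a\<^sup>2 \<le> 2 * \<eta> powr (3/2) * b powr (-5/2) + 5 * \<eta> powr (3/2) * a powr (-5/2)"
    using 1 2 3 by simp
  also have "\<dots> \<le> 5 * \<eta> powr (3/2) * (a powr (-5/2) + b powr (-5/2))"
    by (simp add: distrib_left)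
  finally have "c * (\<eta> / b\<^sup>2 + 1 / a + \<eta> / a\<^sup>2) \<le> c * (5 * \<eta> powr (3/2) * (a powr (-5/2) + b powr (-5/2)))"
    using pos by (intro mult_left_mono)
  thus ?thesis using far' by (simp add: mult_ac)
qed

lemma norm_newton_force: "norm (newton_force w) = 1 / (norm w)\<^sup>2"
  by (cases "w = 0") (simp_all add: newton_force_def field_simps power2_eq_square power3_eq_cube)

lemma norm_tidal_le: "norm (tidal w h) \<le> 4 * norm h / norm w ^ 3"
proof (cases "w = 0")
  case False
  have "\<bar>3 * (w \<bullet> h) / norm w ^ 5\<bar> * norm w \<le> 3 * (norm w * norm h) / norm w ^ 5 * norm w"
    using Cauchy_Schwarz_ineq2 [of w h] by (intro mult_right_mono) (auto simp: abs_mult intro!: divide_right_mono)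
  also have "\<dots> = 3 * (norm h / norm w ^ 3)" using False by (simp add: divide_simps eval_nat_numeral)
  finally have "\<bar>3 * (w \<bullet> h) / norm w ^ 5\<bar> * norm w \<le> 3 * (norm h / norm w ^ 3)" .
  moreover have "norm (tidal w h) \<le> norm h / norm w ^ 3 + \<bar>3 * (w \<bullet> h) / norm w ^ 5\<bar> * norm w"
    unfolding tidal_def by (rule order_trans [OF norm_triangle_ineq4]) (simp add: divide_inverse mult.commute)
  ultimately show ?thesis by simp
qed (simp add: tidal_def)

lemma inverse_norm_first_order:
  fixes w h :: "real^3"
  assumes w: "w \<noteq> 0" "w + h \<noteq> 0"
  shows "\<bar>1 / norm (w + h) - 1 / norm w + newton_force w \<bullet> h\<bar>
    \<le> 15 * norm h powr (3/2) * (norm w powr (-5/2) + norm (w + h) powr (-5/2))"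
proof -
  define a b \<eta> where ab: "a = norm w" "b = norm (w + h)" "\<eta> = norm h"
  let ?E = "\<bar>1 / b - 1 / a + (w \<bullet> h) / a ^ 3\<bar>"
  have d: "\<bar>a - b\<bar> \<le> \<eta>" using norm_diff_le [of w h] unfolding ab .
  have pos: "0 < a" "0 < b" "0 \<le> \<eta>" using w by (auto simp: ab)
  have "?E \<le> 5 * 3 * \<eta> powr (3/2) * (a powr (-5/2) + b powr (-5/2))"
  proof (rule interpolate_remainder)
    assume n: "\<eta> \<le> a / 2"
    hence "a / 2 \<le> b" using d by linarith
    hence "1 / b \<le> 2 / a" using pos by (simp add: field_simps)
    hence "1 / (a\<^sup>2 * b) \<le> 2 / a ^ 3"
      using pos mult_left_mono [of "1/b" "2/a" "1/a\<^sup>2"] by (simp add: power2_eq_square power3_eq_cube mult.assoc)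
    hence "\<eta>\<^sup>2 * (1 / (a\<^sup>2 * b) + 1 / a ^ 3) \<le> \<eta>\<^sup>2 * (2 / a ^ 3 + 1 / a ^ 3)"
      by (intro mult_left_mono add_right_mono) auto
    also have "\<dots> = 3 * (\<eta>\<^sup>2 / a ^ 3)" by (simp add: field_simps)
    finally show "?E \<le> 3 * (\<eta>\<^sup>2 / a ^ 3)"
      using inverse_norm_remainder [OF w] unfolding ab by linarith
  next
    assume f: "a / 2 < \<eta>"
    hence "b \<le> 3 * \<eta>" using d by linarith
    hence "1 / b \<le> 3 * (\<eta> / b\<^sup>2)" using pos by (simp add: field_simps power2_eq_square)
    moreover have "\<bar>(w \<bullet> h) / a ^ 3\<bar> \<le> \<eta> / a\<^sup>2"
    proof -
      have "\<bar>w \<bullet> h\<bar> / a ^ 3 \<le> (a * \<eta>) / a ^ 3"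
        using Cauchy_Schwarz_ineq2 [of w h] pos unfolding ab by (intro divide_right_mono) auto
      thus ?thesis using pos by (simp add: field_simps power2_eq_square power3_eq_cube)
    qed
    moreover have "?E \<le> \<bar>1/b\<bar> + \<bar>1/a\<bar> + \<bar>(w \<bullet> h) / a ^ 3\<bar>" by linarith
    ultimately have "?E \<le> 3 * (\<eta> / b\<^sup>2) + 1/a + \<eta> / a\<^sup>2" using pos by simp
    also have "\<dots> \<le> 3 * (\<eta> / b\<^sup>2 + 1/a + \<eta> / a\<^sup>2)"
    proof -
      have "3 * p + q + r \<le> 3 * (p + q + r)" if "0 \<le> q" "0 \<le> r" for p q r :: real
        using that by simp
      from this [of _ _ _] show ?thesis using pos by (meson zero_le_divide_iff zero_le_power2 less_imp_le zero_le_one)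
    qed
    finally show "?E \<le> 3 * (\<eta> / b\<^sup>2 + 1/a + \<eta> / a\<^sup>2)" .
  qed (use pos d in auto)
  moreover have "newton_force w \<bullet> h = (w \<bullet> h) / a ^ 3"
    by (simp add: newton_force_def ab divide_inverse)
  ultimately show ?thesis unfolding ab by simp
qed

text \<open>
  The extra factor \<open>|w|\<close> is the weight \<open>|\<theta>(x) - \<theta>(z)|\<close> in later use. It lowers the order of the singularity
  from that of a second derivative of the potential to that of a first one.
\<close>

lemma newton_force_first_order:
  assumes w: "w \<noteq> 0" "w + h \<noteq> 0"
  shows "norm w * norm (newton_force (w + h) - newton_force w - tidal w h)
    \<le> 1000 * norm h powr (3/2) * (norm w powr (-5/2) + norm (w + h) powr (-5/2))"
proof -
  define a b \<eta> where ab: "a = norm w" "b = norm (w + h)" "\<eta> = norm h"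
  let ?E = "a * norm (newton_force (w + h) - newton_force w - tidal w h)"
  have d: "\<bar>a - b\<bar> \<le> \<eta>" using norm_diff_le [of w h] unfolding ab .
  have pos: "0 < a" "0 < b" "0 \<le> \<eta>" using w by (auto simp: ab)
  have "?E \<le> 5 * 200 * \<eta> powr (3/2) * (a powr (-5/2) + b powr (-5/2))"
  proof (rule interpolate_remainder)
    assume n: "\<eta> \<le> a / 2"
    have "?E \<le> a * (200 * \<eta>\<^sup>2 / a ^ 4)"
      using newton_force_remainder [OF w(1), of h] n pos unfolding ab by (intro mult_left_mono) auto
    also have "\<dots> = 200 * (\<eta>\<^sup>2 / a ^ 3)" using pos by (simp add: field_simps eval_nat_numeral)
    finally show "?E \<le> 200 * (\<eta>\<^sup>2 / a ^ 3)" .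
  next
    assume f: "a / 2 < \<eta>"
    have "norm (newton_force (w + h) - newton_force w - tidal w h) \<le> 1 / b\<^sup>2 + 1 / a\<^sup>2 + 4 * \<eta> / a ^ 3"
      using norm_triangle_ineq4 [of "newton_force (w + h) - newton_force w" "tidal w h"]
        norm_triangle_ineq4 [of "newton_force (w + h)" "newton_force w"] norm_tidal_le [of w h]
      unfolding ab norm_newton_force by linarith
    hence "?E \<le> a * (1 / b\<^sup>2 + 1 / a\<^sup>2 + 4 * \<eta> / a ^ 3)" using pos by (intro mult_left_mono) auto
    also have "\<dots> = a / b\<^sup>2 + 1 / a + 4 * (\<eta> / a\<^sup>2)"
      using pos by (simp add: field_simps eval_nat_numeral)
    also have "\<dots> \<le> 2 * (\<eta> / b\<^sup>2) + 1 / a + 4 * (\<eta> / a\<^sup>2)"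
      using f pos divide_right_mono [of a "2 * \<eta>" "b\<^sup>2"] by simp
    also have "\<dots> \<le> 200 * (\<eta> / b\<^sup>2 + 1 / a + \<eta> / a\<^sup>2)"
    proof -
      have "2 * p + q + 4 * r \<le> 200 * (p + q + r)" if "0 \<le> p" "0 \<le> q" "0 \<le> r" for p q r :: real
        using that by simp
      from this [of _ _ _] show ?thesis using pos by (meson zero_le_divide_iff zero_le_power2 less_imp_le zero_le_one)
    qed
    finally show "?E \<le> 200 * (\<eta> / b\<^sup>2 + 1 / a + \<eta> / a\<^sup>2)" .
  qed (use pos d in auto)
  thus ?thesis unfolding ab by simp
qed



section \<open>The divergence theorem against the Newtonian kernel\<close>

lemma has_derivative_imp_continuous_on:
  assumes "\<And>x. x \<in> S \<Longrightarrow> (f has_derivative f' x) (at x within S)"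
  shows "continuous_on S f"
  using assms by (meson continuous_on_eq_continuous_within has_derivative_continuous)

text \<open>
  In finite dimensions continuity of the derivative in operator norm can be checked direction by direction.
\<close>

lemma C1_onI:
  fixes f :: "'a::euclidean_space \<Rightarrow> 'b::real_normed_vector"
  assumes f: "\<And>x. x \<in> S \<Longrightarrow> (f has_derivative f' x) (at x within S)"
    and c: "\<And>h. continuous_on S (\<lambda>x. f' x h)"
  shows "C1_on S f"
  unfolding C1_on_def
proof (intro exI conjI ballI)
  have bl: "blinfun_apply (Blinfun (f' x)) = f' x" if "x \<in> S" for x
    using f [OF that] by (intro bounded_linear_Blinfun_apply has_derivative_bounded_linear)
  show "(f has_derivative blinfun_apply (Blinfun (f' x))) (at x within S)" if "x \<in> S" for x
    using f [OF that] by (simp add: bl [OF that])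
  show "continuous_on S (\<lambda>x. Blinfun (f' x))"
  proof (rule continuous_on_blinfun_componentwise)
    fix i :: 'a
    show "continuous_on S (\<lambda>x. blinfun_apply (Blinfun (f' x)) i)"
      by (rule continuous_on_eq [OF c [of i]]) (simp add: bl)
  qed
qed

lemma C1_onD:
  assumes "C1_on S f"
  obtains f' where "\<And>x. x \<in> S \<Longrightarrow> (f has_derivative f' x) (at x within S)"
    "\<And>h. continuous_on S (\<lambda>x. f' x h)"
proof -
  from assms obtain D where D: "\<And>x. x \<in> S \<Longrightarrow> (f has_derivative blinfun_apply (D x)) (at x within S)"
    and c: "continuous_on S D" by (metis C1_onE)
  show ?thesis
  proof (rule that [of "\<lambda>x. blinfun_apply (D x)"])
    show "continuous_on S (\<lambda>x. blinfun_apply (D x) h)" for h by (intro continuous_intros c)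
  qed (rule D)
qed

lemma C1_on_imp_continuous_on: "C1_on S f \<Longrightarrow> continuous_on S f"
  by (metis C1_onD has_derivative_imp_continuous_on)

lemma C1_on_scaleR:
  fixes g :: "'a::euclidean_space \<Rightarrow> real" and v :: "'a \<Rightarrow> 'b::real_normed_vector"
  assumes "C1_on S g" "C1_on S v"
  shows "C1_on S (\<lambda>x. g x *\<^sub>R v x)"
proof -
  obtain g' where g': "\<And>x. x \<in> S \<Longrightarrow> (g has_derivative g' x) (at x within S)" "\<And>h. continuous_on S (\<lambda>x. g' x h)"
    using C1_onD [OF assms(1)] by metis
  obtain v' where v': "\<And>x. x \<in> S \<Longrightarrow> (v has_derivative v' x) (at x within S)" "\<And>h. continuous_on S (\<lambda>x. v' x h)"
    using C1_onD [OF assms(2)] by metis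
  show ?thesis
  proof (rule C1_onI)
    show "((\<lambda>x. g x *\<^sub>R v x) has_derivative (\<lambda>h. g x *\<^sub>R v' x h + g' x h *\<^sub>R v x)) (at x within S)" if "x \<in> S" for x
      using g'(1) [OF that] v'(1) [OF that] by (rule has_derivative_scaleR)
    show "continuous_on S (\<lambda>x. g x *\<^sub>R v' x h + g' x h *\<^sub>R v x)" for h
      by (intro continuous_intros g'(2) v'(2) C1_on_imp_continuous_on assms)
  qed
qed

lemma continuous_on_div_on:
  assumes R: "0 < R" and v: "C1_on (cball 0 R) v"
  shows "continuous_on (cball 0 R) (div_on (cball 0 R) v)"
proof -
  obtain v' where v': "\<And>x. x \<in> cball 0 R \<Longrightarrow> (v has_derivative v' x) (at x within cball 0 R)" "\<And>h. continuous_on (cball 0 R) (\<lambda>x. v' x h)"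
    using C1_onD [OF v] by metis
  have "continuous_on (cball 0 R) (\<lambda>x. \<Sum>k\<in>UNIV. v' x (axis k 1) $ k)"
    by (intro continuous_intros v'(2))
  thus ?thesis by (rule continuous_on_eq) (simp add: div_on_eq [OF R _ v'(1)])
qed

lemma div_on_scaleR:
  fixes v :: "real^3 \<Rightarrow> real^3"
  assumes "0 < R" "x \<in> cball 0 R"
    and g: "(g has_derivative (\<lambda>h. G \<bullet> h)) (at x within cball 0 R)"
    and v: "(v has_derivative v') (at x within cball 0 R)"
  shows "div_on (cball 0 R) (\<lambda>x. g x *\<^sub>R v x) x = g x * div_on (cball 0 R) v x + v x \<bullet> G"
proof -
  have "((\<lambda>x. g x *\<^sub>R v x) has_derivative (\<lambda>h. g x *\<^sub>R v' h + (G \<bullet> h) *\<^sub>R v x)) (at x within cball 0 R)"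
    using g v by (rule has_derivative_scaleR)
  from div_on_eq [OF assms(1,2) this] div_on_eq [OF assms(1,2) v]
  show ?thesis
    by (simp add: sum_3 inner_vec_def axis_def algebra_simps)
qed

lemma regularised_inverse_norm_derivative:
  fixes x z :: "'a::real_inner"
  assumes "0 < d"
  shows "((\<lambda>z. 1 / sqrt ((norm (x - z))\<^sup>2 + d\<^sup>2)) has_derivative
      (\<lambda>h. ((x - z) /\<^sub>R sqrt ((norm (x - z))\<^sup>2 + d\<^sup>2) ^ 3) \<bullet> h)) (at z within S)"
proof -
  define N where "N z = (x - z) \<bullet> (x - z) + d\<^sup>2" for z
  have pos: "0 < N z" using assms unfolding N_def by (intro add_nonneg_pos) auto
  have N: "(N has_derivative (\<lambda>h. - 2 * ((x - z) \<bullet> h))) (at z within S)"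
    unfolding N_def by (auto intro!: derivative_eq_intros simp: fun_eq_iff inner_commute inner_diff)
  have "((\<lambda>t. 1 / sqrt t) has_real_derivative - 1 / (2 * sqrt (N z) ^ 3)) (at (N z))"
    using pos by (auto intro!: derivative_eq_intros simp: field_simps power3_eq_cube)
  from DERIV_compose_FDERIV [OF this N]
  have "((\<lambda>z. 1 / sqrt (N z)) has_derivative (\<lambda>h. - 2 * ((x - z) \<bullet> h) * (- 1 / (2 * sqrt (N z) ^ 3)))) (at z within S)" .
  moreover have "- 2 * a * (- 1 / (2 * c)) = inverse c * a" for a c :: real
    by (simp add: field_simps)
  ultimately show ?thesis unfolding N_def power2_norm_eq_inner by simp
qed

text \<open>
  Integrands below are continuous except at the singularities of the kernel, where their values follow the
  convention \<open>1 / 0 = 0\<close>.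
\<close>

lemma borel_measurable_off_finite:
  fixes g :: "real^3 \<Rightarrow> 'b::euclidean_space"
  assumes "finite X" and "continuous_on (ball 0 R - X) g"
  shows "(\<lambda>z. indicator (ball 0 R) z *\<^sub>R g z) \<in> borel_measurable lborel"
proof -
  have "(\<lambda>z. indicator (ball 0 R - X) z *\<^sub>R g z + (\<Sum>x\<in>X. indicator {x} z *\<^sub>R (indicator (ball 0 R) x *\<^sub>R g x))) \<in> borel_measurable borel"
    using assms by (intro borel_measurable_add borel_measurable_sum borel_measurable_continuous_on_indicator borel_measurable_scaleR
       borel_measurable_indicator borel_measurable_const) (auto simp: finite_imp_closed)
  also have "(\<lambda>z. indicator (ball 0 R - X) z *\<^sub>R g z + (\<Sum>x\<in>X. indicator {x} z *\<^sub>R (indicator (ball 0 R) x *\<^sub>R g x))) = (\<lambda>z. indicator (ball 0 R) z *\<^sub>R g z)"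
  proof
    fix z
    have "(\<Sum>x\<in>X. indicator {x} z *\<^sub>R (indicator (ball 0 R) x *\<^sub>R g x)) = (\<Sum>x\<in>X. if x = z then indicator (ball 0 R) z *\<^sub>R g z else 0)"
      by (intro sum.cong refl) (auto simp: indicator_def)
    also have "\<dots> = (if z \<in> X then indicator (ball 0 R) z *\<^sub>R g z else 0)" using assms(1) by simp
    finally show "indicator (ball 0 R - X) z *\<^sub>R g z + (\<Sum>x\<in>X. indicator {x} z *\<^sub>R (indicator (ball 0 R) x *\<^sub>R g x)) = indicator (ball 0 R) z *\<^sub>R g z"
      by (auto simp: indicator_def)
  qed
  finally show ?thesis by simp
qed

lemma bounded_on_cball:
  fixes \<rho> :: "'a::euclidean_space \<Rightarrow> 'b::real_normed_vector"
  assumes "continuous_on (cball 0 R) \<rho>"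
  obtains M where "0 \<le> M" "\<And>z. z \<in> cball 0 R \<Longrightarrow> norm (\<rho> z) \<le> M"
proof -
  have "bounded (\<rho> ` cball 0 R)" using assms by (intro compact_imp_bounded compact_continuous_image compact_cball)
  then obtain M where "\<forall>y\<in>\<rho> ` cball 0 R. norm y \<le> M" unfolding bounded_iff by blast
  thus ?thesis by (intro that [of "max 0 M"]) (auto simp: le_max_iff_disj)
qed

lemma Riesz_dominated_limit:
  fixes T :: "nat \<Rightarrow> real^3 \<Rightarrow> real"
  assumes x: "x \<in> cball 0 R" and s: "-3 < s" "s < 0"
    and c: "\<And>n. continuous_on (ball 0 R - {x}) (T n)" "continuous_on (ball 0 R - {x}) T'"
    and lim: "\<And>z. z \<in> ball 0 R \<Longrightarrow> z \<noteq> x \<Longrightarrow> (\<lambda>n. T n z) \<longlonglongrightarrow> T' z"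
    and b: "\<And>n z. z \<in> ball 0 R \<Longrightarrow> z \<noteq> x \<Longrightarrow> \<bar>T n z\<bar> \<le> M * norm (x - z) powr s"
  shows "set_integrable lborel (ball 0 R) (T n)" "(\<lambda>n. LBINT z:ball 0 R. T n z) \<longlonglongrightarrow> (LBINT z:ball 0 R. T' z)"
proof -
  have ne: "AE z in lborel. z \<noteq> x" by (rule AE_lborel_singleton)
  have "set_integrable lborel (ball 0 R) (\<lambda>z. norm (x - z) powr s)"
    by (rule Riesz_kernel_bound [OF s, of R]) (use x in auto)
  hence w: "integrable lborel (\<lambda>z. M * (indicator (ball 0 R) z *\<^sub>R norm (x - z) powr s))"
    unfolding set_integrable_def by (rule integrable_mult_right)
  have l: "AE z in lborel. (\<lambda>n. indicator (ball 0 R) z *\<^sub>R T n z) \<longlonglongrightarrow> indicator (ball 0 R) z *\<^sub>R T' z"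
    using ne by eventually_elim (auto simp: indicator_def intro: lim)
  have bd: "AE z in lborel. norm (indicator (ball 0 R) z *\<^sub>R T n z) \<le> M * (indicator (ball 0 R) z *\<^sub>R norm (x - z) powr s)" for n
    using ne by eventually_elim (use b in \<open>auto simp: indicator_def\<close>)
  have X: "finite {x}" by simp
  note m = borel_measurable_off_finite [OF X c(2)] borel_measurable_off_finite [OF X c(1)]
  show "set_integrable lborel (ball 0 R) (T n)"
    unfolding set_integrable_def by (rule integrable_dominated_convergence2 [OF m w l bd])
  show "(\<lambda>n. LBINT z:ball 0 R. T n z) \<longlonglongrightarrow> (LBINT z:ball 0 R. T' z)"
    unfolding set_lebesgue_integral_def by (rule integral_dominated_convergence [OF m w l bd])
qed

text \<open>
  The kernel is replaced by \<open>1 / sqrt(|x - z|\<^sup>2 + d\<^sup>2)\<close>, the divergence theorem is applied to the resulting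
  \<open>C\<^sup>1\<close> field, and \<open>d\<close> tends to \<open>0\<close>. The volume terms are dominated by \<open>|x - z|\<^sup>-\<^sup>1\<close> and \<open>|x - z|\<^sup>-\<^sup>2\<close>. No point mass
  appears in the limit, since only first derivatives of the kernel occur. On the sphere the kernel is
  bounded because \<open>x\<close> is an interior point.
\<close>

lemma singular_divergence:
  fixes v :: "real^3 \<Rightarrow> real^3"
  assumes R: "0 < R" and v: "C1_on (cball 0 R) v" and x: "x \<in> ball 0 R"
  shows "(LBINT z:ball 0 R. div_on (cball 0 R) v z / norm (x - z)) + (LBINT z:ball 0 R. v z \<bullet> newton_force (x - z))
      = sphere_flux R (\<lambda>z. v z /\<^sub>R norm (x - z))"
proof -
  define d where "d n = 1 / real (Suc n)" for n
  have d0: "0 < d n" for n by (simp add: d_def)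
  have dlim: "d \<longlonglongrightarrow> 0" unfolding d_def by (rule LIMSEQ_Suc [OF lim_1_over_n])
  define s where "s n z = sqrt ((norm (x - z))\<^sup>2 + (d n)\<^sup>2)" for n z
  have spos: "0 < s n z" for n z unfolding s_def using d0 [of n] by (simp add: add_nonneg_pos)
  have s_ge: "norm (x - z) \<le> s n z" for n z unfolding s_def by (rule real_le_rsqrt) simp
  have s_lim: "(\<lambda>n. s n z) \<longlonglongrightarrow> norm (x - z)" for z
    unfolding s_def by (rule tendsto_eq_intros dlim refl)+ simp
  have s_cont: "continuous_on A (s n)" for A n
    unfolding s_def by (intro continuous_intros)
  let ?dv = "div_on (cball 0 R) v"
  have cdv: "continuous_on (cball 0 R) ?dv" by (rule continuous_on_div_on [OF R v])
  have cv: "continuous_on (cball 0 R) v" by (rule C1_on_imp_continuous_on [OF v])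
  obtain M1 M2 where M': "0 \<le> M1" "\<And>z. z \<in> cball 0 R \<Longrightarrow> norm (?dv z) \<le> M1" "\<And>z. z \<in> cball 0 R \<Longrightarrow> norm (v z) \<le> M2"
    using bounded_on_cball [OF cdv] bounded_on_cball [OF cv] by metis
  define M where "M = max M1 M2"
  have M: "\<And>z. z \<in> cball 0 R \<Longrightarrow> \<bar>?dv z\<bar> \<le> M" "\<And>z. z \<in> cball 0 R \<Longrightarrow> norm (v z) \<le> M" "0 \<le> M"
    using M' by (auto simp: M_def le_max_iff_disj)
  have xc: "x \<in> cball 0 R" using x by auto
  define F where "F n z = (1 / s n z) *\<^sub>R v z" for n z
  define T1 where "T1 n z = ?dv z / s n z" for n z
  define T2 where "T2 n z = v z \<bullet> ((x - z) /\<^sub>R s n z ^ 3)" for n z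
  have s_der: "((\<lambda>z. 1 / s n z) has_derivative (\<lambda>h. ((x - z) /\<^sub>R s n z ^ 3) \<bullet> h)) (at z within S)" for n z S
    unfolding s_def by (rule regularised_inverse_norm_derivative [OF d0])
  have F_C1: "C1_on (cball 0 R) (F n)" for n
    unfolding F_def
  proof (rule C1_on_scaleR [OF C1_onI v])
    show "continuous_on (cball 0 R) (\<lambda>z. ((x - z) /\<^sub>R s n z ^ 3) \<bullet> h)" for h
      using spos [of n] by (intro continuous_intros s_cont) (auto simp: less_imp_neq [THEN not_sym])
  qed (rule s_der)
  have div_F: "div_on (cball 0 R) (F n) z = T1 n z + T2 n z" if z: "z \<in> cball 0 R" for n z
  proof -
    obtain v' where "(v has_derivative v') (at z within cball 0 R)" using C1_onD [OF v] z by metis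
    from div_on_scaleR [OF R z s_der this, of n] show ?thesis by (simp add: F_def [abs_def] T1_def T2_def)
  qed
  have c: "continuous_on (ball 0 R - {x}) ?dv" "continuous_on (ball 0 R - {x}) v"
    by (auto intro: continuous_on_subset [OF cdv] continuous_on_subset [OF cv])
  have cT: "continuous_on (ball 0 R - {x}) (T1 n)" "continuous_on (ball 0 R - {x}) (T2 n)" for n
    unfolding T1_def T2_def using spos [of n]
    by (intro continuous_intros s_cont c; auto simp: less_imp_neq [THEN not_sym])+
  have cl1: "continuous_on (ball 0 R - {x}) (\<lambda>z. ?dv z / norm (x - z))"
    by (intro continuous_intros c) auto
  have l1: "(\<lambda>n. T1 n z) \<longlonglongrightarrow> ?dv z / norm (x - z)" if "z \<in> ball 0 R" "z \<noteq> x" for z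
    unfolding T1_def using that by (intro tendsto_intros s_lim) auto
  have b1: "\<bar>T1 n z\<bar> \<le> M * norm (x - z) powr (-1)" if z: "z \<in> ball 0 R" "z \<noteq> x" for n z
  proof -
    have "\<bar>?dv z\<bar> / s n z \<le> M / norm (x - z)"
      using s_ge [of z n] M(1) [of z] M(3) z by (intro frac_le) auto
    thus ?thesis using spos [of n z] z by (simp add: T1_def powr_minus_divide abs_of_pos)
  qed
  have lim1: "set_integrable lborel (ball 0 R) (T1 n)"
     "(\<lambda>n. LBINT z:ball 0 R. T1 n z) \<longlonglongrightarrow> (LBINT z:ball 0 R. ?dv z / norm (x - z))" for n
    by (rule Riesz_dominated_limit [OF xc _ _ cT(1) cl1 l1 b1]; simp)+
  have cl2: "continuous_on (ball 0 R - {x}) (\<lambda>z. v z \<bullet> newton_force (x - z))"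
    unfolding newton_force_def by (intro continuous_intros c) auto
  have l2: "(\<lambda>n. T2 n z) \<longlonglongrightarrow> v z \<bullet> newton_force (x - z)" if "z \<in> ball 0 R" "z \<noteq> x" for z
    unfolding T2_def newton_force_def using that by (intro tendsto_intros s_lim) auto
  have b2: "\<bar>T2 n z\<bar> \<le> M * norm (x - z) powr (-2)" if z: "z \<in> ball 0 R" "z \<noteq> x" for n z
  proof -
    have "\<bar>T2 n z\<bar> \<le> norm (v z) * (norm (x - z) / s n z ^ 3)"
      unfolding T2_def using Cauchy_Schwarz_ineq2 [of "v z" "(x - z) /\<^sub>R s n z ^ 3"] spos [of n z]
      by (simp add: divide_inverse mult_ac)
    also have "\<dots> \<le> M * (norm (x - z) / norm (x - z) ^ 3)"
      using M(2) [of z] M(3) z s_ge [of z n] spos [of n z]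
      by (intro mult_mono divide_left_mono power_mono) auto
    also have "norm (x - z) / norm (x - z) ^ 3 = norm (x - z) powr (-2)"
      using z by (simp add: power2_eq_square power3_eq_cube powr_minus_divide)
    finally show ?thesis .
  qed
  have lim2: "set_integrable lborel (ball 0 R) (T2 n)"
     "(\<lambda>n. LBINT z:ball 0 R. T2 n z) \<longlonglongrightarrow> (LBINT z:ball 0 R. v z \<bullet> newton_force (x - z))" for n
    by (rule Riesz_dominated_limit [OF xc _ _ cT(2) cl2 l2 b2]; simp)+
  have flux: "(\<lambda>n. sphere_flux R (F n)) \<longlonglongrightarrow> sphere_flux R (\<lambda>z. v z /\<^sub>R norm (x - z))"
  proof -
    define Q where "Q = {0..pi} \<times> {0..2 * pi}"
    have Q: "compact Q" "Q \<in> sets borel"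
      unfolding Q_def by (auto intro!: compact_Times borel_closed closed_Times)
    define \<delta> where "\<delta> = R - norm x"
    have \<delta>: "0 < \<delta>" using x by (simp add: \<delta>_def)
    let ?P = "\<lambda>y. sphere_point R (fst y) (snd y)"
    have nP: "norm (?P y) = R" for y using R by (simp add: norm_sphere_point)
    have dP: "\<delta> \<le> norm (x - ?P y)" for y
      using norm_triangle_ineq2 [of "?P y" x] nP [of y] by (simp add: \<delta>_def norm_minus_commute)
    have cP: "continuous_on UNIV ?P" unfolding sphere_point_e_r by (intro continuous_intros)
    have cvP: "continuous_on UNIV (\<lambda>y. v (?P y))"
      by (rule continuous_on_compose2 [OF cv cP]) (use nP R in auto)
    let ?g = "\<lambda>c y. (v (?P y) /\<^sub>R c (?P y)) \<bullet> (?P y /\<^sub>R R) * (R\<^sup>2 * sin (fst y))"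
    have m: "(\<lambda>y. indicator Q y *\<^sub>R ?g c y) \<in> borel_measurable lborel"
      if "continuous_on UNIV (\<lambda>y. c (?P y))" "\<And>y. c (?P y) \<noteq> 0" for c :: "real^3 \<Rightarrow> real"
    proof -
      have "continuous_on UNIV (?g c)"
        using that by (intro continuous_intros cvP cP) auto
      thus ?thesis using Q(2) borel_measurable_continuous_onI [of "?g c"]
        by (intro borel_measurable_scaleR borel_measurable_indicator) auto
    qed
    have csP: "continuous_on UNIV (\<lambda>y. s n (?P y))" for n
      by (rule continuous_on_compose2 [OF s_cont cP]) auto
    have bnd: "norm (indicator Q y *\<^sub>R ?g (s n) y) \<le> indicator Q y *\<^sub>R (M / \<delta> * R\<^sup>2)" for n y
    proof -
      have "norm ((v (?P y) /\<^sub>R s n (?P y)) \<bullet> (?P y /\<^sub>R R)) \<le> norm (v (?P y) /\<^sub>R s n (?P y)) * norm (?P y /\<^sub>R R)"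
        by (rule Cauchy_Schwarz_ineq2 [folded real_norm_def])
      also have "\<dots> = norm (v (?P y)) / s n (?P y)"
        using spos [of n "?P y"] R nP [of y] by (simp add: divide_inverse mult.commute)
      also have "\<dots> \<le> M / \<delta>"
        using M(2) [of "?P y"] M(3) nP [of y] dP [of y] \<delta> s_ge [of "?P y" n] by (intro frac_le) (auto intro: order_trans)
      finally have "norm (?g (s n) y) \<le> (M / \<delta>) * (R\<^sup>2 * 1)"
        unfolding norm_mult using M(3) \<delta> by (intro mult_mono) auto
      thus ?thesis by (auto simp: indicator_def)
    qed
    have "(\<lambda>n. \<integral>y. indicator Q y *\<^sub>R ?g (s n) y \<partial>lborel) \<longlonglongrightarrow> (\<integral>y. indicator Q y *\<^sub>R ?g (\<lambda>z. norm (x - z)) y \<partial>lborel)"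
    proof (rule integral_dominated_convergence [where w = "\<lambda>y. indicator Q y *\<^sub>R (M / \<delta> * R\<^sup>2)"])
      show "(\<lambda>y. indicator Q y *\<^sub>R ?g (\<lambda>z. norm (x - z)) y) \<in> borel_measurable lborel"
        using dP \<delta> by (intro m continuous_intros cP) (metis less_le_not_le)
      show "(\<lambda>y. indicator Q y *\<^sub>R ?g (s n) y) \<in> borel_measurable lborel" for n
        using spos by (intro m csP) (metis less_irrefl)
      show "integrable lborel (\<lambda>y. indicator Q y *\<^sub>R (M / \<delta> * R\<^sup>2))"
        by (intro borel_integrable_compact Q continuous_intros)
      show "AE y in lborel. (\<lambda>n. indicator Q y *\<^sub>R ?g (s n) y) \<longlonglongrightarrow> indicator Q y *\<^sub>R ?g (\<lambda>z. norm (x - z)) y"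
      proof (rule AE_I2)
        fix y
        have "norm (x - ?P y) \<noteq> 0" using dP [of y] \<delta> by linarith
        thus "(\<lambda>n. indicator Q y *\<^sub>R ?g (s n) y) \<longlonglongrightarrow> indicator Q y *\<^sub>R ?g (\<lambda>z. norm (x - z)) y"
          by (intro tendsto_intros s_lim) auto
      qed
      show "AE y in lborel. norm (indicator Q y *\<^sub>R ?g (s n) y) \<le> indicator Q y *\<^sub>R (M / \<delta> * R\<^sup>2)" for n
        using bnd by (intro AE_I2)
    qed
    thus ?thesis
      unfolding sphere_flux_def sphere_integral_def set_lebesgue_integral_def Q_def F_def
      by (simp add: case_prod_beta divide_inverse)
  qed
  have eq: "(LBINT z:ball 0 R. T1 n z) + (LBINT z:ball 0 R. T2 n z) = sphere_flux R (F n)" for n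
  proof -
    have "(LBINT z:ball 0 R. T1 n z) + (LBINT z:ball 0 R. T2 n z) = (LBINT z:ball 0 R. T1 n z + T2 n z)"
      using set_integral_add(2) [OF lim1(1) lim2(1)] by simp
    also have "\<dots> = (LBINT z:ball 0 R. div_on (cball 0 R) (F n) z)"
      unfolding set_lebesgue_integral_def
      by (intro Bochner_Integration.integral_cong refl) (auto simp: div_F indicator_def)
    also have "\<dots> = sphere_flux R (F n)" by (rule divergence_theorem_ball [OF R F_C1])
    finally show ?thesis .
  qed
  have "(\<lambda>n. sphere_flux R (F n)) \<longlonglongrightarrow> (LBINT z:ball 0 R. ?dv z / norm (x - z)) + (LBINT z:ball 0 R. v z \<bullet> newton_force (x - z))"
    using tendsto_add [OF lim1(2) lim2(2)] by (simp add: eq)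
  thus ?thesis using flux by (rule LIMSEQ_unique)
qed



section \<open>The equilibrium star\<close>

locale liquid_star =
  fixes \<gamma> \<rho>0 a R :: real and f :: "real \<Rightarrow> real"
  assumes gamma: "1 \<le> \<gamma>" "\<gamma> \<le> 2" and central: "1 < \<rho>0"
    and profile: "lane_emden \<gamma> \<rho>0 a f"
    and radius: "0 < R" "R < a" "f R = 1"
begin

definition f' :: "real \<Rightarrow> real" where "f' s = vector_derivative f (at s)"

text \<open>
  The radial derivative of the specific enthalpy, which is \<open>\<gamma> / (\<gamma> - 1) f\<^bsup>\<gamma>-1\<^esup>\<close> for \<open>\<gamma> > 1\<close> and \<open>ln f\<close> for \<open>\<gamma> = 1\<close>. In terms
  of its slope the two forms of the Lane--Emden equation are one and the same.
\<close>

definition enthalpy_slope :: "real \<Rightarrow> real" where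
  "enthalpy_slope s = \<gamma> * f s powr (\<gamma> - 2) * f' s"

definition mass :: "real \<Rightarrow> real" where
  "mass s = 4 * pi * integral {0..s} (\<lambda>u. u\<^sup>2 * f u)"

text \<open>
  Up to the factor \<open>4\<pi> / 3\<close> the mean of the density over the ball of radius \<open>s\<close>; the value at \<open>0\<close> is the limit
  (\<open>mean_density_lim\<close>).
\<close>

definition mean_density :: "real \<Rightarrow> real" where
  "mean_density s = (if s = 0 then 4 / 3 * pi * \<rho>0 else mass s / s ^ 3)"

lemma f_0: "f 0 = \<rho>0" and f_pos: "s \<in> {0..<a} \<Longrightarrow> 0 < f s"
  and f_der_0: "(f has_real_derivative 0) (at 0 within {0..<a})"
  using profile by (auto simp: lane_emden_def)

lemma f_der: "s \<in> {0<..<a} \<Longrightarrow> (f has_real_derivative f' s) (at s)"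
  using profile
  by (auto simp: lane_emden_def twice_differentiable_on_def f'_def has_real_derivative_iff_has_vector_derivative
     differentiable_on_def at_within_open [of _ "{0<..<a}"] vector_derivative_works [symmetric])

lemma f'_der: assumes "s \<in> {0<..<a}" obtains D where "(f' has_real_derivative D) (at s)"
proof -
  have "f' differentiable (at s)"
    using profile assms
    by (auto simp: lane_emden_def twice_differentiable_on_def f'_def [abs_def] differentiable_on_def at_within_open [of _ "{0<..<a}"])
  thus ?thesis using that by (metis real_differentiableE real_differentiable_def)
qed

lemma f_cont: "continuous_on {0..<a} f"
  unfolding continuous_on_eq_continuous_within
proof
  fix s assume s: "s \<in> {0..<a}"
  show "continuous (at s within {0..<a}) f"
  proof (cases "s = 0")
    case True
    thus ?thesis using f_der_0 by (auto intro: DERIV_continuous)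
  next
    case False
    hence "isCont f s" using s f_der [of s] by (auto intro: DERIV_isCont)
    thus ?thesis by (rule continuous_at_imp_continuous_at_within)
  qed
qed

lemma enthalpy_slope_ode:
  assumes s: "s \<in> {0<..<a}"
  shows "((\<lambda>s. s\<^sup>2 * enthalpy_slope s) has_real_derivative - (4 * pi * s\<^sup>2 * f s)) (at s)"
proof -
  let ?g = "\<lambda>s. s\<^sup>2 * enthalpy_slope s"
  have fp: "0 < f s" and s0: "s \<noteq> 0" using s f_pos [of s] by auto
  have ev: "eventually (\<lambda>u. u \<in> {0<..<a}) (nhds s)" using s by (intro eventually_nhds_in_open) auto
  obtain D where D: "(f' has_real_derivative D) (at s)" using f'_der [OF s] .
  have diff: "\<exists>G. (?g has_real_derivative G) (at s)"
    unfolding enthalpy_slope_def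
    by (rule exI) (rule derivative_eq_intros D f_der s fp refl)+
  hence g: "(?g has_real_derivative deriv ?g s) (at s)" using DERIV_deriv_iff_has_field_derivative by auto
  have ode: "(if \<gamma> = 1 then radial_laplacian (\<lambda>s. ln (f s)) s
       else \<gamma> / (\<gamma> - 1) * radial_laplacian (\<lambda>s. f s powr (\<gamma> - 1)) s) + 4 * pi * f s = 0"
    using profile s by (auto simp: lane_emden_def)
  have "deriv ?g s = - (4 * pi * s\<^sup>2 * f s)"
  proof (cases "\<gamma> = 1")
    case True
    have "deriv (\<lambda>s. s\<^sup>2 * deriv (\<lambda>s. ln (f s)) s) s = deriv ?g s"
    proof (rule deriv_cong_ev [OF eventually_mono [OF ev]])
      fix u assume u: "u \<in> {0<..<a}"
      hence "0 < f u" using f_pos [of u] by auto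
      hence "((\<lambda>s. ln (f s)) has_real_derivative f' u / f u) (at u)"
        by (auto intro!: derivative_eq_intros f_der u)
      hence "deriv (\<lambda>s. ln (f s)) u = f' u / f u" by (rule DERIV_imp_deriv)
      thus "u\<^sup>2 * deriv (\<lambda>s. ln (f s)) u = ?g u"
        unfolding enthalpy_slope_def using \<open>0 < f u\<close> True by (simp add: powr_minus_divide)
    qed simp
    thus ?thesis using ode True s0 by (simp add: radial_laplacian_def field_simps)
  next
    case False
    have "deriv (\<lambda>s. s\<^sup>2 * deriv (\<lambda>s. f s powr (\<gamma> - 1)) s) s = deriv (\<lambda>s. (\<gamma> - 1) / \<gamma> * ?g s) s"
    proof (rule deriv_cong_ev [OF eventually_mono [OF ev]])
      fix u assume u: "u \<in> {0<..<a}"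
      hence "0 < f u" using f_pos [of u] by auto
      hence "((\<lambda>s. f s powr (\<gamma> - 1)) has_real_derivative (\<gamma> - 1) * f u powr (\<gamma> - 2) * f' u) (at u)"
        by (auto intro!: derivative_eq_intros f_der u)
      hence "deriv (\<lambda>s. f s powr (\<gamma> - 1)) u = (\<gamma> - 1) * f u powr (\<gamma> - 2) * f' u" by (rule DERIV_imp_deriv)
      thus "u\<^sup>2 * deriv (\<lambda>s. f s powr (\<gamma> - 1)) u = (\<gamma> - 1) / \<gamma> * ?g u"
        using gamma by (simp add: enthalpy_slope_def)
    qed simp
    also have "\<dots> = (\<gamma> - 1) / \<gamma> * deriv ?g s"
      by (rule DERIV_imp_deriv [OF DERIV_cmult [OF g]])
    finally have "\<gamma> / (\<gamma> - 1) * ((\<gamma> - 1) / \<gamma> * deriv ?g s / s\<^sup>2) + 4 * pi * f s = 0"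
      using ode False by (simp add: radial_laplacian_def)
    moreover have "\<gamma> / (\<gamma> - 1) * ((\<gamma> - 1) / \<gamma> * deriv ?g s / s\<^sup>2) = deriv ?g s / s\<^sup>2"
      using False gamma by simp
    ultimately have "deriv ?g s / s\<^sup>2 = - (4 * pi * f s)" by linarith
    thus ?thesis using s0 by (simp add: divide_eq_eq mult_ac)
  qed
  thus ?thesis using g by simp
qed

lemma weighted_cont: "continuous_on {0..<a} (\<lambda>u. u\<^sup>2 * f u)"
  by (intro continuous_intros f_cont)

lemma mass_der_within:
  assumes "b < a" "s \<in> {0..b}"
  shows "(mass has_real_derivative 4 * pi * s\<^sup>2 * f s) (at s within {0..b})"
proof -
  have "((\<lambda>x. integral {0..x} (\<lambda>u. u\<^sup>2 * f u)) has_real_derivative s\<^sup>2 * f s) (at s within {0..b})"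
    using assms by (intro integral_has_real_derivative continuous_on_subset [OF weighted_cont]) auto
  from DERIV_cmult [OF this, of "4 * pi"] show ?thesis
    unfolding mass_def [abs_def] by (simp add: mult.assoc)
qed

lemma mass_der:
  assumes s: "s \<in> {0<..<a}"
  shows "(mass has_real_derivative 4 * pi * s\<^sup>2 * f s) (at s)"
proof -
  obtain b where b: "s < b" "b < a" using s dense by auto
  have "(mass has_real_derivative 4 * pi * s\<^sup>2 * f s) (at s within {0<..<b})"
    using mass_der_within [of b s] s b by (intro DERIV_subset [of _ _ _ "{0..b}" "{0<..<b}"]) auto
  thus ?thesis using at_within_open [of s "{0<..<b}"] s b by simp
qed

lemma mass_0 [simp]: "mass 0 = 0" by (simp add: mass_def)

lemma mass_cont: "b < a \<Longrightarrow> continuous_on {0..b} mass"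
  using mass_der_within by (meson DERIV_continuous continuous_on_eq_continuous_within)

lemma mass_pos: assumes s: "s \<in> {0<..<a}" shows "0 < mass s"
proof -
  have "\<exists>\<xi>. 0 < \<xi> \<and> \<xi> < s \<and> mass s - mass 0 = (s - 0) * (4 * pi * \<xi>\<^sup>2 * f \<xi>)"
  proof -
    have "\<exists>l z. 0 < z \<and> z < s \<and> DERIV mass z :> l \<and> mass s - mass 0 = (s - 0) * l"
    proof (rule MVT)
      show "continuous_on {0..s} mass" using s by (intro mass_cont) auto
      show "mass differentiable (at x)" if "0 < x" "x < s" for x
        using mass_der [of x] that s by (auto simp: real_differentiable_def)
    qed (use s in auto)
    then obtain l z where z: "0 < z" "z < s" "DERIV mass z :> l" "mass s - mass 0 = (s - 0) * l" by blast
    moreover have "DERIV mass z :> 4 * pi * z\<^sup>2 * f z" using z s by (intro mass_der) auto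
    ultimately show ?thesis using DERIV_unique by blast
  qed
  then obtain \<xi> where \<xi>: "0 < \<xi>" "\<xi> < s" "mass s - mass 0 = (s - 0) * (4 * pi * \<xi>\<^sup>2 * f \<xi>)" by blast
  moreover have "0 < f \<xi>" using \<xi> s by (intro f_pos) auto
  ultimately show ?thesis using s by simp
qed

text \<open>
  Only the derivative of the profile at the centre is prescribed, not the limit of its derivatives. By the
  mean value theorem the derivatives still tend to \<open>0\<close> along some sequence, and this suffices to
  fix the constant of integration in \<open>enthalpy_slope_eq\<close>.
\<close>

lemma slopes_vanish_along_sequence:
  obtains \<xi> where "\<And>n. \<xi> n \<in> {0<..<a}" "\<xi> \<longlonglongrightarrow> 0" "(\<lambda>n. f' (\<xi> n)) \<longlonglongrightarrow> 0"
proof -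
  have a0: "0 < a" using radius by simp
  define s where "s n = a / real (n + 2)" for n
  have s: "s n \<in> {0<..<a}" for n using a0 by (auto simp: s_def field_simps intro: add_pos_nonneg)
  have slim: "s \<longlonglongrightarrow> 0" unfolding s_def using LIMSEQ_ignore_initial_segment [OF lim_const_over_n [of a], of 2] by simp
  have "\<exists>\<xi>. 0 < \<xi> \<and> \<xi> < s n \<and> f (s n) - f 0 = (s n - 0) * f' \<xi>" for n
  proof -
    have "\<exists>l z. 0 < z \<and> z < s n \<and> DERIV f z :> l \<and> f (s n) - f 0 = (s n - 0) * l"
    proof (rule MVT)
      show "continuous_on {0..s n} f" using s [of n] by (intro continuous_on_subset [OF f_cont]) auto
      show "f differentiable (at x)" if "0 < x" "x < s n" for x
        using f_der [of x] that s [of n] by (auto simp: real_differentiable_def)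
    qed (use s [of n] in auto)
    then obtain l z where z: "0 < z" "z < s n" "DERIV f z :> l" "f (s n) - f 0 = (s n - 0) * l" by blast
    moreover have "DERIV f z :> f' z" using z s [of n] by (intro f_der) auto
    ultimately show ?thesis using DERIV_unique by blast
  qed
  then obtain \<xi> where \<xi>: "\<And>n. 0 < \<xi> n" "\<And>n. \<xi> n < s n" "\<And>n. f (s n) - f 0 = (s n - 0) * f' (\<xi> n)" by metis
  have "((\<lambda>y. (f y - f 0) / (y - 0)) \<longlongrightarrow> 0) (at 0 within {0..<a})"
    using f_der_0 by (simp add: has_field_derivative_iff)
  moreover have "filterlim s (at 0 within {0..<a}) sequentially"
    using slim s by (auto simp: filterlim_at less_imp_le intro!: always_eventually) (metis less_irrefl)
  ultimately have "(\<lambda>n. (f (s n) - f 0) / (s n - 0)) \<longlonglongrightarrow> 0" by (rule filterlim_compose)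
  moreover have "(f (s n) - f 0) / (s n - 0) = f' (\<xi> n)" for n
    using \<xi>(3) [of n] s [of n] by simp
  ultimately have "(\<lambda>n. f' (\<xi> n)) \<longlonglongrightarrow> 0" by simp
  moreover have "\<xi> \<longlonglongrightarrow> 0"
    by (rule tendsto_sandwich [OF _ _ tendsto_const slim]) (use \<xi> in \<open>auto intro!: always_eventually less_imp_le\<close>)
  moreover have "\<xi> n \<in> {0<..<a}" for n using \<xi>(1,2) [of n] s [of n] by auto
  ultimately show ?thesis using that by blast
qed

text \<open>
  The sum \<open>s\<^sup>2 q(s) + m(s)\<close> of the weighted enthalpy slope and the mass has zero derivative by the
  Lane--Emden equation. The constant is \<open>0\<close>: there is no point mass at the centre.
\<close>

lemma enthalpy_slope_eq:
  assumes s: "s \<in> {0<..<a}"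
  shows "s\<^sup>2 * enthalpy_slope s = - mass s"
proof -
  have "\<exists>c. \<forall>s\<in>{0<..<a}. s\<^sup>2 * enthalpy_slope s + mass s = c"
  proof (rule has_field_derivative_zero_constant)
    fix s assume s: "s \<in> {0<..<a}"
    have "((\<lambda>s. s\<^sup>2 * enthalpy_slope s + mass s) has_real_derivative 0) (at s)"
      using DERIV_add [OF enthalpy_slope_ode [OF s] mass_der [OF s]] by simp
    thus "((\<lambda>s. s\<^sup>2 * enthalpy_slope s + mass s) has_real_derivative 0) (at s within {0<..<a})"
      by (rule has_field_derivative_at_within)
  qed simp
  then obtain c where c: "\<And>s. s \<in> {0<..<a} \<Longrightarrow> s\<^sup>2 * enthalpy_slope s + mass s = c" by blast
  obtain \<xi> where \<xi>: "\<And>n. \<xi> n \<in> {0<..<a}" "\<xi> \<longlonglongrightarrow> 0" "(\<lambda>n. f' (\<xi> n)) \<longlonglongrightarrow> 0"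
    using slopes_vanish_along_sequence by blast
  have f\<xi>: "(\<lambda>n. f (\<xi> n)) \<longlonglongrightarrow> f 0"
    using radius \<xi> by (intro continuous_on_tendsto_compose [OF f_cont]) (auto intro!: always_eventually less_imp_le)
  define b where "b = a / 2"
  have b: "0 < b" "b < a" using radius by (auto simp: b_def)
  have "eventually (\<lambda>n. \<xi> n < b) sequentially" using \<xi>(2) b(1) by (rule order_tendstoD(2))
  hence m\<xi>: "(\<lambda>n. mass (\<xi> n)) \<longlonglongrightarrow> mass 0"
    using \<xi>(1) b by (intro continuous_on_tendsto_compose [OF mass_cont [OF b(2)] \<xi>(2)])
      (auto elim!: eventually_mono intro: less_imp_le)
  have "(\<lambda>n. (\<xi> n)\<^sup>2 * enthalpy_slope (\<xi> n) + mass (\<xi> n)) \<longlonglongrightarrow> 0\<^sup>2 * (\<gamma> * f 0 powr (\<gamma> - 2) * 0) + mass 0"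
    unfolding enthalpy_slope_def using f_0 central by (intro tendsto_intros \<xi> f\<xi> m\<xi>) auto
  hence "(\<lambda>n. c) \<longlonglongrightarrow> 0" using c \<xi>(1) by simp
  hence "c = 0" by (simp add: LIMSEQ_const_iff)
  thus ?thesis using c [OF s] by simp
qed

lemma f'_eq:
  assumes s: "s \<in> {0<..<a}"
  shows "f' s = - (s * mean_density s) * f s powr (2 - \<gamma>) / \<gamma>"
proof -
  have fs: "0 < f s" using s f_pos by auto
  have "f s powr (\<gamma> - 2) * f s powr (2 - \<gamma>) = 1" using fs by (simp flip: powr_add)
  hence "f' s = (enthalpy_slope s) * f s powr (2 - \<gamma>) / \<gamma>"
    using gamma by (simp add: enthalpy_slope_def)
  also have "enthalpy_slope s = - mass s / s\<^sup>2"
    using enthalpy_slope_eq [OF s] s by (simp add: field_simps)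
  also have "\<dots> = - (s * mean_density s)"
    using s by (simp add: mean_density_def power2_eq_square power3_eq_cube)
  finally show ?thesis .
qed

lemma mean_density_der:
  assumes s: "s \<in> {0<..<a}"
  shows "\<exists>D. (mean_density has_real_derivative D) (at s)"
proof -
  have ev: "eventually (\<lambda>u. u \<in> {0<..<a}) (nhds s)" using s by (intro eventually_nhds_in_open) auto
  have "\<exists>D. ((\<lambda>s. mass s / s ^ 3) has_real_derivative D) (at s)"
    by (rule exI) (rule derivative_eq_intros mass_der s refl | use s in simp)+
  moreover have "eventually (\<lambda>u. mean_density u = mass u / u ^ 3) (nhds s)"
    using ev by eventually_elim (simp add: mean_density_def)
  ultimately show ?thesis using DERIV_cong_ev [OF refl _ refl] by metis
qed

text \<open>
  This limit makes the gravitational field differentiable at the centre, where the profile itself is only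
  known to have derivative \<open>0\<close>.
\<close>

lemma mean_density_lim: "(mean_density \<longlongrightarrow> mean_density 0) (at_right 0)"
proof -
  define b where "b = a / 2"
  have b: "0 < b" "b < a" using radius by (auto simp: b_def)
  have at: "at 0 within {0..b} = at_right (0::real)"
    using b by (simp add: at_within_Icc_at_right)
  have mlim: "(mass \<longlongrightarrow> 0) (at_right 0)"
    using mass_cont [OF b(2)] b by (auto simp: continuous_on_def at [symmetric] dest!: bspec [of _ _ 0])
  have "(f \<longlongrightarrow> f 0) (at 0 within {0..b})"
  proof -
    have "continuous_on {0..b} f" by (rule continuous_on_subset [OF f_cont]) (use b in auto)
    thus ?thesis using b by (auto simp: continuous_on_def)
  qed
  hence flim: "(f \<longlongrightarrow> \<rho>0) (at_right 0)" by (simp add: at f_0)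
  have ev: "eventually (\<lambda>s. s \<in> {0<..<a}) (at_right 0)"
    using radius by (intro eventually_at_right_real) auto
  have "((\<lambda>s. mass s / s ^ 3) \<longlongrightarrow> 4 / 3 * pi * \<rho>0) (at_right 0)"
  proof (rule lhopital_right_0 [OF mlim])
    show "((\<lambda>s::real. s ^ 3) \<longlongrightarrow> 0) (at_right 0)" by (auto intro!: tendsto_eq_intros)
    show "\<forall>\<^sub>F x in at_right 0. x ^ 3 \<noteq> (0::real)" using ev by eventually_elim auto
    show "\<forall>\<^sub>F x in at_right 0. 3 * x\<^sup>2 \<noteq> (0::real)" using ev by eventually_elim auto
    show "\<forall>\<^sub>F x in at_right 0. (mass has_real_derivative 4 * pi * x\<^sup>2 * f x) (at x)"
      using ev by eventually_elim (rule mass_der)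
    show "\<forall>\<^sub>F x in at_right 0. ((\<lambda>s. s ^ 3) has_real_derivative 3 * x\<^sup>2) (at x)"
      by (intro always_eventually allI) (auto intro!: derivative_eq_intros)
    have "((\<lambda>x. 4 / 3 * pi * f x) \<longlongrightarrow> 4 / 3 * pi * \<rho>0) (at_right 0)"
      by (intro tendsto_intros flim)
    moreover have "\<forall>\<^sub>F x in at_right 0. 4 / 3 * pi * f x = (4 * pi * x\<^sup>2 * f x) / (3 * x\<^sup>2)"
      using ev by eventually_elim auto
    ultimately show "filterlim (\<lambda>x. (4 * pi * x\<^sup>2 * f x) / (3 * x\<^sup>2)) (nhds (4 / 3 * pi * \<rho>0)) (at_right 0)"
      by (rule Lim_transform_eventually)
  qed
  moreover have "\<forall>\<^sub>F s in at_right 0. mass s / s ^ 3 = mean_density s"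
    using ev by eventually_elim (simp add: mean_density_def)
  ultimately have "(mean_density \<longlongrightarrow> 4 / 3 * pi * \<rho>0) (at_right 0)" by (rule Lim_transform_eventually)
  thus ?thesis by (simp add: mean_density_def)
qed

text \<open>
  This is \<open>- m(|x|) x / |x|\<^sup>3\<close>, written without the singularity at the centre. It is the gradient of the enthalpy
  by \<open>liquid_density_has_derivative\<close> and the gravitational field \<open>- \<nabla>K\<rho>\<close> by \<open>gravity_eq_force\<close>.
\<close>

definition gravity :: "real^3 \<Rightarrow> real^3" where
  "gravity x = - mean_density (norm x) *\<^sub>R x"

lemma mean_density_norm_lim: "((\<lambda>x::real^3. mean_density (norm x)) \<longlongrightarrow> mean_density 0) (at 0)"
proof (rule filterlim_compose [OF mean_density_lim])
  show "filterlim (norm :: real^3 \<Rightarrow> real) (at_right 0) (at 0)"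
    by (auto simp: filterlim_at eventually_at_filter intro!: tendsto_eq_intros)
qed

text \<open>
  Away from the centre this is the chain rule. At the centre the field is \<open>- \<mu>(|x|) x\<close> with \<open>\<mu>\<close> continuous, and
  this has derivative \<open>- \<mu>(0)\<close> times the identity.
\<close>

lemma gravity_differentiable:
  assumes x: "norm x < a"
  shows "\<exists>W. (gravity has_derivative W) (at x)"
proof (cases "x = 0")
  case True
  have "(gravity has_derivative (\<lambda>h. - mean_density 0 *\<^sub>R h)) (at 0)"
    unfolding has_derivative_at
  proof
    show "bounded_linear (\<lambda>h::real^3. - mean_density 0 *\<^sub>R h)" by (rule bounded_linear_scaleR_right)
    have "((\<lambda>h::real^3. \<bar>mean_density (norm h) - mean_density 0\<bar>) \<longlongrightarrow> \<bar>mean_density 0 - mean_density 0\<bar>) (at 0)"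
      by (intro tendsto_intros mean_density_norm_lim)
    hence "((\<lambda>h::real^3. \<bar>mean_density (norm h) - mean_density 0\<bar>) \<longlongrightarrow> 0) (at 0)" by simp
    moreover have "\<forall>\<^sub>F h in at 0. \<bar>mean_density (norm h) - mean_density 0\<bar> =
        norm (gravity (0 + h) - gravity 0 - - mean_density 0 *\<^sub>R h) / norm (h :: real^3)"
    proof -
      have "\<forall>\<^sub>F h in at 0. h \<noteq> (0 :: real^3)" by (simp add: eventually_at_filter)
      thus ?thesis
      proof eventually_elim
        fix h :: "real^3" assume h: "h \<noteq> 0"
        have "gravity (0 + h) - gravity 0 - - mean_density 0 *\<^sub>R h = (mean_density 0 - mean_density (norm h)) *\<^sub>R h"
          by (simp add: gravity_def algebra_simps)
        thus "\<bar>mean_density (norm h) - mean_density 0\<bar> =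
            norm (gravity (0 + h) - gravity 0 - - mean_density 0 *\<^sub>R h) / norm h"
          using h by (simp add: abs_minus_commute)
      qed
    qed
    ultimately show "(\<lambda>h. norm (gravity (0 + h) - gravity 0 - - mean_density 0 *\<^sub>R h) / norm h) \<midarrow>0\<rightarrow> 0"
      by (rule Lim_transform_eventually)
  qed
  thus ?thesis using True by blast
next
  case False
  obtain D where D: "(mean_density has_real_derivative D) (at (norm x))"
    using mean_density_der [of "norm x"] x False by auto
  have n: "(norm has_derivative (\<lambda>h. (x \<bullet> h) / norm x)) (at x)"
    using has_derivative_norm [OF False] by (simp add: sgn_div_norm inner_commute divide_inverse mult.commute)
  have "((\<lambda>x. mean_density (norm x)) has_derivative (\<lambda>h. (x \<bullet> h) / norm x * D)) (at x)"
    by (rule DERIV_compose_FDERIV [OF D n])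
  thus ?thesis unfolding gravity_def [abs_def]
    by (intro exI) (rule has_derivative_scaleR has_derivative_minus has_derivative_ident | assumption)+
qed

lemma gravity_continuous: "continuous_on (ball 0 a) gravity"
proof -
  have "isCont gravity x" if "norm x < a" for x
    using gravity_differentiable [OF that] has_derivative_continuous by blast
  thus ?thesis by (intro continuous_at_imp_continuous_on) auto
qed

text \<open>
  This is \<open>\<gamma> \<rho>\<^bsup>\<gamma>-2\<^esup> \<nabla>\<rho> = g\<close>, the balance of pressure and gravity, solved for \<open>\<nabla>\<rho>\<close>.
\<close>

lemma f_norm_has_derivative:
  assumes x: "norm (x :: real^3) < a"
  shows "((\<lambda>x. f (norm x)) has_derivative (\<lambda>h. ((f (norm x) powr (2 - \<gamma>) / \<gamma>) *\<^sub>R gravity x) \<bullet> h)) (at x)"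
proof (cases "x = 0")
  case True
  have "((\<lambda>x::real^3. f (norm x)) has_derivative (\<lambda>h. 0)) (at 0)"
    unfolding has_derivative_at
  proof
    have "((\<lambda>y. \<bar>(f y - f 0) / (y - 0)\<bar>) \<longlongrightarrow> \<bar>0\<bar>) (at 0 within {0..<a})"
      using f_der_0 unfolding has_field_derivative_iff by (rule tendsto_rabs)
    moreover have "filterlim (norm :: real^3 \<Rightarrow> real) (at 0 within {0..<a}) (at 0)"
    proof -
      have "\<forall>\<^sub>F x in at (0::real^3). norm x < a"
        using x by (intro order_tendstoD(2) [where y = 0] tendsto_norm_zero tendsto_ident_at) (use radius in auto)
      thus ?thesis
        by (auto simp: filterlim_at eventually_at_filter elim: eventually_mono intro!: tendsto_eq_intros)
    qed
    ultimately have "((\<lambda>h::real^3. \<bar>(f (norm h) - f 0) / (norm h - 0)\<bar>) \<longlongrightarrow> \<bar>0\<bar>) (at 0)"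
      by (rule filterlim_compose)
    thus "(\<lambda>h. norm (f (norm (0 + h)) - f (norm 0) - 0) / norm (h :: real^3)) \<midarrow>0\<rightarrow> 0"
      by (simp add: abs_divide)
  qed simp
  thus ?thesis using True by (simp add: gravity_def)
next
  case False
  hence s: "norm x \<in> {0<..<a}" using x by simp
  have n: "(norm has_derivative (\<lambda>h. (x \<bullet> h) / norm x)) (at x)"
    using has_derivative_norm [OF False] by (simp add: sgn_div_norm inner_commute divide_inverse mult.commute)
  have "((\<lambda>x. f (norm x)) has_derivative (\<lambda>h. (x \<bullet> h) / norm x * f' (norm x))) (at x)"
    by (rule DERIV_compose_FDERIV [OF f_der [OF s] n])
  moreover have "(\<lambda>h. (x \<bullet> h) / norm x * f' (norm x)) = (\<lambda>h. ((f (norm x) powr (2 - \<gamma>) / \<gamma>) *\<^sub>R gravity x) \<bullet> h)"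
    using False by (simp add: fun_eq_iff gravity_def f'_eq [OF s])
  ultimately show ?thesis by simp
qed

lemma liquid_density_eq: "x \<in> cball 0 R \<Longrightarrow> liquid_density R f x = f (norm x)"
  by (simp add: liquid_density_def liquid_profile_def)

lemma liquid_density_pos: "x \<in> cball 0 R \<Longrightarrow> 0 < liquid_density R f x"
  using radius by (auto simp: liquid_density_eq intro!: f_pos)

lemma liquid_density_has_derivative:
  assumes x: "x \<in> cball 0 R"
  shows "(liquid_density R f has_derivative (\<lambda>h. ((liquid_density R f x powr (2 - \<gamma>) / \<gamma>) *\<^sub>R gravity x) \<bullet> h)) (at x within cball 0 R)"
proof -
  have "norm x < a" using x radius by simp
  from has_derivative_at_withinI [OF f_norm_has_derivative [OF this]]
  have "((\<lambda>x. f (norm x)) has_derivative (\<lambda>h. ((liquid_density R f x powr (2 - \<gamma>) / \<gamma>) *\<^sub>R gravity x) \<bullet> h)) (at x within cball 0 R)"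
    using x by (simp add: liquid_density_eq)
  thus ?thesis
    by (rule has_derivative_transform_within [OF _ zero_less_one x]) (simp add: liquid_density_eq)
qed

text \<open>
  The profile extends past \<open>R\<close>, so the density on the closed ball is the restriction of a function that is
  differentiable in a neighbourhood.
\<close>

lemma liquid_density_C1: "C1_on (cball 0 R) (liquid_density R f)"
proof (rule C1_onI [OF liquid_density_has_derivative])
  have c: "continuous_on (cball 0 R) (liquid_density R f)"
    by (rule has_derivative_imp_continuous_on [OF liquid_density_has_derivative])
  show "continuous_on (cball 0 R) (\<lambda>x. ((liquid_density R f x powr (2 - \<gamma>) / \<gamma>) *\<^sub>R gravity x) \<bullet> h)" for h
    using radius gamma liquid_density_pos
    by (intro continuous_intros c continuous_on_subset [OF gravity_continuous]) (auto simp: less_imp_neq [THEN not_sym])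
qed

lemma liquid_slope_eq: "liquid_slope R f = - (R * mean_density R) / \<gamma>"
proof -
  have R: "R \<in> {0<..<a}" using radius by simp
  have "(f has_real_derivative f' R) (at R within {0..R})"
    by (rule has_field_derivative_at_within [OF f_der [OF R]])
  hence "(liquid_profile R f has_real_derivative f' R) (at R within {0..R})"
    by (rule has_field_derivative_transform_within [OF _ zero_less_one]) (use radius in \<open>auto simp: liquid_profile_def\<close>)
  hence "liquid_slope R f = f' R"
    unfolding liquid_slope_def has_real_derivative_iff_has_vector_derivative
    using radius by (intro vector_derivative_within_closed_interval) auto
  also have "\<dots> = - (R * mean_density R) / \<gamma>" using f'_eq [OF R] radius by simp
  finally show ?thesis .
qed

lemma liquid_slope_neq_0: "liquid_slope R f \<noteq> 0"
  using mass_pos [of R] radius gamma by (simp add: liquid_slope_eq mean_density_def)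

end



section \<open>The shell theorem\<close>

lemma set_integral_ball_rotate:
  fixes F :: "real^3 \<Rightarrow> real" and T :: "real^3 \<Rightarrow> real^3"
  assumes F: "set_integrable lborel (ball 0 R) F" and T: "orthogonal_transformation T"
  shows "set_integrable lborel (ball 0 R) (\<lambda>z. F (T z))" (is ?A)
    and "(LBINT z:ball 0 R. F z) = (LBINT z:ball 0 R. F (T z))" (is ?B)
proof -
  have lin: "linear T" using T by (rule orthogonal_transformation_linear)
  have im: "T ` ball 0 R = ball 0 R"
    using image_orthogonal_transformation_ball [OF T, of 0 R] linear_0 [OF lin] by simp
  have mF: "(\<lambda>z. indicator (ball 0 R) z *\<^sub>R F z) \<in> borel_measurable borel"
    using F by (simp add: set_integrable_def borel_measurable_integrable[simplified])
  have ai: "F absolutely_integrable_on ball 0 R"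
    using F mF unfolding set_integrable_def by (subst integrable_completion) auto
  have inj: "inj_on T (ball 0 R)" using orthogonal_transformation_inj [OF T] by (rule inj_on_subset) auto
  have der: "(T has_derivative T) (at x within ball 0 R)" for x
    using lin by (simp add: linear_conv_bounded_linear bounded_linear_imp_has_derivative)
  have key: "((\<lambda>x. F (T x)) absolutely_integrable_on ball 0 R \<and> integral (ball 0 R) (\<lambda>x. F (T x)) = b)
     \<longleftrightarrow> (F absolutely_integrable_on ball 0 R \<and> integral (ball 0 R) F = b)" for b
    using real_change_of_variables [of "ball 0 R" T "\<lambda>_. T" F b] der inj T by (simp add: im)
  have aiT: "(\<lambda>x. F (T x)) absolutely_integrable_on ball 0 R" and eq: "integral (ball 0 R) (\<lambda>x. F (T x)) = integral (ball 0 R) F"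
    using key ai by metis+
  have "T \<in> borel_measurable borel"
    using lin by (intro borel_measurable_continuous_onI) (simp add: linear_continuous_on linear_conv_bounded_linear)
  from measurable_compose [OF this mF]
  have "(\<lambda>z. indicator (ball 0 R) (T z) *\<^sub>R F (T z)) \<in> borel_measurable borel" .
  also have "(\<lambda>z. indicator (ball 0 R) (T z) *\<^sub>R F (T z)) = (\<lambda>z. indicator (ball 0 R) z *\<^sub>R F (T z))"
    using T by (auto simp: fun_eq_iff indicator_def orthogonal_transformation_norm)
  finally have mT: "(\<lambda>z. indicator (ball 0 R) z *\<^sub>R F (T z)) \<in> borel_measurable lborel" by simp
  show A: ?A using aiT unfolding set_integrable_def using integrable_completion [OF mT] by simp
  show ?B using set_borel_integral_eq_integral(2) [OF F] set_borel_integral_eq_integral(2) [OF A] eq by simp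
qed

text \<open>
  Up to the factor \<open>r\<^sup>2\<close> this is the potential at distance \<open>s\<close> from the centre of a sphere of radius \<open>r\<close>. The
  integrand is the derivative of \<open>sqrt(r\<^sup>2 + s\<^sup>2 - 2 r s cos p) / (r s)\<close>, with values \<open>r + s\<close> and \<open>|r - s|\<close> of the
  root at the two poles. For \<open>r = s\<close> the point lies on the sphere and the root vanishes at one pole; half-angle
  formulas remove the singularity.
\<close>

lemma shell_potential:
  fixes r s :: real
  assumes r: "0 < r" and s: "0 < s"
  defines "N \<equiv> \<lambda>p. sqrt (r\<^sup>2 + s\<^sup>2 - 2 * r * s * cos p)"
  shows "(LBINT (p,w):{0<..<pi} \<times> {0<..<2*pi}. sin p / N p) = 4 * pi / max r s"
proof -
  obtain k where k: "continuous_on {0..pi} k" "\<And>p. p \<in> {0<..<pi} \<Longrightarrow> sin p / N p = k p"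
    "(LBINT p:{0<..<pi}. k p) = 2 / max r s"
  proof (cases "r = s")
    case False
    have pos: "0 < r\<^sup>2 + s\<^sup>2 - 2 * r * s * cos p" for p
    proof -
      have "2 * r * s * cos p \<le> 2 * r * s * 1" using r s by (intro mult_left_mono) auto
      moreover have "r\<^sup>2 + s\<^sup>2 - 2 * r * s = (r - s)\<^sup>2" by (simp add: power2_diff)
      moreover have "0 < (r - s)\<^sup>2" using False by simp
      ultimately show ?thesis by linarith
    qed
    hence Npos: "0 < N p" for p by (simp add: N_def)
    have Nc: "continuous_on A N" for A unfolding N_def by (intro continuous_intros)
    have der: "((\<lambda>p. N p / (r * s)) has_real_derivative sin p / N p) (at p within A)" for p A
      unfolding N_def using pos [of p] r s
      by (auto intro!: derivative_eq_intros simp: field_simps)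
    have kc: "continuous_on {0..pi} (\<lambda>p. sin p / N p)"
      using Npos by (intro continuous_intros Nc) (auto simp: less_imp_neq [THEN not_sym])
    have "(LBINT p:{0<..<pi}. sin p / N p) = N pi / (r * s) - N 0 / (r * s)"
      by (intro set_integral_FTC der kc) auto
    also have "N pi = r + s"
    proof -
      have "r\<^sup>2 + s\<^sup>2 - 2 * r * s * cos pi = (r + s)\<^sup>2" by (simp add: power2_sum)
      thus ?thesis using r s unfolding N_def by simp
    qed
    also have "N 0 = \<bar>r - s\<bar>"
    proof -
      have "r\<^sup>2 + s\<^sup>2 - 2 * r * s * cos 0 = (r - s)\<^sup>2" by (simp add: power2_diff)
      thus ?thesis unfolding N_def by simp
    qed
    also have "(r + s) / (r * s) - \<bar>r - s\<bar> / (r * s) = 2 / max r s"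
      using r s by (auto simp: max_def abs_if field_simps)
    finally show ?thesis using kc by (intro that [of "\<lambda>p. sin p / N p"]) auto
  next
    case True
    have "(LBINT p:{0<..<pi}. cos (p / 2) / r) = 2 * sin (pi / 2) / r - 2 * sin (0 / 2) / r"
      using r by (intro set_integral_FTC continuous_intros) (auto intro!: derivative_eq_intros)
    moreover have "sin p / N p = cos (p / 2) / r" if "p \<in> {0<..<pi}" for p
    proof -
      have sp: "0 < sin (p / 2)" using that by (intro sin_gt_zero) auto
      have "r\<^sup>2 + s\<^sup>2 - 2 * r * s * cos p = (2 * r * sin (p / 2))\<^sup>2"
      proof -
        have c: "cos p = 1 - 2 * (sin (p / 2))\<^sup>2" using cos_double_sin [of "p / 2"] by simp
        show ?thesis unfolding True [symmetric] c by (simp add: algebra_simps power2_eq_square)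
      qed
      hence N: "N p = 2 * r * sin (p / 2)" using r sp unfolding N_def by simp
      have "sin p = 2 * sin (p / 2) * cos (p / 2)" using sin_double [of "p / 2"] by simp
      thus ?thesis using sp r by (simp add: N)
    qed
    ultimately show ?thesis using True r
      by (intro that [of "\<lambda>p. cos (p / 2) / r"]) (auto intro!: continuous_intros)
  qed
  have "continuous_on ({0..pi} \<times> {0..2*pi}) (\<lambda>x. k (fst x))"
    by (rule continuous_on_compose2 [OF k(1)]) (auto intro!: continuous_intros)
  hence "set_integrable lborel ({0..pi} \<times> {0..2*pi}) (\<lambda>x. k (fst x))"
    unfolding set_integrable_def by (intro borel_integrable_compact compact_Times) auto
  hence int: "set_integrable lborel ({0<..<pi} \<times> {0<..<2*pi}) (\<lambda>x. k (fst x))"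
    by (rule set_integrable_subset) (auto intro!: borel_open open_Times)
  have "(LBINT (p,w):{0<..<pi} \<times> {0<..<2*pi}. sin p / N p) = (LBINT x:{0<..<pi} \<times> {0<..<2*pi}. k (fst x))"
    unfolding set_lebesgue_integral_def
    by (intro Bochner_Integration.integral_cong refl) (auto simp: indicator_def k(2))
  also have "\<dots> = (LBINT w:{0<..<2*pi}. LBINT p:{0<..<pi}. k p)"
    using set_integral_iterate(2) [OF int] by simp
  also have "\<dots> = (LBINT w:{0<..<2*pi}. 2 / max r s)" by (simp only: k(3))
  also have "\<dots> = 4 * pi / max r s" by (simp add: set_lebesgue_integral_def)
  finally show ?thesis .
qed

text \<open>
  A rotation brings \<open>y\<close> to the polar axis, where the integral splits into spherical shells.
\<close>

lemma radial_potential: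
  fixes g :: "real \<Rightarrow> real" and y :: "real^3"
  assumes g: "continuous_on {0..R} g" and y: "y \<in> ball 0 R" "y \<noteq> 0"
  shows "(LBINT z:ball 0 R. g (norm z) / norm (y - z)) = integral {0..R} (\<lambda>r. 4 * pi * (r\<^sup>2 * g r) / max r (norm y))"
proof -
  define s where "s = norm y"
  have s: "0 < s" "s < R" using y by (auto simp: s_def)
  hence R: "0 < R" by simp
  define y0 :: "real^3" where "y0 = s *\<^sub>R axis 3 1"
  have "norm y0 = norm y" using s by (simp add: y0_def s_def)
  then obtain T where T: "orthogonal_transformation T" "T y0 = y" using orthogonal_transformation_exists by blast
  have int: "set_integrable lborel (ball 0 R) (\<lambda>z. g (norm z) / norm (x - z))" if x: "x \<in> ball 0 R" for x :: "real^3"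
  proof -
    have "bounded (g ` {0..R})" by (rule compact_imp_bounded [OF compact_continuous_image [OF g compact_Icc]])
    then obtain M where "\<forall>y\<in>g ` {0..R}. norm y \<le> M" unfolding bounded_iff by blast
    hence M: "\<And>r. r \<in> {0..R} \<Longrightarrow> \<bar>g r\<bar> \<le> M" by simp
    have gm: "(\<lambda>z. indicator (ball 0 R) z *\<^sub>R g (norm (z::real^3))) \<in> borel_measurable borel"
      by (intro borel_measurable_continuous_on_indicator continuous_on_compose2 [OF g] continuous_intros) auto
    have I1: "set_integrable lborel (ball 0 R) (\<lambda>z. norm (x - z) powr (-1))"
      by (rule Riesz_kernel_bound [of "-1" R]) (use x in auto)
    show ?thesis
      unfolding set_integrable_def
    proof (rule Bochner_Integration.integrable_bound)
      show "integrable lborel (\<lambda>z. M * (indicator (ball 0 R) z *\<^sub>R norm (x - z) powr (-1)))"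
        using I1 unfolding set_integrable_def by (rule integrable_mult_right)
      have "(\<lambda>z. (indicator (ball 0 R) z *\<^sub>R g (norm (z::real^3))) / norm (x - z)) \<in> borel_measurable lborel"
        using gm by measurable
      thus "(\<lambda>z. indicator (ball 0 R) z *\<^sub>R (g (norm z) / norm (x - z))) \<in> borel_measurable lborel" by simp
      show "AE z in lborel. norm (indicator (ball 0 R) z *\<^sub>R (g (norm z) / norm (x - z)))
          \<le> norm (M * (indicator (ball 0 R) z *\<^sub>R norm (x - z) powr (-1)))"
      proof (rule AE_I2)
        fix z :: "real^3"
        have "\<bar>g (norm z)\<bar> / norm (x - z) \<le> \<bar>M\<bar> * norm (x - z) powr (-1)" if "z \<in> ball 0 R"
          using M [of "norm z"] that by (cases "x = z") (auto simp: powr_minus_divide divide_right_mono)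
        thus "norm (indicator (ball 0 R) z *\<^sub>R (g (norm z) / norm (x - z)))
          \<le> norm (M * (indicator (ball 0 R) z *\<^sub>R norm (x - z) powr (-1)))"
          by (auto simp: indicator_def abs_mult)
      qed
    qed
  qed
  have "(LBINT z:ball 0 R. g (norm z) / norm (y - z)) = (LBINT z:ball 0 R. g (norm (T z)) / norm (y - T z))"
    by (rule set_integral_ball_rotate(2) [OF int [OF y(1)] T(1)])
  also have "\<dots> = (LBINT z:ball 0 R. g (norm z) / norm (y0 - z))"
  proof -
    have "norm (y - T z) = norm (y0 - z)" for z
      using T orthogonal_transformation_norm [OF T(1), of "y0 - z"] linear_diff [OF orthogonal_transformation_linear [OF T(1)]] by metis
    thus ?thesis using T(1) by (simp add: orthogonal_transformation_norm)
  qed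
  finally have rot: "(LBINT z:ball 0 R. g (norm z) / norm (y - z)) = (LBINT z:ball 0 R. g (norm z) / norm (y0 - z))" .
  have y0: "y0 \<in> ball 0 R" using s by (simp add: y0_def)
  have dist: "norm (y0 - sphere_point r p w) = sqrt (r\<^sup>2 + s\<^sup>2 - 2 * r * s * cos p)" for r p w
  proof -
    have "(norm (y0 - sphere_point r p w))\<^sup>2 = (norm y0)\<^sup>2 + (norm (sphere_point r p w))\<^sup>2 - 2 * (y0 \<bullet> sphere_point r p w)"
      by (simp add: power2_norm_eq_inner inner_diff algebra_simps inner_commute)
    also have "y0 \<bullet> sphere_point r p w = r * s * cos p"
      by (simp add: y0_def sphere_point_eq inner_vec_def sum_3 axis_def)
    also have "(norm y0)\<^sup>2 = s\<^sup>2" by (simp add: y0_def)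
    also have "(norm (sphere_point r p w))\<^sup>2 = r\<^sup>2" by (simp add: norm_sphere_point)
    finally have "(norm (y0 - sphere_point r p w))\<^sup>2 = r\<^sup>2 + s\<^sup>2 - 2 * r * s * cos p" by simp
    thus ?thesis by (rule real_sqrt_unique [symmetric]) simp
  qed
  let ?Q = "{0<..<R} \<times> {0<..<pi} \<times> {0<..<2*pi}"
  let ?F = "\<lambda>(r,p,w). g (norm (sphere_point r p w)) / norm (y0 - sphere_point r p w) * (r\<^sup>2 * sin p)"
  have bm: "set_borel_measurable borel (ball 0 R) (\<lambda>z. g (norm z) / norm (y0 - z))"
    using int [OF y0] by (auto simp: set_integrable_def set_borel_measurable_def dest: borel_measurable_integrable)
  have FQ: "set_integrable lborel ?Q ?F" using ball_integral_spherical(1) [OF bm] int [OF y0] by simp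
  have "(LBINT z:ball 0 R. g (norm z) / norm (y0 - z)) = (LBINT x:?Q. ?F x)" by (rule ball_integral_spherical(2) [OF bm])
  also have "\<dots> = (LBINT r:{0<..<R}. LBINT x:{0<..<pi} \<times> {0<..<2*pi}. ?F (r, x))"
    by (rule set_integral_iterate(1) [OF FQ])
  also have "\<dots> = (LBINT r:{0<..<R}. 4 * pi * (r\<^sup>2 * g r) / max r s)"
  proof (rule set_lebesgue_integral_cong)
    show "\<forall>r. r \<in> {0<..<R} \<longrightarrow> (LBINT x:{0<..<pi} \<times> {0<..<2*pi}. ?F (r, x)) = 4 * pi * (r\<^sup>2 * g r) / max r s"
    proof (intro allI impI)
      fix r assume r: "r \<in> {0<..<R}"
      have "(LBINT x:{0<..<pi} \<times> {0<..<2*pi}. ?F (r, x)) =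
          (LBINT x:{0<..<pi} \<times> {0<..<2*pi}. (g r * r\<^sup>2) * (\<lambda>(p,w). sin p / sqrt (r\<^sup>2 + s\<^sup>2 - 2 * r * s * cos p)) x)"
        using r by (simp add: case_prod_beta norm_sphere_point dist mult_ac)
      also have "\<dots> = (g r * r\<^sup>2) * (4 * pi / max r s)"
        using r s by (simp only: set_integral_mult_right) (subst shell_potential, auto)
      finally show "(LBINT x:{0<..<pi} \<times> {0<..<2*pi}. ?F (r, x)) = 4 * pi * (r\<^sup>2 * g r) / max r s" by simp
    qed
  qed simp
  also have "\<dots> = integral {0<..<R} (\<lambda>r. 4 * pi * (r\<^sup>2 * g r) / max r s)"
  proof (rule set_borel_integral_eq_integral(2))
    have "set_integrable lborel {0..R} (\<lambda>r. 4 * pi * (r\<^sup>2 * g r) / max r s)"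
      unfolding set_integrable_def using s
      by (intro borel_integrable_compact continuous_intros g) auto
    thus "set_integrable lborel {0<..<R} (\<lambda>r. 4 * pi * (r\<^sup>2 * g r) / max r s)"
      by (rule set_integrable_subset) auto
  qed
  also have "\<dots> = integral {0..R} (\<lambda>r. 4 * pi * (r\<^sup>2 * g r) / max r s)"
    using integral_open_interval [of 0 R] by (simp add: box_real)
  finally show ?thesis unfolding rot s_def .
qed

context liquid_star
begin

lemma Kpot_density:
  assumes y: "y \<in> ball 0 R" "y \<noteq> 0"
  shows "Kpot R (liquid_density R f) y
    = - (mass (norm y) / norm y + 4 * pi * (integral {0..R} (\<lambda>r. r * f r) - integral {0..norm y} (\<lambda>r. r * f r)))"
proof -
  define s where "s = norm y"
  have s: "0 < s" "s < R" using y by (auto simp: s_def)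
  have fc: "continuous_on {c..d} f" if "0 \<le> c" "d < a" for c d
    using that by (intro continuous_on_subset [OF f_cont]) auto
  have i1: "(\<lambda>r. r\<^sup>2 * f r) integrable_on {0..s}" "(\<lambda>r. r * f r) integrable_on {s..R}" "(\<lambda>r. r * f r) integrable_on {0..R}"
    using s radius by (auto intro!: integrable_continuous_real continuous_intros fc)
  have "Kpot R (liquid_density R f) y = - (LBINT z:ball 0 R. f (norm z) / norm (y - z))"
    unfolding Kpot_def set_lebesgue_integral_def
    by (intro arg_cong [of _ _ uminus] Bochner_Integration.integral_cong refl) (auto simp: liquid_density_eq indicator_def)
  also have "(LBINT z:ball 0 R. f (norm z) / norm (y - z)) = integral {0..R} (\<lambda>r. 4 * pi * (r\<^sup>2 * f r) / max r s)"
    unfolding s_def using radius by (intro radial_potential y fc) auto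
  also have "\<dots> = integral {0..s} (\<lambda>r. 4 * pi * (r\<^sup>2 * f r) / max r s) + integral {s..R} (\<lambda>r. 4 * pi * (r\<^sup>2 * f r) / max r s)"
    using s radius
    by (intro Henstock_Kurzweil_Integration.integral_combine [symmetric] integrable_continuous_real continuous_intros fc) auto
  also have "integral {0..s} (\<lambda>r. 4 * pi * (r\<^sup>2 * f r) / max r s) = integral {0..s} (\<lambda>r. (4 * pi / s) * (r\<^sup>2 * f r))"
    by (rule Henstock_Kurzweil_Integration.integral_cong) (use s in \<open>auto simp: max_def\<close>)
  also have "\<dots> = mass s / s" by (simp only: integral_mult_right) (simp add: mass_def)
  also have "integral {s..R} (\<lambda>r. 4 * pi * (r\<^sup>2 * f r) / max r s) = integral {s..R} (\<lambda>r. (4 * pi) * (r * f r))"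
    by (rule Henstock_Kurzweil_Integration.integral_cong) (use s in \<open>auto simp: max_def power2_eq_square\<close>)
  also have "\<dots> = 4 * pi * integral {s..R} (\<lambda>r. r * f r)" by (rule integral_mult_right)
  also have "integral {s..R} (\<lambda>r. r * f r) = integral {0..R} (\<lambda>r. r * f r) - integral {0..s} (\<lambda>r. r * f r)"
    using Henstock_Kurzweil_Integration.integral_combine [of 0 s R "\<lambda>r. r * f r"] i1(3) s by simp
  finally show ?thesis by (simp add: s_def)
qed

lemma Kpot_density_has_derivative:
  assumes y: "y \<in> ball 0 R" "y \<noteq> 0"
  shows "(Kpot R (liquid_density R f) has_derivative (\<lambda>h. - gravity y \<bullet> h)) (at y)"
proof -
  define k where "k s = - (mass s / s + 4 * pi * (integral {0..R} (\<lambda>r. r * f r) - integral {0..s} (\<lambda>r. r * f r)))" for s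
  define s where "s = norm y"
  have s: "0 < s" "s < R" "s \<in> {0<..<a}" using y radius by (auto simp: s_def)
  have "((\<lambda>x. integral {0..x} (\<lambda>r. r * f r)) has_real_derivative s * f s) (at s within {0..R})"
    using s radius by (intro integral_has_real_derivative continuous_intros continuous_on_subset [OF f_cont]) auto
  hence "((\<lambda>x. integral {0..x} (\<lambda>r. r * f r)) has_real_derivative s * f s) (at s within {0<..<R})"
    by (rule DERIV_subset) auto
  hence i: "((\<lambda>x. integral {0..x} (\<lambda>r. r * f r)) has_real_derivative s * f s) (at s)"
    using at_within_open [of s "{0<..<R}"] s by simp
  have "(k has_real_derivative mass s / s\<^sup>2) (at s)"
  proof -
    have sn: "s \<noteq> 0" using s by simp
    have "(k has_real_derivative
        - ((4 * pi * s\<^sup>2 * f s * s - mass s * 1) / (s * s) + 4 * pi * (0 - s * f s))) (at s)"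
      unfolding k_def [abs_def]
      by (intro DERIV_minus DERIV_add DERIV_cmult DERIV_diff DERIV_const i DERIV_divide mass_der s(3) DERIV_ident sn)
    moreover have "- ((4 * pi * s\<^sup>2 * f s * s - mass s * 1) / (s * s) + 4 * pi * (0 - s * f s)) = mass s / s\<^sup>2"
      using sn by (simp add: diff_divide_distrib power2_eq_square)
    ultimately show ?thesis by simp
  qed
  moreover have n: "(norm has_derivative (\<lambda>h. (y \<bullet> h) / norm y)) (at y)"
    using has_derivative_norm [OF y(2)] by (simp add: sgn_div_norm inner_commute divide_inverse mult.commute)
  ultimately have "((\<lambda>x. k (norm x)) has_derivative (\<lambda>h. (y \<bullet> h) / norm y * (mass s / s\<^sup>2))) (at y)"
    unfolding s_def by (rule DERIV_compose_FDERIV)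
  moreover have "(\<lambda>h. (y \<bullet> h) / norm y * (mass s / s\<^sup>2)) = (\<lambda>h. - gravity y \<bullet> h)"
    using s by (simp add: fun_eq_iff gravity_def mean_density_def s_def power2_eq_square power3_eq_cube mult_ac)
  ultimately have "((\<lambda>x. k (norm x)) has_derivative (\<lambda>h. - gravity y \<bullet> h)) (at y)" by simp
  moreover have "open (ball 0 R - {0::real^3})" by auto
  ultimately show ?thesis
    by (rule has_derivative_transform_within_open [of _ _ _ _ "ball 0 R - {0}"]) (use y Kpot_density in \<open>auto simp: k_def\<close>)
qed

text \<open>
  This determines the force at the centre, which the formula for \<open>y \<noteq> 0\<close> does not reach.
\<close>

lemma Kpot_density_even: "y \<in> ball 0 R \<Longrightarrow> Kpot R (liquid_density R f) (- y) = Kpot R (liquid_density R f) y"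
  by (cases "y = 0") (auto simp: Kpot_density)

end



section \<open>Differentiating potentials\<close>

lemma has_derivative_zeroI:
  fixes G :: "'a::real_normed_vector \<Rightarrow> 'b::real_normed_vector"
  assumes "\<And>y. y \<in> S \<Longrightarrow> norm (G y - G x) \<le> C * norm (y - x) powr (3/2)"
  shows "(G has_derivative (\<lambda>h. 0)) (at x within S)"
  unfolding has_derivative_within
proof
  have "((\<lambda>y. C * norm (y - x) powr (1/2)) \<longlongrightarrow> C * 0 powr (1/2)) (at x within S)"
    by (intro tendsto_intros tendsto_powr' tendsto_norm_zero) (auto intro!: tendsto_eq_intros always_eventually)
  hence lim: "((\<lambda>y. C * norm (y - x) powr (1/2)) \<longlongrightarrow> 0) (at x within S)" by simp
  have "eventually (\<lambda>y. y \<in> S \<and> y \<noteq> x) (at x within S)" by (simp add: eventually_at_filter)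
  hence "eventually (\<lambda>y. norm ((1 / norm (y - x)) *\<^sub>R (G y - (G x + 0))) \<le> C * norm (y - x) powr (1/2)) (at x within S)"
  proof eventually_elim
    fix y assume y: "y \<in> S \<and> y \<noteq> x"
    hence n: "0 < norm (y - x)" by simp
    have "norm ((1 / norm (y - x)) *\<^sub>R (G y - (G x + 0))) = norm (G y - G x) / norm (y - x)" by simp
    also have "\<dots> \<le> (C * norm (y - x) powr (3/2)) / norm (y - x)"
      using assms [of y] y by (intro divide_right_mono) auto
    also have "norm (y - x) powr (3/2) = norm (y - x) powr (1/2) * norm (y - x)"
      using powr_product [OF n, of "1/2" 1] by simp
    finally show "norm ((1 / norm (y - x)) *\<^sub>R (G y - (G x + 0))) \<le> C * norm (y - x) powr (1/2)"
      using n by simp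
  qed
  thus "((\<lambda>y. (1 / norm (y - x)) *\<^sub>R (G y - (G x + 0))) \<longlongrightarrow> 0) (at x within S)"
    by (rule Lim_null_comparison [OF _ lim])
qed simp

lemma has_vector_derivative_quadraticI:
  fixes F :: "real \<Rightarrow> 'b::real_normed_vector"
  assumes r: "0 < r" and b: "\<And>\<epsilon>. \<bar>\<epsilon>\<bar> < r \<Longrightarrow> norm (F \<epsilon> - F 0 - \<epsilon> *\<^sub>R D) \<le> K * \<epsilon>\<^sup>2"
  shows "(F has_vector_derivative D) (at 0)"
  unfolding has_vector_derivative_def has_derivative_at
proof
  show "bounded_linear (\<lambda>x. x *\<^sub>R D)" by (rule bounded_linear_scaleR_left)
  have lim: "(\<lambda>h. K * \<bar>h\<bar>) \<midarrow>0\<rightarrow> (0::real)" by (auto intro!: tendsto_eq_intros)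
  have "eventually (\<lambda>h. h \<noteq> 0 \<and> \<bar>h\<bar> < r) (at (0::real))"
    using r by (auto simp: eventually_at intro!: exI [of _ r])
  hence "eventually (\<lambda>h. norm (norm (F (0 + h) - F 0 - h *\<^sub>R D) / norm h) \<le> K * \<bar>h\<bar>) (at 0)"
  proof eventually_elim
    fix h :: real assume h: "h \<noteq> 0 \<and> \<bar>h\<bar> < r"
    hence "norm (F (0 + h) - F 0 - h *\<^sub>R D) / \<bar>h\<bar> \<le> (K * h\<^sup>2) / \<bar>h\<bar>"
      using b [of h] by (intro divide_right_mono) auto
    also have "\<dots> = K * \<bar>h\<bar>" using h by (simp add: power2_eq_square abs_if)
    finally show "norm (norm (F (0 + h) - F 0 - h *\<^sub>R D) / norm h) \<le> K * \<bar>h\<bar>" by simp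
  qed
  thus "(\<lambda>h. norm (F (0 + h) - F 0 - h *\<^sub>R D) / norm h) \<midarrow>0\<rightarrow> 0"
    by (rule Lim_null_comparison [OF _ lim])
qed

lemma set_integrable_Riesz:
  fixes k :: "real^3 \<Rightarrow> 'b::euclidean_space"
  assumes k: "continuous_on (ball 0 R - X) k" "finite X" and x: "x \<in> cball 0 R" and s: "-3 < s" "s < 0"
    and b: "\<And>z. z \<in> ball 0 R \<Longrightarrow> z \<notin> X \<Longrightarrow> norm (k z) \<le> c * norm (x - z) powr s"
  shows "set_integrable lborel (ball 0 R) k"
proof -
  have I: "set_integrable lborel (ball 0 R) (\<lambda>z. norm (x - z) powr s)"
    by (rule Riesz_kernel_bound [of s R]) (use x s in auto)
  have ne: "AE z in lborel. z \<notin> X"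
    using k(2) by (intro AE_not_in finite_imp_null_set_lborel)
  show ?thesis unfolding set_integrable_def
  proof (rule Bochner_Integration.integrable_bound)
    show "integrable lborel (\<lambda>z. c * (indicator (ball 0 R) z *\<^sub>R norm (x - z) powr s))"
      using I unfolding set_integrable_def by (rule integrable_mult_right)
    show "(\<lambda>z. indicator (ball 0 R) z *\<^sub>R k z) \<in> borel_measurable lborel"
      by (rule borel_measurable_off_finite [OF k(2,1)])
    show "AE z in lborel. norm (indicator (ball 0 R) z *\<^sub>R k z) \<le> norm (c * (indicator (ball 0 R) z *\<^sub>R norm (x - z) powr s))"
      using ne
    proof eventually_elim
      fix z assume "z \<notin> X"
      thus "norm (indicator (ball 0 R) z *\<^sub>R k z) \<le> norm (c * (indicator (ball 0 R) z *\<^sub>R norm (x - z) powr s))"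
        using b [of z] by (auto simp: indicator_def intro: order_trans [OF _ abs_ge_self])
    qed
  qed
qed

lemma norm_set_integral_Riesz_le:
  fixes k :: "real^3 \<Rightarrow> 'b::euclidean_space"
  assumes int: "set_integrable lborel (ball 0 R) k" and X: "finite X" and xy: "x \<in> cball 0 R" "y \<in> cball 0 R"
    and s: "-3 < s" "s < 0" and c: "0 \<le> c"
    and C: "\<And>x::real^3. x \<in> cball 0 R \<Longrightarrow> (LBINT z:ball 0 R. norm (x - z) powr s) \<le> C"
    and b: "\<And>z. z \<in> ball 0 R \<Longrightarrow> z \<notin> X \<Longrightarrow> norm (k z) \<le> c * (norm (x - z) powr s + norm (y - z) powr s)"
  shows "norm (LBINT z:ball 0 R. k z) \<le> c * (2 * C)"
proof -
  have I: "set_integrable lborel (ball 0 R) (\<lambda>z. norm (x - z) powr s)" if "x \<in> cball 0 R" for x :: "real^3"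
    by (rule Riesz_kernel_bound [of s R]) (use that s in auto)
  have ne: "AE z in lborel. z \<notin> X"
    using X by (intro AE_not_in finite_imp_null_set_lborel)
  have I2: "set_integrable lborel (ball 0 R) (\<lambda>z. c * (norm (x - z) powr s + norm (y - z) powr s))"
    by (intro set_integrable_mult_right set_integral_add(1) I xy)
  have "norm (LBINT z:ball 0 R. k z) \<le> (LBINT z:ball 0 R. norm (k z))"
    by (rule set_integral_norm_bound [OF int])
  also have "\<dots> \<le> (LBINT z:ball 0 R. c * (norm (x - z) powr s + norm (y - z) powr s))"
    using set_integrable_norm [OF int] I2 by (rule set_integral_mono_AE) (use ne b in auto)
  also have "\<dots> = c * ((LBINT z:ball 0 R. norm (x - z) powr s) + (LBINT z:ball 0 R. norm (y - z) powr s))"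
    by (simp only: set_integral_mult_right set_integral_add(2) [OF I [OF xy(1)] I [OF xy(2)]])
  also have "\<dots> \<le> c * (2 * C)"
    using C [OF xy(1)] C [OF xy(2)] c by (intro mult_left_mono) auto
  finally show ?thesis .
qed

lemma set_integral_inner:
  fixes k :: "'a \<Rightarrow> 'b::euclidean_space"
  assumes "set_integrable M A k"
  shows "set_integrable M A (\<lambda>z. k z \<bullet> c)" "(LINT z:A|M. k z \<bullet> c) = (LINT z:A|M. k z) \<bullet> c"
proof -
  have i: "integrable M (\<lambda>z. indicator A z *\<^sub>R k z)" using assms by (simp add: set_integrable_def)
  have e: "indicator A z *\<^sub>R (k z \<bullet> c) = (indicator A z *\<^sub>R k z) \<bullet> c" for z
    by (simp only: inner_scaleR_left real_scaleR_def)
  show "set_integrable M A (\<lambda>z. k z \<bullet> c)"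
    unfolding set_integrable_def e by (rule integrable_inner_left) (rule i)
  show "(LINT z:A|M. k z \<bullet> c) = (LINT z:A|M. k z) \<bullet> c"
    unfolding set_lebesgue_integral_def e by (rule integral_inner_left) (rule i)
qed

lemma continuous_on_newton_force:
  assumes "continuous_on A g" "\<And>z. z \<in> A \<Longrightarrow> g z \<noteq> 0"
  shows "continuous_on A (\<lambda>z. newton_force (g z))"
  unfolding newton_force_def using assms by (intro continuous_intros) auto

lemma continuous_on_tidal:
  assumes "continuous_on A g" "continuous_on A k" "\<And>z. z \<in> A \<Longrightarrow> g z \<noteq> 0"
  shows "continuous_on A (\<lambda>z. tidal (g z) (k z))"
  unfolding tidal_def using assms by (intro continuous_intros) auto

text \<open>
  The gravitational force at the displaced point \<open>\<eta> x\<close>, as an integral over the undisplaced star.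
\<close>

definition pulled_force :: "real \<Rightarrow> (real^3 \<Rightarrow> real) \<Rightarrow> (real^3 \<Rightarrow> real^3) \<Rightarrow> real^3 \<Rightarrow> real^3" where
  "pulled_force R \<rho> \<eta> x = (LBINT z:ball 0 R. \<rho> z *\<^sub>R newton_force (\<eta> x - \<eta> z))"

lemma inverse_power_le_of_half:
  fixes a b :: real
  assumes "0 < a" "a / 2 \<le> b" "s < 0"
  shows "b powr s \<le> 2 powr (- s) * a powr s"
proof -
  have "b powr s \<le> (a / 2) powr s" using assms by (intro powr_mono2') auto
  also have "\<dots> = 2 powr (- s) * a powr s" using assms by (simp add: powr_divide powr_minus_divide)
  finally show ?thesis .
qed

lemma pulled_force_integrable:
  fixes \<eta> :: "real^3 \<Rightarrow> real^3" and x :: "real^3"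
  assumes R: "0 < R" and \<rho>: "continuous_on (cball 0 R) \<rho>" and \<eta>: "continuous_on (cball 0 R) \<eta>"
    and lower: "\<And>y z. y \<in> cball 0 R \<Longrightarrow> z \<in> cball 0 R \<Longrightarrow> norm (y - z) / 2 \<le> norm (\<eta> y - \<eta> z)"
    and x: "x \<in> cball 0 R"
  shows "set_integrable lborel (ball 0 R) (\<lambda>z. \<rho> z *\<^sub>R newton_force (\<eta> x - \<eta> z))"
    and "set_integrable lborel (ball 0 R) (\<lambda>z. \<rho> z / norm (\<eta> x - \<eta> z))"
proof -
  obtain M where M: "0 \<le> M" "\<And>z. z \<in> cball 0 R \<Longrightarrow> norm (\<rho> z) \<le> M" using bounded_on_cball [OF \<rho>] by blast
  have ne: "\<eta> x - \<eta> z \<noteq> 0" if "z \<in> ball 0 R - {x}" for z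
    using lower [OF x, of z] that by auto
  have c: "continuous_on (ball 0 R - {x}) \<rho>" "continuous_on (ball 0 R - {x}) \<eta>"
    by (auto intro: continuous_on_subset [OF \<rho>] continuous_on_subset [OF \<eta>])
  have half: "norm (\<eta> x - \<eta> z) powr s \<le> 2 powr (- s) * norm (x - z) powr s" if "z \<in> ball 0 R" "z \<noteq> x" "s < 0" for z s
    using lower [OF x, of z] that by (intro inverse_power_le_of_half) auto
  show "set_integrable lborel (ball 0 R) (\<lambda>z. \<rho> z *\<^sub>R newton_force (\<eta> x - \<eta> z))"
  proof (rule set_integrable_Riesz [where X = "{x}" and x = x and s = "-2" and c = "M * 2 powr 2"])
    show "continuous_on (ball 0 R - {x}) (\<lambda>z. \<rho> z *\<^sub>R newton_force (\<eta> x - \<eta> z))"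
      by (intro continuous_intros continuous_on_newton_force c ne)
    fix z assume z: "z \<in> ball 0 R" "z \<notin> {x}"
    have "norm (\<rho> z *\<^sub>R newton_force (\<eta> x - \<eta> z)) = norm (\<rho> z) * norm (\<eta> x - \<eta> z) powr (-2)"
      by (simp add: norm_newton_force powr_minus_divide)
    also have "\<dots> \<le> M * (2 powr (-(-2)) * norm (x - z) powr (-2))"
      using M(2) [of z] M(1) half [of z "-2"] z by (intro mult_mono) auto
    finally show "norm (\<rho> z *\<^sub>R newton_force (\<eta> x - \<eta> z)) \<le> M * 2 powr 2 * norm (x - z) powr (-2)" by simp
  qed (use x in auto)
  show "set_integrable lborel (ball 0 R) (\<lambda>z. \<rho> z / norm (\<eta> x - \<eta> z))"
  proof (rule set_integrable_Riesz [where X = "{x}" and x = x and s = "-1" and c = "M * 2 powr 1"])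
    show "continuous_on (ball 0 R - {x}) (\<lambda>z. \<rho> z / norm (\<eta> x - \<eta> z))"
      using ne by (intro continuous_intros c) auto
    fix z assume z: "z \<in> ball 0 R" "z \<notin> {x}"
    have "norm (\<rho> z / norm (\<eta> x - \<eta> z)) = norm (\<rho> z) * norm (\<eta> x - \<eta> z) powr (-1)"
      by (simp add: powr_minus_divide)
    also have "\<dots> \<le> M * (2 powr (-(-1)) * norm (x - z) powr (-1))"
      using M(2) [of z] M(1) half [of z "-1"] z by (intro mult_mono) auto
    finally show "norm (\<rho> z / norm (\<eta> x - \<eta> z)) \<le> M * 2 powr 1 * norm (x - z) powr (-1)" by simp
  qed (use x in auto)
qed

text \<open>
  Both the evaluation point and the sources move with \<open>\<eta>\<close>, so the singularity stays at \<open>z = x\<close>. As \<open>\<eta>\<close> distorts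
  distances by at most a factor \<open>2\<close>, the remainder estimate for the kernel at \<open>\<eta> x - \<eta> z\<close> is still
  integrable in \<open>z\<close>.
\<close>

lemma lagr_potential_has_derivative:
  fixes \<eta> :: "real^3 \<Rightarrow> real^3" and x :: "real^3"
  assumes R: "0 < R" and \<rho>: "continuous_on (cball 0 R) \<rho>"
    and lower: "\<And>y z. y \<in> cball 0 R \<Longrightarrow> z \<in> cball 0 R \<Longrightarrow> norm (y - z) / 2 \<le> norm (\<eta> y - \<eta> z)"
    and upper: "\<And>y z. y \<in> cball 0 R \<Longrightarrow> z \<in> cball 0 R \<Longrightarrow> norm (\<eta> y - \<eta> z) \<le> 2 * norm (y - z)"
    and x: "x \<in> cball 0 R" and \<eta>': "(\<eta> has_derivative \<eta>') (at x within cball 0 R)"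
  shows "(lagr_potential R \<rho> \<eta> has_derivative (\<lambda>h. pulled_force R \<rho> \<eta> x \<bullet> \<eta>' h)) (at x within cball 0 R)"
proof -
  obtain M where M: "0 \<le> M" "\<And>z. z \<in> cball 0 R \<Longrightarrow> norm (\<rho> z) \<le> M" using bounded_on_cball [OF \<rho>] by blast
  have \<eta>: "continuous_on (cball 0 R) \<eta>"
    unfolding continuous_on_iff
  proof (intro ballI allI impI)
    fix y e assume "y \<in> cball (0::real^3) R" "0 < (e::real)"
    thus "\<exists>d>0. \<forall>z\<in>cball 0 R. dist z y < d \<longrightarrow> dist (\<eta> z) (\<eta> y) < e"
      by (intro exI [of _ "e / 2"]) (auto simp: dist_norm intro!: le_less_trans [OF upper])
  qed
  obtain C where C: "0 \<le> C" "\<And>x::real^3. x \<in> cball 0 R \<Longrightarrow> (LBINT z:ball 0 R. norm (x - z) powr (-5/2)) \<le> C"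
    by (rule Riesz_kernel_bound [of "-5/2" R]) auto
  define E where "E = pulled_force R \<rho> \<eta> x"
  let ?V = "lagr_potential R \<rho> \<eta>"
  define K where "K = M * 15 * 2 powr (3/2) * 2 powr (5/2) * (2 * C)"
  \<comment> \<open>What remains after the linear part is removed is of order \<open>3/2\<close> in \<open>y - x\<close>.\<close>
  have est: "norm ((?V y - E \<bullet> \<eta> y) - (?V x - E \<bullet> \<eta> x)) \<le> K * norm (y - x) powr (3/2)" if y: "y \<in> cball 0 R" for y
  proof -
    define k where "k = \<eta> y - \<eta> x"
    define w where "w z = \<eta> x - \<eta> z" for z
    have wk: "w z + k = \<eta> y - \<eta> z" for z by (simp add: w_def k_def)
    have kn: "norm k \<le> 2 * norm (y - x)" unfolding k_def by (rule upper [OF y x])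
    have I: "set_integrable lborel (ball 0 R) (\<lambda>z. \<rho> z *\<^sub>R newton_force (\<eta> x - \<eta> z))"
        "set_integrable lborel (ball 0 R) (\<lambda>z. \<rho> z / norm (\<eta> x - \<eta> z))" if "x \<in> cball 0 R" for x
      using pulled_force_integrable [OF R \<rho> \<eta> _ that] lower by auto
    have If: "set_integrable lborel (ball 0 R) (\<lambda>z. (\<rho> z *\<^sub>R newton_force (w z)) \<bullet> k)"
      using set_integral_inner(1) [OF I(1) [OF x]] by (simp add: w_def)
    define D where "D z = \<rho> z * (1 / norm (w z + k) - 1 / norm (w z) + newton_force (w z) \<bullet> k)" for z
    have D_eq: "D = (\<lambda>z. \<rho> z / norm (\<eta> y - \<eta> z) - \<rho> z / norm (\<eta> x - \<eta> z) + (\<rho> z *\<^sub>R newton_force (w z)) \<bullet> k)"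
      unfolding D_def wk fun_eq_iff by (simp add: w_def distrib_left right_diff_distrib)
    have D_int: "set_integrable lborel (ball 0 R) D"
      unfolding D_eq by (intro set_integral_add(1) set_integral_diff(1) I(2) If x y)
    have "(LBINT z:ball 0 R. D z) = (LBINT z:ball 0 R. \<rho> z / norm (\<eta> y - \<eta> z)) - (LBINT z:ball 0 R. \<rho> z / norm (\<eta> x - \<eta> z))
        + (LBINT z:ball 0 R. (\<rho> z *\<^sub>R newton_force (w z)) \<bullet> k)"
      unfolding D_eq
      by (simp only: set_integral_add(2) [OF set_integral_diff(1) [OF I(2) [OF y] I(2) [OF x]] If]
          set_integral_diff(2) [OF I(2) [OF y] I(2) [OF x]])
    also have "(LBINT z:ball 0 R. (\<rho> z *\<^sub>R newton_force (w z)) \<bullet> k) = E \<bullet> k"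
      using set_integral_inner(2) [OF I(1) [OF x]] by (simp add: w_def E_def pulled_force_def)
    finally have V: "(?V y - E \<bullet> \<eta> y) - (?V x - E \<bullet> \<eta> x) = - (LBINT z:ball 0 R. D z)"
      by (simp add: lagr_potential_def k_def inner_diff_right)
    have "norm (LBINT z:ball 0 R. D z) \<le> (M * 15 * norm k powr (3/2) * 2 powr (5/2)) * (2 * C)"
    proof (rule norm_set_integral_Riesz_le [OF D_int, where X = "{x, y}" and x = x and y = y and s = "-5/2"])
      fix z assume z: "z \<in> ball 0 R" "z \<notin> {x, y}"
      have nz: "w z \<noteq> 0" "w z + k \<noteq> 0"
        using lower [OF x, of z] lower [OF y, of z] z unfolding wk by (auto simp: w_def)
      have h: "norm (w z) powr (-5/2) \<le> 2 powr (5/2) * norm (x - z) powr (-5/2)"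
          "norm (w z + k) powr (-5/2) \<le> 2 powr (5/2) * norm (y - z) powr (-5/2)"
        using inverse_power_le_of_half [of "norm (x - z)" "norm (w z)" "-5/2"] lower [OF x, of z]
          inverse_power_le_of_half [of "norm (y - z)" "norm (w z + k)" "-5/2"] lower [OF y, of z] z
        unfolding wk by (auto simp: w_def)
      have "norm (D z) \<le> M * (15 * norm k powr (3/2) * (norm (w z) powr (-5/2) + norm (w z + k) powr (-5/2)))"
        unfolding D_def norm_mult using M(1) M(2) [of z] z inverse_norm_first_order [OF nz] by (intro mult_mono) auto
      also have "\<dots> \<le> M * (15 * norm k powr (3/2) * (2 powr (5/2) * norm (x - z) powr (-5/2) + 2 powr (5/2) * norm (y - z) powr (-5/2)))"
        using M(1) h by (intro mult_left_mono add_mono) auto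
      also have "\<dots> = M * 15 * norm k powr (3/2) * 2 powr (5/2) * (norm (x - z) powr (-5/2) + norm (y - z) powr (-5/2))"
        by (simp add: distrib_left mult_ac)
      finally show "norm (D z) \<le> M * 15 * norm k powr (3/2) * 2 powr (5/2) * (norm (x - z) powr (-5/2) + norm (y - z) powr (-5/2))" .
    qed (use x y M(1) C in auto)
    also have "\<dots> \<le> (M * 15 * (2 * norm (y - x)) powr (3/2) * 2 powr (5/2)) * (2 * C)"
      using M(1) C(1) kn by (intro mult_right_mono mult_left_mono powr_mono2) auto
    also have "\<dots> = K * norm (y - x) powr (3/2)"
      by (simp add: K_def powr_mult mult_ac)
    finally show ?thesis unfolding V by simp
  qed
  have "((\<lambda>y. ?V y - E \<bullet> \<eta> y) has_derivative (\<lambda>h. 0)) (at x within cball 0 R)"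
    by (rule has_derivative_zeroI [OF est])
  from has_derivative_add [OF this has_derivative_inner_right [OF \<eta>', of E]]
  show ?thesis by (simp add: E_def)
qed


lemma tidal_symmetric: "tidal w h \<bullet> k = tidal w k \<bullet> h"
  unfolding tidal_def inner_diff_left inner_scaleR_left by (simp add: inner_commute mult_ac)

text \<open>
  Against the Lipschitz factor \<open>\<theta> x - \<theta> z\<close> the singularity of order \<open>3\<close> drops to order \<open>2\<close>.
\<close>

lemma tidal_cancelled_singularity:
  assumes R: "0 < R" and \<rho>: "continuous_on (cball 0 R) \<rho>" and \<theta>: "continuous_on (cball 0 R) \<theta>"
    and lip: "\<And>y z. y \<in> cball 0 R \<Longrightarrow> z \<in> cball 0 R \<Longrightarrow> norm (\<theta> y - \<theta> z) \<le> L * norm (y - z)"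
    and x: "x \<in> cball 0 R" and L: "0 \<le> L"
  shows "set_integrable lborel (ball 0 R) (\<lambda>z. \<rho> z *\<^sub>R tidal (x - z) (\<theta> x - \<theta> z))"
proof -
  obtain M where M: "0 \<le> M" "\<And>z. z \<in> cball 0 R \<Longrightarrow> norm (\<rho> z) \<le> M" using bounded_on_cball [OF \<rho>] by blast
  show ?thesis
  proof (rule set_integrable_Riesz [where X = "{x}" and x = x and s = "-2" and c = "M * (4 * L)"])
    show "continuous_on (ball 0 R - {x}) (\<lambda>z. \<rho> z *\<^sub>R tidal (x - z) (\<theta> x - \<theta> z))"
      by (intro continuous_intros continuous_on_tidal continuous_on_subset [OF \<rho>] continuous_on_subset [OF \<theta>]) auto
    fix z assume z: "z \<in> ball 0 R" "z \<notin> {x}"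
    hence n: "0 < norm (x - z)" by auto
    have "norm (tidal (x - z) (\<theta> x - \<theta> z)) \<le> 4 * (L * norm (x - z)) / norm (x - z) ^ 3"
      using lip [OF x, of z] z by (intro order_trans [OF norm_tidal_le] divide_right_mono) auto
    also have "\<dots> = 4 * L * norm (x - z) powr (-2)"
      using n by (simp add: powr_minus_divide power2_eq_square power3_eq_cube)
    finally show "norm (\<rho> z *\<^sub>R tidal (x - z) (\<theta> x - \<theta> z)) \<le> M * (4 * L) * norm (x - z) powr (-2)"
      unfolding norm_scaleR using M(1) M(2) [of z] z by (simp only: mult.assoc) (intro mult_mono, auto)
  qed (use x in auto)
qed

lemma force_work_integrable:
  assumes \<rho>: "continuous_on (cball 0 R) \<rho>" and k: "continuous_on (cball 0 R) k" and y: "y \<in> cball 0 R"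
  shows "set_integrable lborel (ball 0 R) (\<lambda>z. \<rho> z * (newton_force (y - z) \<bullet> k z))"
proof -
  obtain M where M: "0 \<le> M" "\<And>z. z \<in> cball 0 R \<Longrightarrow> norm (\<rho> z) \<le> M" using bounded_on_cball [OF \<rho>] by blast
  obtain B where B: "0 \<le> B" "\<And>z. z \<in> cball 0 R \<Longrightarrow> norm (k z) \<le> B" using bounded_on_cball [OF k] by blast
  show ?thesis
  proof (rule set_integrable_Riesz [where X = "{y}" and x = y and s = "-2" and c = "M * B"])
    show "continuous_on (ball 0 R - {y}) (\<lambda>z. \<rho> z * (newton_force (y - z) \<bullet> k z))"
      by (intro continuous_intros continuous_on_newton_force continuous_on_subset [OF \<rho>] continuous_on_subset [OF k]) auto
    fix z assume z: "z \<in> ball 0 R" "z \<notin> {y}"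
    have "\<bar>newton_force (y - z) \<bullet> k z\<bar> \<le> norm (newton_force (y - z)) * norm (k z)"
      by (rule Cauchy_Schwarz_ineq2)
    also have "\<dots> \<le> norm (y - z) powr (-2) * B"
      unfolding norm_newton_force using B(2) [of z] z
      by (intro mult_mono) (auto simp: powr_minus_divide)
    finally have "norm (\<rho> z) * \<bar>newton_force (y - z) \<bullet> k z\<bar> \<le> M * (norm (y - z) powr (-2) * B)"
      using M(1) M(2) [of z] z by (intro mult_mono) auto
    thus "norm (\<rho> z * (newton_force (y - z) \<bullet> k z)) \<le> M * B * norm (y - z) powr (-2)"
      by (simp add: abs_mult mult_ac)
  qed (use y in auto)
qed

text \<open>
  The point \<open>x\<close> in \<open>\<theta> x\<close> is fixed while \<open>y\<close> varies. Therefore the weight is small of first order where the kernel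
  \<open>newton_force (y - z)\<close> with \<open>y\<close> near \<open>x\<close> is singular, and differentiation under the integral is legitimate at
  \<open>y = x\<close>. The derivative is the same integral as in \<open>pulled_force_perturbation_derivative\<close>, by the symmetry of
  the second derivative of the kernel.
\<close>

lemma force_against_displacement_has_derivative:
  assumes R: "0 < R" and \<rho>: "continuous_on (cball 0 R) \<rho>" and \<theta>: "continuous_on (cball 0 R) \<theta>"
    and lip: "\<And>y z. y \<in> cball 0 R \<Longrightarrow> z \<in> cball 0 R \<Longrightarrow> norm (\<theta> y - \<theta> z) \<le> L * norm (y - z)"
    and x: "x \<in> cball 0 R" and L: "0 \<le> L"
  shows "((\<lambda>y. LBINT z:ball 0 R. \<rho> z * (newton_force (y - z) \<bullet> (\<theta> x - \<theta> z))) has_derivative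
     (\<lambda>h. (LBINT z:ball 0 R. \<rho> z *\<^sub>R tidal (x - z) (\<theta> x - \<theta> z)) \<bullet> h)) (at x within cball 0 R)"
proof -
  obtain M where M: "0 \<le> M" "\<And>z. z \<in> cball 0 R \<Longrightarrow> norm (\<rho> z) \<le> M" using bounded_on_cball [OF \<rho>] by blast
  obtain C where C: "0 \<le> C" "\<And>x::real^3. x \<in> cball 0 R \<Longrightarrow> (LBINT z:ball 0 R. norm (x - z) powr (-5/2)) \<le> C"
    by (rule Riesz_kernel_bound [of "-5/2" R]) auto
  let ?Q = "\<lambda>y. LBINT z:ball 0 R. \<rho> z * (newton_force (y - z) \<bullet> (\<theta> x - \<theta> z))"
  define Q' where "Q' = (LBINT z:ball 0 R. \<rho> z *\<^sub>R tidal (x - z) (\<theta> x - \<theta> z))"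
  note I' = tidal_cancelled_singularity [OF R \<rho> \<theta> lip x L]
  have I: "set_integrable lborel (ball 0 R) (\<lambda>z. \<rho> z * (newton_force (y - z) \<bullet> (\<theta> x - \<theta> z)))" if y: "y \<in> cball 0 R" for y
    by (intro force_work_integrable continuous_intros \<rho> \<theta> y)
  define K where "K = M * L * 1000 * (2 * C)"
  have est: "norm ((?Q y - Q' \<bullet> y) - (?Q x - Q' \<bullet> x)) \<le> K * norm (y - x) powr (3/2)" if y: "y \<in> cball 0 R" for y
  proof -
    define k where "k = y - x"
    have If: "set_integrable lborel (ball 0 R) (\<lambda>z. (\<rho> z *\<^sub>R tidal (x - z) (\<theta> x - \<theta> z)) \<bullet> k)"
      by (rule set_integral_inner(1)) (rule I')
    define D where "D z = \<rho> z * ((newton_force ((x - z) + k) - newton_force (x - z) - tidal (x - z) k) \<bullet> (\<theta> x - \<theta> z))" for z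
    have D_eq: "D = (\<lambda>z. \<rho> z * (newton_force (y - z) \<bullet> (\<theta> x - \<theta> z)) - \<rho> z * (newton_force (x - z) \<bullet> (\<theta> x - \<theta> z))
        - (\<rho> z *\<^sub>R tidal (x - z) (\<theta> x - \<theta> z)) \<bullet> k)"
      unfolding fun_eq_iff D_def inner_diff_left
      by (auto simp: k_def right_diff_distrib tidal_symmetric [of _ "y - x"])
    have D_int: "set_integrable lborel (ball 0 R) D"
      unfolding D_eq by (intro set_integral_diff(1) I If x y)
    have "(LBINT z:ball 0 R. D z) = ?Q y - ?Q x - (LBINT z:ball 0 R. (\<rho> z *\<^sub>R tidal (x - z) (\<theta> x - \<theta> z)) \<bullet> k)"
      unfolding D_eq
      by (simp only: set_integral_diff(2) [OF set_integral_diff(1) [OF I [OF y] I [OF x]] If]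
          set_integral_diff(2) [OF I [OF y] I [OF x]])
    also have "(LBINT z:ball 0 R. (\<rho> z *\<^sub>R tidal (x - z) (\<theta> x - \<theta> z)) \<bullet> k) = Q' \<bullet> k"
      unfolding Q'_def by (rule set_integral_inner(2)) (rule I')
    finally have V: "(?Q y - Q' \<bullet> y) - (?Q x - Q' \<bullet> x) = (LBINT z:ball 0 R. D z)"
      by (simp add: k_def inner_diff_right)
    have "norm (LBINT z:ball 0 R. D z) \<le> (M * L * 1000 * norm k powr (3/2)) * (2 * C)"
    proof (rule norm_set_integral_Riesz_le [OF D_int, where X = "{x, y}" and x = x and y = y and s = "-5/2"])
      fix z assume z: "z \<in> ball 0 R" "z \<notin> {x, y}"
      have nz: "x - z \<noteq> 0" "(x - z) + k \<noteq> 0" using z by (auto simp: k_def)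
      let ?n = "norm (newton_force ((x - z) + k) - newton_force (x - z) - tidal (x - z) k)"
      have "\<bar>(newton_force ((x - z) + k) - newton_force (x - z) - tidal (x - z) k) \<bullet> (\<theta> x - \<theta> z)\<bar> \<le> ?n * norm (\<theta> x - \<theta> z)"
        by (rule Cauchy_Schwarz_ineq2)
      also have "\<dots> \<le> ?n * (L * norm (x - z))"
        using lip [OF x, of z] z by (intro mult_left_mono) auto
      also have "\<dots> = L * (norm (x - z) * ?n)" by simp
      also have "\<dots> \<le> L * (1000 * norm k powr (3/2) * (norm (x - z) powr (-5/2) + norm ((x - z) + k) powr (-5/2)))"
        using newton_force_first_order [OF nz] L by (intro mult_left_mono)
      finally have "norm (D z) \<le> M * (L * (1000 * norm k powr (3/2) * (norm (x - z) powr (-5/2) + norm ((x - z) + k) powr (-5/2))))"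
        unfolding D_def norm_mult using M(1) M(2) [of z] z by (intro mult_mono) auto
      thus "norm (D z) \<le> M * L * 1000 * norm k powr (3/2) * (norm (x - z) powr (-5/2) + norm (y - z) powr (-5/2))"
        by (simp add: k_def mult_ac)
    qed (use x y M(1) C L in auto)
    also have "\<dots> = K * norm (y - x) powr (3/2)"
      by (simp add: K_def k_def mult_ac)
    finally show ?thesis unfolding V .
  qed
  have "((\<lambda>y. ?Q y - Q' \<bullet> y) has_derivative (\<lambda>h. 0)) (at x within cball 0 R)"
    by (rule has_derivative_zeroI [OF est])
  from has_derivative_add [OF this has_derivative_inner_right [OF has_derivative_ident, of Q']]
  show ?thesis by (simp add: Q'_def)
qed

text \<open>
  The kernel is evaluated at \<open>w + \<epsilon>\<delta>\<close> with \<open>w = x - z\<close> and \<open>|\<delta>| \<le> L |w|\<close>. For small \<open>\<epsilon>\<close> the increment is at most \<open>|w| / 2\<close>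
  for all \<open>z\<close> at once, so the second-order remainder is at most a multiple of \<open>\<epsilon>\<^sup>2 / |w|\<^sup>2\<close>, which is integrable.
\<close>

lemma pulled_force_perturbation_derivative:
  assumes R: "0 < R" and \<rho>: "continuous_on (cball 0 R) \<rho>" and \<theta>: "continuous_on (cball 0 R) \<theta>"
    and lip: "\<And>y z. y \<in> cball 0 R \<Longrightarrow> z \<in> cball 0 R \<Longrightarrow> norm (\<theta> y - \<theta> z) \<le> L * norm (y - z)"
    and x: "x \<in> cball 0 R" and L: "0 < L"
  shows "((\<lambda>\<epsilon>. pulled_force R \<rho> (flow_map (\<lambda>y. \<epsilon> *\<^sub>R \<theta> y)) x) has_vector_derivative
     (LBINT z:ball 0 R. \<rho> z *\<^sub>R tidal (x - z) (\<theta> x - \<theta> z))) (at 0)"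
proof -
  obtain M where M: "0 \<le> M" "\<And>z. z \<in> cball 0 R \<Longrightarrow> norm (\<rho> z) \<le> M" using bounded_on_cball [OF \<rho>] by blast
  obtain C where C: "0 \<le> C" "\<And>x::real^3. x \<in> cball 0 R \<Longrightarrow> (LBINT z:ball 0 R. norm (x - z) powr (-2)) \<le> C"
    by (rule Riesz_kernel_bound [of "-2" R]) auto
  define F where "F \<epsilon> = pulled_force R \<rho> (flow_map (\<lambda>y. \<epsilon> *\<^sub>R \<theta> y)) x" for \<epsilon>
  define F' where "F' = (LBINT z:ball 0 R. \<rho> z *\<^sub>R tidal (x - z) (\<theta> x - \<theta> z))"
  define w where "w z = x - z" for z
  define \<delta> where "\<delta> z = \<theta> x - \<theta> z" for z
  have F_eq: "F \<epsilon> = (LBINT z:ball 0 R. \<rho> z *\<^sub>R newton_force (w z + \<epsilon> *\<^sub>R \<delta> z))" for \<epsilon>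
    by (simp add: F_def pulled_force_def flow_map_def w_def \<delta>_def algebra_simps)
  have tidal_scale: "tidal w (\<epsilon> *\<^sub>R h) = \<epsilon> *\<^sub>R tidal w h" for w h \<epsilon>
    by (simp add: tidal_def scaleR_right_diff_distrib mult_ac)
  have I': "set_integrable lborel (ball 0 R) (\<lambda>z. \<rho> z *\<^sub>R tidal (w z) (\<delta> z))"
    unfolding w_def \<delta>_def by (rule tidal_cancelled_singularity [OF R \<rho> \<theta> lip x]) (use L in auto)
  have est: "norm (F \<epsilon> - F 0 - \<epsilon> *\<^sub>R F') \<le> (M * (200 * L\<^sup>2)) * (2 * C) * \<epsilon>\<^sup>2" if \<epsilon>: "\<bar>\<epsilon>\<bar> * L \<le> 1 / 2" for \<epsilon>
  proof -
    have small: "norm (\<epsilon> *\<^sub>R \<delta> z) \<le> \<bar>\<epsilon>\<bar> * L * norm (w z)" if "z \<in> ball 0 R" for z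
      using mult_left_mono [OF lip [OF x, of z], of "\<bar>\<epsilon>\<bar>"] that by (simp add: \<delta>_def w_def mult.assoc)
    have half: "norm (\<epsilon> *\<^sub>R \<delta> z) \<le> norm (w z) / 2" if "z \<in> ball 0 R" for z
      using order_trans [OF small [OF that] mult_right_mono [OF \<epsilon>, of "norm (w z)"]] by simp
    have lower: "norm (w z) / 2 \<le> norm (w z + \<epsilon> *\<^sub>R \<delta> z)" if "z \<in> ball 0 R" for z
      using norm_diff_ineq [of "w z" "\<epsilon> *\<^sub>R \<delta> z"] half [OF that] by linarith
    have J: "set_integrable lborel (ball 0 R) (\<lambda>z. \<rho> z *\<^sub>R newton_force (w z + e *\<^sub>R \<delta> z))" if e: "e = 0 \<or> e = \<epsilon>" for e
    proof (rule set_integrable_Riesz [where X = "{x}" and x = x and s = "-2" and c = "M * 4"])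
      have low: "norm (w z) / 2 \<le> norm (w z + e *\<^sub>R \<delta> z)" if "z \<in> ball 0 R" for z
        using lower [OF that] e by auto
      show "continuous_on (ball 0 R - {x}) (\<lambda>z. \<rho> z *\<^sub>R newton_force (w z + e *\<^sub>R \<delta> z))"
      proof (intro continuous_intros continuous_on_newton_force)
        show "continuous_on (ball 0 R - {x}) \<rho>" by (rule continuous_on_subset [OF \<rho>]) auto
        show "continuous_on (ball 0 R - {x}) w" unfolding w_def by (intro continuous_intros)
        show "continuous_on (ball 0 R - {x}) \<delta>" unfolding \<delta>_def by (intro continuous_intros continuous_on_subset [OF \<theta>]) auto
        show "w z + e *\<^sub>R \<delta> z \<noteq> 0" if "z \<in> ball 0 R - {x}" for z
          using low [of z] that by (auto simp: w_def)
      qed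
      fix z assume z: "z \<in> ball 0 R" "z \<notin> {x}"
      have wz: "0 < norm (w z)" using z by (auto simp: w_def)
      have "norm (w z + e *\<^sub>R \<delta> z) powr (-2) \<le> 2 powr (-(-2)) * norm (w z) powr (-2)"
        by (rule inverse_power_le_of_half) (use wz low [OF z(1)] in auto)
      hence "norm (newton_force (w z + e *\<^sub>R \<delta> z)) \<le> 4 * norm (w z) powr (-2)"
        by (simp add: norm_newton_force powr_minus_divide)
      thus "norm (\<rho> z *\<^sub>R newton_force (w z + e *\<^sub>R \<delta> z)) \<le> M * 4 * norm (x - z) powr (-2)"
        unfolding norm_scaleR mult.assoc w_def using M(1) M(2) [of z] z by (intro mult_mono) auto
    qed (use x in auto)
    define D where "D z = \<rho> z *\<^sub>R (newton_force (w z + \<epsilon> *\<^sub>R \<delta> z) - newton_force (w z) - tidal (w z) (\<epsilon> *\<^sub>R \<delta> z))" for z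
    have J0: "set_integrable lborel (ball 0 R) (\<lambda>z. \<rho> z *\<^sub>R newton_force (w z))" using J [of 0] by simp
    have D_eq: "D = (\<lambda>z. \<rho> z *\<^sub>R newton_force (w z + \<epsilon> *\<^sub>R \<delta> z) - \<rho> z *\<^sub>R newton_force (w z) - \<epsilon> *\<^sub>R (\<rho> z *\<^sub>R tidal (w z) (\<delta> z)))"
      by (simp add: D_def fun_eq_iff tidal_scale scaleR_right_diff_distrib)
    have J\<epsilon>: "set_integrable lborel (ball 0 R) (\<lambda>z. \<rho> z *\<^sub>R newton_force (w z + \<epsilon> *\<^sub>R \<delta> z))" using J [of \<epsilon>] by simp
    have I\<epsilon>: "set_integrable lborel (ball 0 R) (\<lambda>z. \<epsilon> *\<^sub>R (\<rho> z *\<^sub>R tidal (w z) (\<delta> z)))"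
      using I' by (rule set_integrable_scaleR_right)
    have D_int: "set_integrable lborel (ball 0 R) D"
      unfolding D_eq by (intro set_integral_diff(1) J\<epsilon> J0 I\<epsilon>)
    have "(LBINT z:ball 0 R. D z) = F \<epsilon> - F 0 - \<epsilon> *\<^sub>R F'"
      unfolding D_eq set_integral_diff(2) [OF set_integral_diff(1) [OF J\<epsilon> J0] I\<epsilon>] set_integral_diff(2) [OF J\<epsilon> J0] set_integral_scaleR_right
      by (simp add: F_eq F'_def w_def \<delta>_def)
    moreover have "norm (LBINT z:ball 0 R. D z) \<le> (M * (200 * L\<^sup>2) * \<epsilon>\<^sup>2) * (2 * C)"
    proof (rule norm_set_integral_Riesz_le [OF D_int, where X = "{x}" and x = x and y = x and s = "-2"])
      fix z assume z: "z \<in> ball 0 R" "z \<notin> {x}"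
      have wz: "0 < norm (w z)" using z by (auto simp: w_def)
      have "norm (newton_force (w z + \<epsilon> *\<^sub>R \<delta> z) - newton_force (w z) - tidal (w z) (\<epsilon> *\<^sub>R \<delta> z))
          \<le> 200 * (norm (\<epsilon> *\<^sub>R \<delta> z))\<^sup>2 / norm (w z) ^ 4"
        using newton_force_remainder [OF _ half [OF z(1)]] wz by auto
      also have "\<dots> \<le> 200 * (\<bar>\<epsilon>\<bar> * L * norm (w z))\<^sup>2 / norm (w z) ^ 4"
        by (intro divide_right_mono mult_left_mono power_mono small z) auto
      also have "\<dots> = 200 * L\<^sup>2 * \<epsilon>\<^sup>2 * norm (w z) powr (-2)"
        using wz by (simp add: powr_minus_divide power_mult_distrib eval_nat_numeral)
      finally have "norm (D z) \<le> M * (200 * L\<^sup>2 * \<epsilon>\<^sup>2 * norm (w z) powr (-2))"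
        unfolding D_def norm_scaleR using M(1) M(2) [of z] z by (intro mult_mono) auto
      also have "\<dots> \<le> M * (200 * L\<^sup>2) * \<epsilon>\<^sup>2 * (norm (x - z) powr (-2) + norm (x - z) powr (-2))"
        using M(1) by (simp add: w_def mult_ac)
      finally show "norm (D z) \<le> M * (200 * L\<^sup>2) * \<epsilon>\<^sup>2 * (norm (x - z) powr (-2) + norm (x - z) powr (-2))" .
    qed (use x M(1) C in auto)
    ultimately show ?thesis by (simp add: mult_ac)
  qed
  have "(F has_vector_derivative F') (at 0)"
  proof (rule has_vector_derivative_quadraticI)
    show "0 < 1 / (2 * L)" using L by simp
    fix \<epsilon> assume "\<bar>\<epsilon>\<bar> < 1 / (2 * L)"
    thus "norm (F \<epsilon> - F 0 - \<epsilon> *\<^sub>R F') \<le> (M * (200 * L\<^sup>2)) * (2 * C) * \<epsilon>\<^sup>2"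
      using L by (intro est) (simp add: field_simps)
  qed
  thus ?thesis by (simp add: F_def [abs_def] F'_def)
qed



section \<open>The Jacobian of the flow map and the pressure term\<close>

text \<open>
  The mean value theorem is applied to the increment in direction \<open>v\<close>, as a function of the position along \<open>u\<close>.
  The derivative of the increment is then expanded by differentiability of \<open>g'\<close> at \<open>x\<close>.
\<close>

lemma mixed_difference_quotient:
  fixes g :: "'a::real_normed_vector \<Rightarrow> real"
  assumes r: "0 < r" and g': "\<And>y. y \<in> ball x r \<Longrightarrow> (g has_derivative g' y) (at y)"
    and A: "((\<lambda>y. g' y u) has_derivative A) (at x)"
  shows "((\<lambda>t. (g (x + t *\<^sub>R u + t *\<^sub>R v) - g (x + t *\<^sub>R u) - g (x + t *\<^sub>R v) + g x) / t\<^sup>2) \<longlongrightarrow> A v) (at_right 0)"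
proof (rule tendstoI)
  fix e :: real assume e: "0 < e"
  interpret A: bounded_linear A using A by (rule has_derivative_bounded_linear)
  define n where "n = norm u + norm v + 1"
  have n: "0 < n" "norm u \<le> n" "norm v \<le> n" "norm u + norm v \<le> n" by (auto simp: n_def add_nonneg_pos)
  define e' where "e' = e / (4 * n)"
  have e': "0 < e'" using e n by (simp add: e'_def)
  obtain d where d: "0 < d" "\<And>y. norm (y - x) < d \<Longrightarrow> \<bar>g' y u - g' x u - A (y - x)\<bar> \<le> e' * norm (y - x)"
    using A e' unfolding has_derivative_at_alt by (auto simp: real_norm_def)
  define t0 where "t0 = min d r / n"
  have t0: "0 < t0" using d r n by (simp add: t0_def)
  have main: "\<bar>(g (x + t *\<^sub>R u + t *\<^sub>R v) - g (x + t *\<^sub>R u) - g (x + t *\<^sub>R v) + g x) / t\<^sup>2 - A v\<bar> < e"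
    if t: "0 < t" "t < t0" for t
  proof -
    have tn: "t * n < d" "t * n < r" using t n by (auto simp: t0_def field_simps min_less_iff_conj)
    have near: "norm (s *\<^sub>R u + c *\<^sub>R v) \<le> t * n" if "0 \<le> s" "s \<le> t" "0 \<le> c" "c \<le> t" for s c
    proof -
      have "norm (s *\<^sub>R u + c *\<^sub>R v) \<le> s * norm u + c * norm v"
        using that by (intro order_trans [OF norm_triangle_ineq]) auto
      also have "\<dots> \<le> t * norm u + t * norm v" using that by (intro add_mono mult_right_mono) auto
      also have "\<dots> = t * (norm u + norm v)" by (simp add: distrib_left)
      also have "\<dots> \<le> t * n" using n t by (intro mult_left_mono) auto
      finally show ?thesis .
    qed
    have inb: "x + s *\<^sub>R u + c *\<^sub>R v \<in> ball x r" if "0 \<le> s" "s \<le> t" "0 \<le> c" "c \<le> t" for s c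
      using near [OF that] tn norm_minus_cancel [of "s *\<^sub>R u + c *\<^sub>R v"] by (simp add: dist_norm algebra_simps)
    define \<phi> where "\<phi> s = g (x + s *\<^sub>R u + t *\<^sub>R v) - g (x + s *\<^sub>R u)" for s
    have path: "((\<lambda>s. g (x + s *\<^sub>R u + c *\<^sub>R v)) has_real_derivative g' (x + s *\<^sub>R u + c *\<^sub>R v) u) (at s)"
      if s: "0 \<le> s" "s \<le> t" "0 \<le> c" "c \<le> t" for s c
    proof -
      have "((\<lambda>s. x + s *\<^sub>R u + c *\<^sub>R v) has_vector_derivative u) (at s)"
        by (auto intro!: derivative_eq_intros simp: has_vector_derivative_def)
      from has_vector_derivative_along_path [OF g' [OF inb [OF s]] this, simplified]
      show ?thesis by (simp add: has_real_derivative_iff_has_vector_derivative)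
    qed
    have \<phi>: "(\<phi> has_real_derivative g' (x + s *\<^sub>R u + t *\<^sub>R v) u - g' (x + s *\<^sub>R u) u) (at s)" if "0 \<le> s" "s \<le> t" for s
      unfolding \<phi>_def [abs_def] using path [of s t] path [of s 0] that t by (intro DERIV_diff) auto
    have "\<exists>\<xi>. 0 < \<xi> \<and> \<xi> < t \<and> \<phi> t - \<phi> 0 = (t - 0) * (g' (x + \<xi> *\<^sub>R u + t *\<^sub>R v) u - g' (x + \<xi> *\<^sub>R u) u)"
      using t \<phi> by (intro MVT2) auto
    then obtain \<xi> where \<xi>: "0 < \<xi>" "\<xi> < t" "\<phi> t - \<phi> 0 = t * (g' (x + \<xi> *\<^sub>R u + t *\<^sub>R v) u - g' (x + \<xi> *\<^sub>R u) u)" by auto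
    have 1: "\<bar>g' (x + \<xi> *\<^sub>R u + t *\<^sub>R v) u - g' x u - A (\<xi> *\<^sub>R u + t *\<^sub>R v)\<bar> \<le> e' * (t * n)"
    proof -
      have "norm ((x + \<xi> *\<^sub>R u + t *\<^sub>R v) - x) \<le> t * n" using near [of \<xi> t] \<xi> t by (simp add: add.assoc)
      moreover from this tn have "norm ((x + \<xi> *\<^sub>R u + t *\<^sub>R v) - x) < d" by simp
      ultimately show ?thesis using d(2) [of "x + \<xi> *\<^sub>R u + t *\<^sub>R v"] mult_left_mono [of _ "t * n" e'] e'
        by (smt (verit) add.assoc add_diff_cancel_left')
    qed
    have 2: "\<bar>g' (x + \<xi> *\<^sub>R u) u - g' x u - A (\<xi> *\<^sub>R u)\<bar> \<le> e' * (t * n)"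
    proof -
      have "norm ((x + \<xi> *\<^sub>R u) - x) \<le> t * n" using near [of \<xi> 0] \<xi> t by simp
      moreover from this tn have "norm ((x + \<xi> *\<^sub>R u) - x) < d" by simp
      ultimately show ?thesis using d(2) [of "x + \<xi> *\<^sub>R u"] mult_left_mono [of _ "t * n" e'] e'
        by (smt (verit) add_diff_cancel_left')
    qed
    have "\<bar>(g' (x + \<xi> *\<^sub>R u + t *\<^sub>R v) u - g' (x + \<xi> *\<^sub>R u) u) - t * A v\<bar> \<le> 2 * e' * (t * n)"
      using 1 2 by (simp add: A.add A.scaleR)
    also have "2 * e' * (t * n) = t * (e / 2)" using n by (simp add: e'_def)
    finally have "\<bar>(g' (x + \<xi> *\<^sub>R u + t *\<^sub>R v) u - g' (x + \<xi> *\<^sub>R u) u) / t - A v\<bar> \<le> e / 2"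
      using t by (simp add: abs_le_iff field_simps)
    moreover have "(g (x + t *\<^sub>R u + t *\<^sub>R v) - g (x + t *\<^sub>R u) - g (x + t *\<^sub>R v) + g x) / t\<^sup>2
        = (g' (x + \<xi> *\<^sub>R u + t *\<^sub>R v) u - g' (x + \<xi> *\<^sub>R u) u) / t"
    proof -
      have "g (x + t *\<^sub>R u + t *\<^sub>R v) - g (x + t *\<^sub>R u) - g (x + t *\<^sub>R v) + g x = \<phi> t - \<phi> 0" by (simp add: \<phi>_def)
      thus ?thesis using \<xi>(3) t by (simp add: power2_eq_square)
    qed
    ultimately show ?thesis using e by simp
  qed
  have "\<forall>\<^sub>F t in at_right 0. t \<in> {0<..<t0}" using t0 by (rule eventually_at_right_real)
  thus "\<forall>\<^sub>F t in at_right 0. dist ((g (x + t *\<^sub>R u + t *\<^sub>R v) - g (x + t *\<^sub>R u) - g (x + t *\<^sub>R v) + g x) / t\<^sup>2) (A v) < e"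
    by eventually_elim (use main in \<open>auto simp: dist_real_def\<close>)
qed

text \<open>
  The difference quotient of \<open>mixed_difference_quotient\<close> is symmetric in \<open>u\<close> and \<open>v\<close>.
\<close>

lemma second_derivative_symmetric:
  fixes g :: "'a::real_normed_vector \<Rightarrow> real"
  assumes r: "0 < r" and g': "\<And>y. y \<in> ball x r \<Longrightarrow> (g has_derivative g' y) (at y)"
    and A: "((\<lambda>y. g' y u) has_derivative A) (at x)" and B: "((\<lambda>y. g' y v) has_derivative B) (at x)"
  shows "A v = B u"
proof (rule tendsto_unique [of "at_right (0::real)"])
  show "((\<lambda>t. (g (x + t *\<^sub>R u + t *\<^sub>R v) - g (x + t *\<^sub>R u) - g (x + t *\<^sub>R v) + g x) / t\<^sup>2) \<longlongrightarrow> A v) (at_right 0)"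
    by (rule mixed_difference_quotient [OF r g' A])
  have "((\<lambda>t. (g (x + t *\<^sub>R v + t *\<^sub>R u) - g (x + t *\<^sub>R v) - g (x + t *\<^sub>R u) + g x) / t\<^sup>2) \<longlongrightarrow> B u) (at_right 0)"
    by (rule mixed_difference_quotient [OF r g' B])
  thus "((\<lambda>t. (g (x + t *\<^sub>R u + t *\<^sub>R v) - g (x + t *\<^sub>R u) - g (x + t *\<^sub>R v) + g x) / t\<^sup>2) \<longlongrightarrow> B u) (at_right 0)"
    by (simp add: algebra_simps)
qed simp

text \<open>
  For a matrix with columns \<open>c 1\<close>, \<open>c 2\<close>, \<open>c 3\<close> these are the rows of the adjugate and, below, their derivative in the
  direction of the matrix with columns \<open>u 1\<close>, \<open>u 2\<close>, \<open>u 3\<close>, and likewise for the determinant. In this form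
  they are multilinear in the columns, so the product rule gives all derivatives.
\<close>

definition adj_row :: "(3 \<Rightarrow> real^3) \<Rightarrow> 3 \<Rightarrow> real^3" where
  "adj_row c k = (if k = 1 then cross3 (c 2) (c 3) else if k = 2 then cross3 (c 3) (c 1) else cross3 (c 1) (c 2))"

definition adj_row_deriv :: "(3 \<Rightarrow> real^3) \<Rightarrow> (3 \<Rightarrow> real^3) \<Rightarrow> 3 \<Rightarrow> real^3" where
  "adj_row_deriv c u k = (if k = 1 then cross3 (c 2) (u 3) + cross3 (u 2) (c 3)
     else if k = 2 then cross3 (c 3) (u 1) + cross3 (u 3) (c 1) else cross3 (c 1) (u 2) + cross3 (u 1) (c 2))"

definition col_det :: "(3 \<Rightarrow> real^3) \<Rightarrow> real" where
  "col_det c = c 1 \<bullet> adj_row c 1"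

definition col_det_deriv :: "(3 \<Rightarrow> real^3) \<Rightarrow> (3 \<Rightarrow> real^3) \<Rightarrow> real" where
  "col_det_deriv c u = c 1 \<bullet> adj_row_deriv c u 1 + u 1 \<bullet> adj_row c 1"

lemma bounded_bilinear_cross3: "bounded_bilinear cross3"
  using bilinear_cross by (simp add: bilinear_conv_bounded_bilinear)

lemma adj_row_inner: "adj_row c k \<bullet> c j = (if k = j then col_det c else 0)"
  using exhaust_3 [of k] exhaust_3 [of j]
  by (auto simp: adj_row_def col_det_def inner_vec_def sum_3 cross3_def algebra_simps)

lemma col_det: "det (\<chi> i j. c j $ i) = col_det c"
  by (simp add: det_3 col_det_def adj_row_def inner_vec_def sum_3 cross3_def algebra_simps)

lemma matrix_inv_cols:
  assumes "col_det c \<noteq> 0"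
  shows "matrix_inv (\<chi> i j. c j $ i) $ k = adj_row c k /\<^sub>R col_det c"
proof -
  define N B :: "real^3^3" where "N = (\<chi> i j. c j $ i)" and "B = (\<chi> k. adj_row c k /\<^sub>R col_det c)"
  have "B ** N = mat 1"
  proof -
    have "(B ** N) $ k $ j = (adj_row c k \<bullet> c j) / col_det c" for k j
      by (simp add: B_def N_def matrix_matrix_mult_def inner_vec_def sum_divide_distrib divide_inverse mult_ac sum_distrib_left)
    thus ?thesis using assms by (simp add: vec_eq_iff adj_row_inner mat_def)
  qed
  hence NB: "N ** B = mat 1" by (simp add: matrix_left_right_inverse)
  have inv: "invertible N" using NB \<open>B ** N = mat 1\<close> by (auto simp: invertible_def)
  have "N ** matrix_inv N = mat 1 \<and> matrix_inv N ** N = mat 1"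
    using inv unfolding invertible_def matrix_inv_def by (rule someI_ex)
  hence "matrix_inv N ** (N ** B) = B" by (simp add: matrix_mul_assoc)
  moreover have "matrix_inv N ** (N ** B) = matrix_inv N" by (simp add: NB)
  ultimately have "matrix_inv N = B" by simp
  thus ?thesis by (simp add: N_def B_def)
qed

lemma adj_row_has_vector_derivative:
  assumes "\<And>j. (c j has_vector_derivative u j) (at t within T)"
  shows "((\<lambda>t. adj_row (\<lambda>j. c j t) k) has_vector_derivative adj_row_deriv (\<lambda>j. c j t) u k) (at t within T)"
  unfolding adj_row_def adj_row_deriv_def
  by (auto intro!: bounded_bilinear.has_vector_derivative [OF bounded_bilinear_cross3] assms)

lemma adj_row_has_derivative:
  assumes "\<And>j. (c j has_derivative u j) (at t within T)"
  shows "((\<lambda>t. adj_row (\<lambda>j. c j t) k) has_derivative (\<lambda>h. adj_row_deriv (\<lambda>j. c j t) (\<lambda>j. u j h) k)) (at t within T)"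
  unfolding adj_row_def adj_row_deriv_def
  by (cases "k = 1"; cases "k = 2"; simp; intro bounded_bilinear.FDERIV [OF bounded_bilinear_cross3] assms)

lemma col_det_has_derivative:
  assumes "\<And>j. (c j has_derivative u j) (at t within T)"
  shows "((\<lambda>t. col_det (\<lambda>j. c j t)) has_derivative (\<lambda>h. col_det_deriv (\<lambda>j. c j t) (\<lambda>j. u j h))) (at t within T)"
  unfolding col_det_def col_det_deriv_def
  by (intro has_derivative_inner adj_row_has_derivative assms)

lemma adj_row_axis: "adj_row (\<lambda>j. axis j 1) k = axis k 1"
  using exhaust_3 [of k] by (auto simp: adj_row_def cross3_def vec_eq_iff forall_3 axis_def)

lemma col_det_axis: "col_det (\<lambda>j. axis j 1) = 1"
  unfolding col_det_def adj_row_axis by (simp add: inner_vec_def sum_3 axis_def)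

lemma col_det_deriv_axis: "col_det_deriv (\<lambda>j. axis j 1) u = (\<Sum>j\<in>UNIV. u j $ j)"
  by (simp add: col_det_deriv_def adj_row_deriv_def adj_row_def cross3_def inner_vec_def sum_3 axis_def)

text \<open>
  At the identity the adjugate \<open>J A\<close> has derivative \<open>(tr u) I - u\<close>.
\<close>

lemma adj_row_deriv_axis: "adj_row_deriv (\<lambda>j. axis j 1) u k = (\<Sum>j\<in>UNIV. u j $ j) *\<^sub>R axis k 1 - (\<chi> i. u i $ k)"
  using exhaust_3 [of k] by (auto simp: adj_row_deriv_def cross3_def vec_eq_iff forall_3 axis_def sum_3)

lemma adj_row_deriv_scale: "adj_row_deriv c (\<lambda>j. \<epsilon> *\<^sub>R u j) k = \<epsilon> *\<^sub>R adj_row_deriv c u k"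
  by (simp add: adj_row_deriv_def cross3_def vec_eq_iff forall_3 algebra_simps)

lemma col_det_deriv_scale: "col_det_deriv c (\<lambda>j. \<epsilon> *\<^sub>R u j) = \<epsilon> * col_det_deriv c u"
  by (simp add: col_det_deriv_def adj_row_deriv_scale algebra_simps)

lemma flow_map_columns:
  fixes \<epsilon> :: real
  assumes R: "0 < R" and x: "x \<in> cball 0 R" and \<theta>: "(\<theta> has_derivative D) (at x within cball 0 R)"
  defines "c \<equiv> \<lambda>j. axis j 1 + \<epsilon> *\<^sub>R D (axis j 1)"
  shows "grad_flow R (flow_map (\<lambda>y. \<epsilon> *\<^sub>R \<theta> y)) x = (\<chi> i j. c j $ i)"
    and "jac_det R (flow_map (\<lambda>y. \<epsilon> *\<^sub>R \<theta> y)) x = col_det c"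
    and "col_det c \<noteq> 0 \<Longrightarrow> inv_grad R (flow_map (\<lambda>y. \<epsilon> *\<^sub>R \<theta> y)) x $ k = adj_row c k /\<^sub>R col_det c"
proof -
  have "(flow_map (\<lambda>y. \<epsilon> *\<^sub>R \<theta> y) has_derivative (\<lambda>h. h + \<epsilon> *\<^sub>R D h)) (at x within cball 0 R)"
    unfolding flow_map_def [abs_def]
    by (intro has_derivative_add has_derivative_ident has_derivative_scaleR_right \<theta>)
  hence "frechet_derivative (flow_map (\<lambda>y. \<epsilon> *\<^sub>R \<theta> y)) (at x within cball 0 R) = (\<lambda>h. h + \<epsilon> *\<^sub>R D h)"
    by (rule frechet_derivative_cball [OF R x])
  thus g: "grad_flow R (flow_map (\<lambda>y. \<epsilon> *\<^sub>R \<theta> y)) x = (\<chi> i j. c j $ i)"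
    by (simp add: grad_flow_def jacobian_def matrix_def c_def)
  show "jac_det R (flow_map (\<lambda>y. \<epsilon> *\<^sub>R \<theta> y)) x = col_det c"
    by (simp add: jac_det_def g col_det)
  show "inv_grad R (flow_map (\<lambda>y. \<epsilon> *\<^sub>R \<theta> y)) x $ k = adj_row c k /\<^sub>R col_det c" if "col_det c \<noteq> 0"
    using matrix_inv_cols [OF that] by (simp add: inv_grad_def g)
qed

lemma jac_det_perturbation_derivative:
  assumes R: "0 < R" and x: "x \<in> cball 0 R" and \<theta>: "(\<theta> has_derivative D) (at x within cball 0 R)"
  shows "((\<lambda>\<epsilon>. jac_det R (flow_map (\<lambda>y. \<epsilon> *\<^sub>R \<theta> y)) x) has_real_derivative div_on (cball 0 R) \<theta> x) (at 0)"
proof -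
  have "((\<lambda>\<epsilon>. axis j 1 + \<epsilon> *\<^sub>R D (axis j 1)) has_derivative (\<lambda>h. h *\<^sub>R D (axis j 1))) (at 0)" for j
    by (auto intro!: derivative_eq_intros)
  from col_det_has_derivative [of "\<lambda>j \<epsilon>. axis j 1 + \<epsilon> *\<^sub>R D (axis j 1)" "\<lambda>j h. h *\<^sub>R D (axis j 1)" 0 UNIV, OF this]
  have "((\<lambda>\<epsilon>. col_det (\<lambda>j. axis j 1 + \<epsilon> *\<^sub>R D (axis j 1))) has_derivative (\<lambda>h. h * div_on (cball 0 R) \<theta> x)) (at 0)"
    by (simp add: col_det_deriv_scale col_det_deriv_axis div_on_eq [OF R x \<theta>])
  thus ?thesis
    by (simp add: flow_map_columns(2) [OF R x \<theta>] has_field_derivative_def mult_commute_abs)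
qed


text \<open>
  Here \<open>J\<^bsup>1-\<gamma>\<^esup> A\<^sup>k = J\<^bsup>-\<gamma>\<^esup> a\<^sub>k\<close> with \<open>a\<^sub>k\<close> the adjugate row. Every derivative of the columns in \<open>x\<close> carries a factor \<open>\<epsilon>\<close>,
  which is why the second summand is \<open>\<epsilon>\<close> times a continuous function of \<open>\<epsilon>\<close>.
\<close>

lemma pressure_term_eq:
  fixes \<epsilon> :: real
  assumes R: "0 < R" and x: "x \<in> cball 0 R"
    and \<theta>: "\<And>y. y \<in> cball 0 R \<Longrightarrow> (\<theta> has_derivative D y) (at y within cball 0 R)"
    and D: "\<And>j. ((\<lambda>y. D y (axis j 1)) has_derivative U j) (at x within cball 0 R)"
    and r: "((\<lambda>y. \<rho> y powr \<gamma>) has_derivative r') (at x within cball 0 R)"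
  defines "c \<equiv> \<lambda>y j. axis j 1 + \<epsilon> *\<^sub>R D y (axis j 1)"
  assumes J: "0 < col_det (c x)"
  shows "pressure_term \<gamma> R \<rho> (flow_map (\<lambda>y. \<epsilon> *\<^sub>R \<theta> y)) x = inverse (\<rho> x) *\<^sub>R (\<Sum>k\<in>UNIV.
      r' (axis k 1) *\<^sub>R (col_det (c x) powr (- \<gamma>) *\<^sub>R adj_row (c x) k - axis k 1)
      + \<rho> x powr \<gamma> *\<^sub>R (\<epsilon> *\<^sub>R (
          (- \<gamma> * col_det (c x) powr (- \<gamma> - 1) * col_det_deriv (c x) (\<lambda>j. U j (axis k 1))) *\<^sub>R adj_row (c x) k
          + col_det (c x) powr (- \<gamma>) *\<^sub>R adj_row_deriv (c x) (\<lambda>j. U j (axis k 1)) k)))"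
proof -
  let ?\<eta> = "flow_map (\<lambda>y. \<epsilon> *\<^sub>R \<theta> y)"
  have c': "((\<lambda>y. c y j) has_derivative (\<lambda>h. \<epsilon> *\<^sub>R U j h)) (at x within cball 0 R)" for j
    unfolding c_def by (auto intro!: derivative_eq_intros D)
  have J': "((\<lambda>y. col_det (c y)) has_derivative (\<lambda>h. col_det_deriv (c x) (\<lambda>j. \<epsilon> *\<^sub>R U j h))) (at x within cball 0 R)"
    using col_det_has_derivative [of "\<lambda>j y. c y j" "\<lambda>j h. \<epsilon> *\<^sub>R U j h" x "cball 0 R", OF c'] by simp
  have A': "((\<lambda>y. adj_row (c y) k) has_derivative (\<lambda>h. adj_row_deriv (c x) (\<lambda>j. \<epsilon> *\<^sub>R U j h) k)) (at x within cball 0 R)" for k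
    using adj_row_has_derivative [of "\<lambda>j y. c y j" "\<lambda>j h. \<epsilon> *\<^sub>R U j h" x "cball 0 R", OF c'] by simp
  have P': "((\<lambda>y. col_det (c y) powr (- \<gamma>)) has_derivative
      (\<lambda>h. col_det_deriv (c x) (\<lambda>j. \<epsilon> *\<^sub>R U j h) * (- \<gamma> * col_det (c x) powr (- \<gamma> - 1)))) (at x within cball 0 R)"
    using J by (intro DERIV_compose_FDERIV [OF _ J']) (auto intro!: derivative_eq_intros)
  have ev: "\<forall>\<^sub>F y in at x within cball 0 R. y \<in> cball 0 R \<and> 0 < col_det (c y)"
  proof -
    have "((\<lambda>y. col_det (c y)) \<longlongrightarrow> col_det (c x)) (at x within cball 0 R)"
      using has_derivative_continuous [OF J'] by (simp add: continuous_within)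
    hence "\<forall>\<^sub>F y in at x within cball 0 R. 0 < col_det (c y)" using J by (rule order_tendstoD)
    moreover have "\<forall>\<^sub>F y in at x within cball 0 R. y \<in> cball 0 R" by (simp add: eventually_at_filter)
    ultimately show ?thesis by eventually_elim simp
  qed
  have eq: "\<rho> y powr \<gamma> *\<^sub>R (jac_det R ?\<eta> y powr (1 - \<gamma>) *\<^sub>R inv_grad R ?\<eta> y $ k - axis k 1)
      = \<rho> y powr \<gamma> *\<^sub>R (col_det (c y) powr (- \<gamma>) *\<^sub>R adj_row (c y) k - axis k 1)"
    if "y \<in> cball 0 R \<and> 0 < col_det (c y)" for y k
  proof -
    have y: "y \<in> cball 0 R" and Jy: "0 < col_det (c y)" using that by auto
    have "jac_det R ?\<eta> y = col_det (c y)" "inv_grad R ?\<eta> y $ k = adj_row (c y) k /\<^sub>R col_det (c y)"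
      using flow_map_columns(2,3) [OF R y \<theta> [OF y], of \<epsilon>] Jy by (auto simp: c_def)
    moreover have "col_det (c y) powr (1 - \<gamma>) * inverse (col_det (c y)) = col_det (c y) powr (- \<gamma>)"
    proof -
      have "inverse (col_det (c y)) = col_det (c y) powr (- 1)" using Jy by (simp add: powr_minus)
      thus ?thesis using powr_product [OF Jy, of "1 - \<gamma>" "- 1"] by simp
    qed
    ultimately show ?thesis by simp
  qed
  have "partial_on (cball 0 R) k (\<lambda>y. \<rho> y powr \<gamma> *\<^sub>R (jac_det R ?\<eta> y powr (1 - \<gamma>) *\<^sub>R inv_grad R ?\<eta> y $ k - axis k 1)) x
    = r' (axis k 1) *\<^sub>R (col_det (c x) powr (- \<gamma>) *\<^sub>R adj_row (c x) k - axis k 1)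
      + \<rho> x powr \<gamma> *\<^sub>R (\<epsilon> *\<^sub>R (
          (- \<gamma> * col_det (c x) powr (- \<gamma> - 1) * col_det_deriv (c x) (\<lambda>j. U j (axis k 1))) *\<^sub>R adj_row (c x) k
          + col_det (c x) powr (- \<gamma>) *\<^sub>R adj_row_deriv (c x) (\<lambda>j. U j (axis k 1)) k))" for k
  proof -
    have "((\<lambda>y. \<rho> y powr \<gamma> *\<^sub>R (col_det (c y) powr (- \<gamma>) *\<^sub>R adj_row (c y) k - axis k 1)) has_derivative
       (\<lambda>h. \<rho> x powr \<gamma> *\<^sub>R (col_det (c x) powr (- \<gamma>) *\<^sub>R adj_row_deriv (c x) (\<lambda>j. \<epsilon> *\<^sub>R U j h) k
            + (col_det_deriv (c x) (\<lambda>j. \<epsilon> *\<^sub>R U j h) * (- \<gamma> * col_det (c x) powr (- \<gamma> - 1))) *\<^sub>R adj_row (c x) k - 0)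
          + r' h *\<^sub>R (col_det (c x) powr (- \<gamma>) *\<^sub>R adj_row (c x) k - axis k 1))) (at x within cball 0 R)"
      by (intro has_derivative_scaleR has_derivative_diff has_derivative_const r P' A')
    hence "((\<lambda>y. \<rho> y powr \<gamma> *\<^sub>R (jac_det R ?\<eta> y powr (1 - \<gamma>) *\<^sub>R inv_grad R ?\<eta> y $ k - axis k 1)) has_derivative
       (\<lambda>h. \<rho> x powr \<gamma> *\<^sub>R (col_det (c x) powr (- \<gamma>) *\<^sub>R adj_row_deriv (c x) (\<lambda>j. \<epsilon> *\<^sub>R U j h) k
            + (col_det_deriv (c x) (\<lambda>j. \<epsilon> *\<^sub>R U j h) * (- \<gamma> * col_det (c x) powr (- \<gamma> - 1))) *\<^sub>R adj_row (c x) k - 0)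
          + r' h *\<^sub>R (col_det (c x) powr (- \<gamma>) *\<^sub>R adj_row (c x) k - axis k 1))) (at x within cball 0 R)"
    proof (rule has_derivative_transform_eventually [OF _ _ _ x])
      show "\<forall>\<^sub>F y in at x within cball 0 R. \<rho> y powr \<gamma> *\<^sub>R (col_det (c y) powr (- \<gamma>) *\<^sub>R adj_row (c y) k - axis k 1)
          = \<rho> y powr \<gamma> *\<^sub>R (jac_det R ?\<eta> y powr (1 - \<gamma>) *\<^sub>R inv_grad R ?\<eta> y $ k - axis k 1)"
        using ev by (rule eventually_mono) (rule eq [symmetric])
      show "\<rho> x powr \<gamma> *\<^sub>R (col_det (c x) powr (- \<gamma>) *\<^sub>R adj_row (c x) k - axis k 1)
          = \<rho> x powr \<gamma> *\<^sub>R (jac_det R ?\<eta> x powr (1 - \<gamma>) *\<^sub>R inv_grad R ?\<eta> x $ k - axis k 1)"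
        by (rule eq [symmetric]) (use x J in auto)
    qed
    from partial_on_eq [OF R x this, of k] show ?thesis
      by (simp add: adj_row_deriv_scale col_det_deriv_scale algebra_simps)
  qed
  thus ?thesis unfolding pressure_term_def by simp
qed

text \<open>
  With the explicit factor \<open>\<epsilon>\<close> continuity of \<open>B\<close> is enough, so the terms with second derivatives of \<open>\<theta>\<close> need not be
  differentiated in \<open>\<epsilon>\<close> any further.
\<close>

lemma has_vector_derivative_scaled_continuous:
  fixes B :: "real \<Rightarrow> 'b::real_normed_vector"
  assumes "isCont B 0"
  shows "((\<lambda>\<epsilon>. \<epsilon> *\<^sub>R B \<epsilon>) has_vector_derivative B 0) (at 0)"
  unfolding has_vector_derivative_def has_derivative_at
proof
  have "((\<lambda>h. norm (B h - B 0)) \<longlongrightarrow> norm (B 0 - B 0)) (at 0)"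
    using assms unfolding isCont_def by (intro tendsto_intros)
  moreover have "\<forall>\<^sub>F h in at 0. norm (B h - B 0) = norm ((0 + h) *\<^sub>R B (0 + h) - 0 *\<^sub>R B 0 - h *\<^sub>R B 0) / norm h"
  proof -
    have "\<forall>\<^sub>F h in at 0. h \<noteq> (0::real)" by (simp add: eventually_at_filter)
    thus ?thesis
    proof eventually_elim
      fix h :: real assume h: "h \<noteq> 0"
      have "(0 + h) *\<^sub>R B (0 + h) - 0 *\<^sub>R B 0 - h *\<^sub>R B 0 = h *\<^sub>R (B h - B 0)" by (simp add: scaleR_right_diff_distrib)
      thus "norm (B h - B 0) = norm ((0 + h) *\<^sub>R B (0 + h) - 0 *\<^sub>R B 0 - h *\<^sub>R B 0) / norm h" using h by simp
    qed
  qed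
  ultimately show "(\<lambda>h. norm ((0 + h) *\<^sub>R B (0 + h) - 0 *\<^sub>R B 0 - h *\<^sub>R B 0) / norm h) \<midarrow>0\<rightarrow> 0"
    using Lim_transform_eventually by fastforce
qed (rule bounded_linear_scaleR_left)

lemma pressure_term_derivative:
  assumes R: "0 < R" and x: "x \<in> cball 0 R"
    and \<theta>: "\<And>y. y \<in> cball 0 R \<Longrightarrow> (\<theta> has_derivative D y) (at y within cball 0 R)"
    and D: "\<And>j. ((\<lambda>y. D y (axis j 1)) has_derivative U j) (at x within cball 0 R)"
    and r: "((\<lambda>y. \<rho> y powr \<gamma>) has_derivative r') (at x within cball 0 R)"
  shows "((\<lambda>\<epsilon>. pressure_term \<gamma> R \<rho> (flow_map (\<lambda>y. \<epsilon> *\<^sub>R \<theta> y)) x) has_vector_derivative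
     inverse (\<rho> x) *\<^sub>R (\<Sum>k\<in>UNIV.
        r' (axis k 1) *\<^sub>R (((1 - \<gamma>) * (\<Sum>j\<in>UNIV. D x (axis j 1) $ j)) *\<^sub>R axis k 1 - (\<chi> i. D x (axis i 1) $ k))
      + \<rho> x powr \<gamma> *\<^sub>R (((1 - \<gamma>) * (\<Sum>j\<in>UNIV. U j (axis k 1) $ j)) *\<^sub>R axis k 1 - (\<chi> i. U i (axis k 1) $ k)))) (at 0)"
proof -
  define c where "c \<epsilon> j = axis j 1 + \<epsilon> *\<^sub>R D x (axis j 1)" for \<epsilon> j
  define B where "B k \<epsilon> = (- \<gamma> * col_det (c \<epsilon>) powr (- \<gamma> - 1) * col_det_deriv (c \<epsilon>) (\<lambda>j. U j (axis k 1))) *\<^sub>R adj_row (c \<epsilon>) k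
          + col_det (c \<epsilon>) powr (- \<gamma>) *\<^sub>R adj_row_deriv (c \<epsilon>) (\<lambda>j. U j (axis k 1)) k" for k \<epsilon>
  define X where "X \<epsilon> = inverse (\<rho> x) *\<^sub>R (\<Sum>k\<in>UNIV.
      r' (axis k 1) *\<^sub>R (col_det (c \<epsilon>) powr (- \<gamma>) *\<^sub>R adj_row (c \<epsilon>) k - axis k 1) + \<rho> x powr \<gamma> *\<^sub>R (\<epsilon> *\<^sub>R B k \<epsilon>))" for \<epsilon>
  have c0: "c 0 = (\<lambda>j. axis j 1)" by (simp add: c_def fun_eq_iff)
  have c': "((\<lambda>\<epsilon>. c \<epsilon> j) has_derivative (\<lambda>h. h *\<^sub>R D x (axis j 1))) (at 0)" for j
    unfolding c_def by (auto intro!: derivative_eq_intros)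
  have c'': "((\<lambda>\<epsilon>. c \<epsilon> j) has_vector_derivative D x (axis j 1)) (at 0)" for j
    using c' by (simp add: has_vector_derivative_def)
  have cc: "isCont (\<lambda>\<epsilon>. c \<epsilon> j) 0" for j using c' has_derivative_continuous by blast
  have J': "((\<lambda>\<epsilon>. col_det (c \<epsilon>)) has_derivative (\<lambda>h. h * (\<Sum>j\<in>UNIV. D x (axis j 1) $ j))) (at 0)"
    using col_det_has_derivative [of "\<lambda>j \<epsilon>. c \<epsilon> j" "\<lambda>j h. h *\<^sub>R D x (axis j 1)" 0 UNIV, OF c']
    by (simp add: c0 col_det_deriv_scale col_det_deriv_axis)
  have J'': "((\<lambda>\<epsilon>. col_det (c \<epsilon>)) has_real_derivative (\<Sum>j\<in>UNIV. D x (axis j 1) $ j)) (at 0)"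
    using J' by (simp add: has_field_derivative_def mult_commute_abs)
  have J0: "col_det (c 0) = 1" by (simp add: c0 col_det_axis)
  have P'': "((\<lambda>\<epsilon>. col_det (c \<epsilon>) powr s) has_real_derivative s * (\<Sum>j\<in>UNIV. D x (axis j 1) $ j)) (at 0)" for s
    using J0 by (auto intro!: derivative_eq_intros J'')
  have Jc: "isCont (\<lambda>\<epsilon>. col_det (c \<epsilon>) powr s) 0" for s using P'' DERIV_isCont by blast
  have A'': "((\<lambda>\<epsilon>. adj_row (c \<epsilon>) k) has_vector_derivative adj_row_deriv (\<lambda>j. axis j 1) (\<lambda>j. D x (axis j 1)) k) (at 0)" for k
    using adj_row_has_vector_derivative [of "\<lambda>j \<epsilon>. c \<epsilon> j" "\<lambda>j. D x (axis j 1)" 0 UNIV, OF c''] by (simp add: c0)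
  have Ac: "isCont (\<lambda>\<epsilon>. adj_row (c \<epsilon>) k) 0" for k using A'' has_vector_derivative_continuous by blast
  have Adc: "isCont (\<lambda>\<epsilon>. adj_row_deriv (c \<epsilon>) u k) 0" for u k
    unfolding adj_row_deriv_def
    by (cases "k = 1"; cases "k = 2"; simp; intro continuous_intros continuous_cross cc)
  have Bc: "isCont (B k) 0" for k
    unfolding B_def col_det_deriv_def by (intro continuous_intros Jc Ac Adc cc)
  have f1: "((\<lambda>\<epsilon>. col_det (c \<epsilon>) powr (- \<gamma>) *\<^sub>R adj_row (c \<epsilon>) k - axis k 1) has_vector_derivative
      ((1 - \<gamma>) * (\<Sum>j\<in>UNIV. D x (axis j 1) $ j)) *\<^sub>R axis k 1 - (\<chi> i. D x (axis i 1) $ k)) (at 0)" for k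
  proof -
    have "((\<lambda>\<epsilon>. col_det (c \<epsilon>) powr (- \<gamma>) *\<^sub>R adj_row (c \<epsilon>) k - axis k 1) has_vector_derivative
      (col_det (c 0) powr (- \<gamma>) *\<^sub>R adj_row_deriv (\<lambda>j. axis j 1) (\<lambda>j. D x (axis j 1)) k
       + (- \<gamma> * (\<Sum>j\<in>UNIV. D x (axis j 1) $ j)) *\<^sub>R adj_row (c 0) k) - 0) (at 0)"
      by (intro has_vector_derivative_diff has_vector_derivative_scaleR P'' A'' has_vector_derivative_const)
    thus ?thesis
      by (simp add: c0 col_det_axis adj_row_axis adj_row_deriv_axis algebra_simps)
  qed
  have B0: "B k 0 = ((1 - \<gamma>) * (\<Sum>j\<in>UNIV. U j (axis k 1) $ j)) *\<^sub>R axis k 1 - (\<chi> i. U i (axis k 1) $ k)" for k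
    by (simp add: B_def c0 col_det_axis adj_row_axis adj_row_deriv_axis col_det_deriv_axis algebra_simps)
  have X': "(X has_vector_derivative inverse (\<rho> x) *\<^sub>R (\<Sum>k\<in>UNIV.
        r' (axis k 1) *\<^sub>R (((1 - \<gamma>) * (\<Sum>j\<in>UNIV. D x (axis j 1) $ j)) *\<^sub>R axis k 1 - (\<chi> i. D x (axis i 1) $ k))
      + \<rho> x powr \<gamma> *\<^sub>R B k 0)) (at 0)"
    unfolding X_def [abs_def]
    by (intro bounded_linear.has_vector_derivative [OF bounded_linear_scaleR_right] has_vector_derivative_sum
        has_vector_derivative_add f1 has_vector_derivative_scaled_continuous Bc)
  have "\<forall>\<^sub>F \<epsilon> in nhds 0. 0 < col_det (c \<epsilon>)"
  proof -
    have "isCont (\<lambda>\<epsilon>. col_det (c \<epsilon>)) 0" using J'' DERIV_isCont by blast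
    hence "((\<lambda>\<epsilon>. col_det (c \<epsilon>)) \<longlongrightarrow> col_det (c 0)) (nhds 0)" by (simp add: continuous_at filterlim_at_within_not_equal tendsto_nhds_iff isCont_def)
    thus ?thesis using J0 by (intro order_tendstoD(1) [where y = 1]) auto
  qed
  hence "\<forall>\<^sub>F \<epsilon> in nhds 0. X \<epsilon> = pressure_term \<gamma> R \<rho> (flow_map (\<lambda>y. \<epsilon> *\<^sub>R \<theta> y)) x"
  proof eventually_elim
    fix \<epsilon> assume "0 < col_det (c \<epsilon>)"
    thus "X \<epsilon> = pressure_term \<gamma> R \<rho> (flow_map (\<lambda>y. \<epsilon> *\<^sub>R \<theta> y)) x"
      using pressure_term_eq [OF R x \<theta> D r, of \<epsilon>] by (simp add: X_def B_def c_def [abs_def])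
  qed
  hence "\<forall>\<^sub>F \<epsilon> in nhds 0. \<epsilon> \<in> UNIV \<longrightarrow> X \<epsilon> = pressure_term \<gamma> R \<rho> (flow_map (\<lambda>y. \<epsilon> *\<^sub>R \<theta> y)) x"
    by simp
  moreover from this have "X 0 = pressure_term \<gamma> R \<rho> (flow_map (\<lambda>y. 0 *\<^sub>R \<theta> y)) x"
    using eventually_nhds_x_imp_x by fast
  ultimately have "((\<lambda>\<epsilon>. pressure_term \<gamma> R \<rho> (flow_map (\<lambda>y. \<epsilon> *\<^sub>R \<theta> y)) x) has_vector_derivative inverse (\<rho> x) *\<^sub>R (\<Sum>k\<in>UNIV.
        r' (axis k 1) *\<^sub>R (((1 - \<gamma>) * (\<Sum>j\<in>UNIV. D x (axis j 1) $ j)) *\<^sub>R axis k 1 - (\<chi> i. D x (axis i 1) $ k))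
      + \<rho> x powr \<gamma> *\<^sub>R B k 0)) (at 0)"
    using X' by (rule has_vector_derivative_cong_ev [THEN iffD1])
  thus ?thesis by (simp only: B0)
qed



section \<open>Linearisation of the momentum equation\<close>

text \<open>
  This undoes the chain rule: the derivatives of the potential along \<open>\<partial>\<^sub>k\<eta>\<close>, contracted with the inverse gradient,
  return the force.
\<close>

lemma sum_inner_adj_row: "(\<Sum>k\<in>UNIV. (E \<bullet> c k) *\<^sub>R adj_row c k) = col_det c *\<^sub>R E"
  by (simp add: adj_row_def col_det_def inner_vec_def sum_3 cross3_def vec_eq_iff forall_3 algebra_simps)

lemma Kpot_has_derivative:
  assumes R: "0 < R" and \<rho>: "continuous_on (cball 0 R) \<rho>" and x: "x \<in> cball 0 R"
  shows "(Kpot R \<rho> has_derivative (\<lambda>h. pulled_force R \<rho> (\<lambda>x. x) x \<bullet> h)) (at x within cball 0 R)"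
proof -
  have "Kpot R \<rho> = lagr_potential R \<rho> (\<lambda>x. x)" by (simp add: Kpot_def lagr_potential_def fun_eq_iff)
  thus ?thesis
    using lagr_potential_has_derivative [OF R \<rho> _ _ x has_derivative_ident] by simp
qed

lemma flow_map_bilipschitz:
  assumes lip: "norm (\<theta> y - \<theta> z) \<le> L * norm (y - z)" and \<epsilon>: "\<bar>\<epsilon>\<bar> * L \<le> 1 / 2"
  shows "norm (y - z) / 2 \<le> norm (flow_map (\<lambda>y. \<epsilon> *\<^sub>R \<theta> y) y - flow_map (\<lambda>y. \<epsilon> *\<^sub>R \<theta> y) z)"
    and "norm (flow_map (\<lambda>y. \<epsilon> *\<^sub>R \<theta> y) y - flow_map (\<lambda>y. \<epsilon> *\<^sub>R \<theta> y) z) \<le> 2 * norm (y - z)"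
proof -
  have eq: "flow_map (\<lambda>y. \<epsilon> *\<^sub>R \<theta> y) y - flow_map (\<lambda>y. \<epsilon> *\<^sub>R \<theta> y) z = (y - z) + \<epsilon> *\<^sub>R (\<theta> y - \<theta> z)"
    by (simp add: flow_map_def algebra_simps)
  have "norm (\<epsilon> *\<^sub>R (\<theta> y - \<theta> z)) \<le> \<bar>\<epsilon>\<bar> * (L * norm (y - z))"
    using lip by (simp add: mult_left_mono)
  also have "\<dots> \<le> 1 / 2 * norm (y - z)"
    using mult_right_mono [OF \<epsilon>, of "norm (y - z)"] by (simp add: mult.assoc)
  finally have small: "norm (\<epsilon> *\<^sub>R (\<theta> y - \<theta> z)) \<le> norm (y - z) / 2" by simp
  show "norm (y - z) / 2 \<le> norm (flow_map (\<lambda>y. \<epsilon> *\<^sub>R \<theta> y) y - flow_map (\<lambda>y. \<epsilon> *\<^sub>R \<theta> y) z)"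
    unfolding eq using norm_diff_ineq [of "y - z" "\<epsilon> *\<^sub>R (\<theta> y - \<theta> z)"] small by linarith
  show "norm (flow_map (\<lambda>y. \<epsilon> *\<^sub>R \<theta> y) y - flow_map (\<lambda>y. \<epsilon> *\<^sub>R \<theta> y) z) \<le> 2 * norm (y - z)"
    unfolding eq using norm_triangle_ineq [of "y - z" "\<epsilon> *\<^sub>R (\<theta> y - \<theta> z)"] small norm_ge_zero [of "y - z"] by linarith
qed

lemma gravity_term_derivative:
  assumes R: "0 < R" and \<rho>: "continuous_on (cball 0 R) \<rho>" and x: "x \<in> cball 0 R"
    and \<theta>: "\<And>y. y \<in> cball 0 R \<Longrightarrow> (\<theta> has_derivative D y) (at y within cball 0 R)"
    and lip: "\<And>y z. y \<in> cball 0 R \<Longrightarrow> z \<in> cball 0 R \<Longrightarrow> norm (\<theta> y - \<theta> z) \<le> L * norm (y - z)" and L: "0 < L"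
  shows "((\<lambda>\<epsilon>. gravity_term R \<rho> (flow_map (\<lambda>y. \<epsilon> *\<^sub>R \<theta> y)) x) has_vector_derivative
     (LBINT z:ball 0 R. \<rho> z *\<^sub>R tidal (x - z) (\<theta> x - \<theta> z))) (at 0)"
proof -
  define F where "F \<epsilon> = pulled_force R \<rho> (flow_map (\<lambda>y. \<epsilon> *\<^sub>R \<theta> y)) x" for \<epsilon>
  define c where "c \<epsilon> j = axis j 1 + \<epsilon> *\<^sub>R D x (axis j 1)" for \<epsilon> j
  let ?g0 = "grad_on (cball 0 R) (Kpot R \<rho>) x"
  have c\<theta>: "continuous_on (cball 0 R) \<theta>" by (rule has_derivative_imp_continuous_on [OF \<theta>])
  have F': "((\<lambda>\<epsilon>. F \<epsilon> - ?g0) has_vector_derivative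
     (LBINT z:ball 0 R. \<rho> z *\<^sub>R tidal (x - z) (\<theta> x - \<theta> z)) - 0) (at 0)"
    unfolding F_def
    by (intro has_vector_derivative_diff has_vector_derivative_const pulled_force_perturbation_derivative [where L = L] R \<rho> c\<theta> lip x L)
  have eq: "F \<epsilon> - ?g0 = gravity_term R \<rho> (flow_map (\<lambda>y. \<epsilon> *\<^sub>R \<theta> y)) x"
    if \<epsilon>: "\<bar>\<epsilon>\<bar> * L \<le> 1 / 2" and J: "0 < col_det (c \<epsilon>)" for \<epsilon>
  proof -
    let ?\<eta> = "flow_map (\<lambda>y. \<epsilon> *\<^sub>R \<theta> y)"
    have \<eta>': "(?\<eta> has_derivative (\<lambda>h. h + \<epsilon> *\<^sub>R D x h)) (at x within cball 0 R)"
      unfolding flow_map_def [abs_def] by (intro has_derivative_add has_derivative_ident has_derivative_scaleR_right \<theta> x)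
    have "(lagr_potential R \<rho> ?\<eta> has_derivative (\<lambda>h. F \<epsilon> \<bullet> (h + \<epsilon> *\<^sub>R D x h))) (at x within cball 0 R)"
      unfolding F_def
    proof (rule lagr_potential_has_derivative [OF R \<rho> _ _ x \<eta>'])
      fix y z :: "real^3" assume yz: "y \<in> cball 0 R" "z \<in> cball 0 R"
      show "norm (y - z) / 2 \<le> norm (?\<eta> y - ?\<eta> z)" "norm (?\<eta> y - ?\<eta> z) \<le> 2 * norm (y - z)"
        using flow_map_bilipschitz [of \<theta> y z L \<epsilon>] lip [OF yz] \<epsilon> by auto
    qed
    hence "partial_on (cball 0 R) k (lagr_potential R \<rho> ?\<eta>) x = F \<epsilon> \<bullet> c \<epsilon> k" for k
      using partial_on_eq [OF R x] by (simp add: c_def)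
    moreover have "inv_grad R ?\<eta> x $ k = adj_row (c \<epsilon>) k /\<^sub>R col_det (c \<epsilon>)" for k
      using flow_map_columns(3) [OF R x \<theta> [OF x], of \<epsilon> k] J by (simp add: c_def [abs_def])
    ultimately have "gravity_term R \<rho> ?\<eta> x = (\<Sum>k\<in>UNIV. (F \<epsilon> \<bullet> c \<epsilon> k) *\<^sub>R (adj_row (c \<epsilon>) k /\<^sub>R col_det (c \<epsilon>))) - ?g0"
      by (simp add: gravity_term_def)
    also have "(\<Sum>k\<in>UNIV. (F \<epsilon> \<bullet> c \<epsilon> k) *\<^sub>R (adj_row (c \<epsilon>) k /\<^sub>R col_det (c \<epsilon>)))
        = (\<Sum>k\<in>UNIV. (F \<epsilon> \<bullet> c \<epsilon> k) *\<^sub>R adj_row (c \<epsilon>) k) /\<^sub>R col_det (c \<epsilon>)"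
      by (simp add: scaleR_sum_right mult.commute)
    also have "\<dots> = F \<epsilon>" using J by (simp add: sum_inner_adj_row)
    finally show ?thesis by simp
  qed
  have "\<forall>\<^sub>F \<epsilon> in nhds 0. \<bar>\<epsilon>\<bar> * L < 1 / 2"
  proof (rule order_tendstoD(2))
    show "((\<lambda>\<epsilon>. \<bar>\<epsilon>\<bar> * L) \<longlongrightarrow> \<bar>0\<bar> * L) (nhds 0)"
      by (intro tendsto_mult tendsto_rabs tendsto_const filterlim_ident)
  qed simp
  moreover have "\<forall>\<^sub>F \<epsilon> in nhds 0. 0 < col_det (c \<epsilon>)"
  proof -
    have "((\<lambda>\<epsilon>. c \<epsilon> j) has_derivative (\<lambda>h. h *\<^sub>R D x (axis j 1))) (at 0)" for j
      unfolding c_def by (auto intro!: derivative_eq_intros)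
    from has_derivative_continuous [OF col_det_has_derivative [of "\<lambda>j \<epsilon>. c \<epsilon> j" "\<lambda>j h. h *\<^sub>R D x (axis j 1)" 0 UNIV, OF this]]
    have "((\<lambda>\<epsilon>. col_det (c \<epsilon>)) \<longlongrightarrow> col_det (c 0)) (nhds 0)"
      by (simp add: continuous_at filterlim_at_within_not_equal tendsto_nhds_iff isCont_def)
    moreover have "col_det (c 0) = 1" by (simp add: c_def [abs_def] col_det_axis)
    ultimately show ?thesis by (intro order_tendstoD(1) [where y = 1]) auto
  qed
  ultimately have ev: "\<forall>\<^sub>F \<epsilon> in nhds 0. \<epsilon> \<in> UNIV \<longrightarrow> F \<epsilon> - ?g0 = gravity_term R \<rho> (flow_map (\<lambda>y. \<epsilon> *\<^sub>R \<theta> y)) x"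
    by eventually_elim (use eq in auto)
  have e0: "F 0 - ?g0 = gravity_term R \<rho> (flow_map (\<lambda>y. 0 *\<^sub>R \<theta> y)) x"
    using eventually_nhds_x_imp_x [OF ev] by simp
  show ?thesis using has_vector_derivative_cong_ev [THEN iffD1, OF ev e0 F'] by simp
qed

lemma sphere_integral_cong:
  assumes "0 \<le> R" "\<And>z. norm z = R \<Longrightarrow> F z = G z"
  shows "sphere_integral R F = sphere_integral R G"
  using assms by (simp add: sphere_integral_def norm_sphere_point case_prod_beta)

lemma sphere_flux_cong:
  assumes "0 \<le> R" "\<And>z. norm z = R \<Longrightarrow> F z = G z"
  shows "sphere_flux R F = sphere_flux R G"
  unfolding sphere_flux_def using assms by (intro sphere_integral_cong) auto

lemma time_deriv2_scaleR:
  fixes u :: "real \<Rightarrow> 'b::real_normed_vector"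
  assumes T: "open T" "t \<in> T" and u: "u twice_differentiable_on T"
  shows "time_deriv2 (\<lambda>s. \<epsilon> *\<^sub>R u s) t = \<epsilon> *\<^sub>R time_deriv2 u t"
proof -
  have at: "at s within T = at s" if "s \<in> T" for s using that T(1) by (rule at_within_open)
  have d1: "(u has_vector_derivative vector_derivative u (at s)) (at s)" if "s \<in> T" for s
  proof -
    have "u differentiable (at s within T)"
      using u that unfolding twice_differentiable_on_def differentiable_on_def by blast
    thus ?thesis unfolding at [OF that] by (rule vector_derivative_works [THEN iffD1])
  qed
  have d2: "((\<lambda>s. vector_derivative u (at s)) has_vector_derivative time_deriv2 u t) (at t)"
  proof -
    have "(\<lambda>s. vector_derivative u (at s)) differentiable (at t within T)"
      using u T unfolding twice_differentiable_on_def differentiable_on_def by blast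
    thus ?thesis unfolding at [OF T(2)] time_deriv2_def by (rule vector_derivative_works [THEN iffD1])
  qed
  have e: "\<epsilon> *\<^sub>R vector_derivative u (at s) = vector_derivative (\<lambda>s. \<epsilon> *\<^sub>R u s) (at s)" if "s \<in> T" for s
    by (rule vector_derivative_at [symmetric])
       (rule bounded_linear.has_vector_derivative [OF bounded_linear_scaleR_right d1 [OF that]])
  have "((\<lambda>s. vector_derivative (\<lambda>s. \<epsilon> *\<^sub>R u s) (at s)) has_vector_derivative \<epsilon> *\<^sub>R time_deriv2 u t) (at t)"
    by (rule has_vector_derivative_transform_within_open
         [OF bounded_linear.has_vector_derivative [OF bounded_linear_scaleR_right d2] T e])
  thus ?thesis unfolding time_deriv2_def by (rule vector_derivative_at)
qed

context liquid_star
begin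

abbreviation \<rho> :: "real^3 \<Rightarrow> real" where "\<rho> \<equiv> liquid_density R f"

lemma R_pos: "0 < R" using radius by simp

lemma \<rho>_continuous: "continuous_on (cball 0 R) \<rho>"
  by (rule C1_on_imp_continuous_on [OF liquid_density_C1])

text \<open>
  Away from the centre both sides are gradients of \<open>K\<rho>\<close>, one by differentiating under the integral and one
  from the explicit potential. At the centre the derivative of an even function vanishes.
\<close>

lemma gravity_eq_force:
  assumes y: "y \<in> ball 0 R"
  shows "pulled_force R \<rho> (\<lambda>x. x) y = - gravity y"
proof -
  let ?E = "pulled_force R \<rho> (\<lambda>x. x) y"
  have at: "at y within cball 0 R = at y" using y by (intro at_within_interior) simp
  have K: "(Kpot R \<rho> has_derivative (\<lambda>h. ?E \<bullet> h)) (at y)"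
    using Kpot_has_derivative [OF R_pos \<rho>_continuous, of y] y unfolding at by auto
  show ?thesis
  proof (cases "y = 0")
    case False
    have "(\<lambda>h. ?E \<bullet> h) = (\<lambda>h. - gravity y \<bullet> h)"
      by (rule has_derivative_unique [OF K Kpot_density_has_derivative [OF y False]])
    hence "?E \<bullet> (?E + gravity y) = - gravity y \<bullet> (?E + gravity y)" by (rule fun_cong)
    hence "(?E + gravity y) \<bullet> (?E + gravity y) = 0" by (simp add: inner_add_left)
    thus ?thesis by (simp add: eq_neg_iff_add_eq_0)
  next
    case True
    have "(uminus has_derivative uminus) (at (0::real^3))" by (intro has_derivative_minus has_derivative_ident)
    moreover have "(Kpot R \<rho> has_derivative (\<lambda>h. ?E \<bullet> h)) (at (- 0))" using K True by simp
    ultimately have "((\<lambda>x. Kpot R \<rho> (- x)) has_derivative (\<lambda>h. ?E \<bullet> (- h))) (at 0)"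
      by (rule has_derivative_compose)
    hence "(Kpot R \<rho> has_derivative (\<lambda>h. ?E \<bullet> (- h))) (at 0)"
      by (rule has_derivative_transform_within_open [of _ _ _ _ "ball 0 R"]) (use radius Kpot_density_even in auto)
    hence "(\<lambda>h. ?E \<bullet> (- h)) = (\<lambda>h. ?E \<bullet> h)" using K True by (simp add: has_derivative_unique)
    hence "?E \<bullet> (- ?E) = ?E \<bullet> ?E" by (rule fun_cong)
    thus ?thesis using True by (simp add: gravity_def)
  qed
qed

lemma div_density_times:
  assumes y: "y \<in> cball 0 R" and v: "(v has_derivative v') (at y within cball 0 R)"
  shows "div_on (cball 0 R) (\<lambda>z. \<rho> z *\<^sub>R v z) y = \<rho> y * div_on (cball 0 R) v y + \<rho> y powr (2 - \<gamma>) / \<gamma> * (v y \<bullet> gravity y)"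
  using div_on_scaleR [OF R_pos y liquid_density_has_derivative [OF y] v] by simp

text \<open>
  Differentiated as it stands, the nonlocal part would produce a principal value integral of \<open>D\<^sup>2\<Phi>\<close> against \<open>\<rho>\<theta>\<close>.
  Subtracting the constant vector \<open>\<theta> x\<close> inside the integral costs a multiple of \<open>\<nabla>K\<rho>\<close>, which equilibrium combines
  with the local term \<open>\<theta> \<bullet> g\<close>, and leaves an integral that is differentiable at \<open>x\<close>.
\<close>

lemma lin_op_potential:
  assumes \<theta>: "C1_on (cball 0 R) \<theta>" and y: "y \<in> ball 0 R" and x: "x \<in> cball 0 R"
  shows "\<gamma> * \<rho> y powr (\<gamma> - 2) * div_on (cball 0 R) (\<lambda>z. \<rho> z *\<^sub>R \<theta> z) y
           + Kpot R (div_on (cball 0 R) (\<lambda>z. \<rho> z *\<^sub>R \<theta> z)) y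
           + sphere_flux R (\<lambda>z. \<theta> z /\<^sub>R norm (y - z))
     = \<gamma> * \<rho> y powr (\<gamma> - 1) * div_on (cball 0 R) \<theta> y + (\<theta> y - \<theta> x) \<bullet> gravity y
       - (LBINT z:ball 0 R. \<rho> z * (newton_force (y - z) \<bullet> (\<theta> x - \<theta> z)))"
proof -
  have yc: "y \<in> cball 0 R" using y by simp
  have \<rho>y: "0 < \<rho> y" by (rule liquid_density_pos [OF yc])
  have c\<theta>: "continuous_on (cball 0 R) \<theta>" by (rule C1_on_imp_continuous_on [OF \<theta>])
  obtain v' where v': "(\<theta> has_derivative v') (at y within cball 0 R)" using C1_onD [OF \<theta>] yc by metis
  have p1: "\<rho> y powr (\<gamma> - 2) * \<rho> y = \<rho> y powr (\<gamma> - 1)" using powr_product [OF \<rho>y, of "\<gamma> - 2" 1] \<rho>y by simp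
  have p2: "\<rho> y powr (\<gamma> - 2) * \<rho> y powr (2 - \<gamma>) = 1" using powr_product [OF \<rho>y, of "\<gamma> - 2" "2 - \<gamma>"] \<rho>y by simp
  have "\<gamma> * \<rho> y powr (\<gamma> - 2) * div_on (cball 0 R) (\<lambda>z. \<rho> z *\<^sub>R \<theta> z) y
      = \<gamma> * (\<rho> y powr (\<gamma> - 2) * \<rho> y) * div_on (cball 0 R) \<theta> y
        + (\<rho> y powr (\<gamma> - 2) * \<rho> y powr (2 - \<gamma>)) * (\<theta> y \<bullet> gravity y)"
    unfolding div_density_times [OF yc v'] using gamma by (simp add: field_simps)
  hence 1: "\<gamma> * \<rho> y powr (\<gamma> - 2) * div_on (cball 0 R) (\<lambda>z. \<rho> z *\<^sub>R \<theta> z) y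
      = \<gamma> * \<rho> y powr (\<gamma> - 1) * div_on (cball 0 R) \<theta> y + \<theta> y \<bullet> gravity y"
    by (simp only: p1 p2 mult_1)
  \<comment> \<open>The density is \<open>1\<close> on the sphere, so the flux of \<open>\<theta>\<close> is the boundary term of \<open>\<rho>\<theta>\<close>.\<close>
  have fl: "sphere_flux R (\<lambda>z. \<theta> z /\<^sub>R norm (y - z)) = sphere_flux R (\<lambda>z. (\<rho> z *\<^sub>R \<theta> z) /\<^sub>R norm (y - z))"
    using radius by (intro sphere_flux_cong) (auto simp: liquid_density_eq)
  have 2: "Kpot R (div_on (cball 0 R) (\<lambda>z. \<rho> z *\<^sub>R \<theta> z)) y + sphere_flux R (\<lambda>z. \<theta> z /\<^sub>R norm (y - z))
      = (LBINT z:ball 0 R. (\<rho> z *\<^sub>R \<theta> z) \<bullet> newton_force (y - z))"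
    using singular_divergence [OF R_pos C1_on_scaleR [OF liquid_density_C1 \<theta>] y]
    unfolding fl Kpot_def by linarith
  have i1: "set_integrable lborel (ball 0 R) (\<lambda>z. \<rho> z * (newton_force (y - z) \<bullet> \<theta> x))"
    and i2: "set_integrable lborel (ball 0 R) (\<lambda>z. \<rho> z * (newton_force (y - z) \<bullet> \<theta> z))"
    by (intro force_work_integrable continuous_intros \<rho>_continuous c\<theta> yc)+
  have i3: "set_integrable lborel (ball 0 R) (\<lambda>z. \<rho> z *\<^sub>R newton_force (y - z))"
    using pulled_force_integrable(1) [OF R_pos \<rho>_continuous, of "\<lambda>x. x" y] yc by (simp add: continuous_on_id)
  have "(LBINT z:ball 0 R. \<rho> z * (newton_force (y - z) \<bullet> (\<theta> x - \<theta> z)))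
      = (LBINT z:ball 0 R. \<rho> z * (newton_force (y - z) \<bullet> \<theta> x)) - (LBINT z:ball 0 R. \<rho> z * (newton_force (y - z) \<bullet> \<theta> z))"
    unfolding inner_diff_right right_diff_distrib by (rule set_integral_diff(2) [OF i1 i2])
  also have "(LBINT z:ball 0 R. \<rho> z * (newton_force (y - z) \<bullet> \<theta> x)) = pulled_force R \<rho> (\<lambda>x. x) y \<bullet> \<theta> x"
    using set_integral_inner(2) [OF i3, of "\<theta> x"] by (simp add: pulled_force_def)
  also have "\<dots> = - gravity y \<bullet> \<theta> x" by (simp only: gravity_eq_force [OF y])
  also have "(LBINT z:ball 0 R. \<rho> z * (newton_force (y - z) \<bullet> \<theta> z)) = (LBINT z:ball 0 R. (\<rho> z *\<^sub>R \<theta> z) \<bullet> newton_force (y - z))"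
    by (simp add: inner_commute)
  finally have 3: "(LBINT z:ball 0 R. (\<rho> z *\<^sub>R \<theta> z) \<bullet> newton_force (y - z))
      = - (gravity y \<bullet> \<theta> x) - (LBINT z:ball 0 R. \<rho> z * (newton_force (y - z) \<bullet> (\<theta> x - \<theta> z)))"
    by simp
  have "(\<theta> y - \<theta> x) \<bullet> gravity y = \<theta> y \<bullet> gravity y - gravity y \<bullet> \<theta> x"
    by (simp only: inner_diff_left) (simp add: inner_commute)
  thus ?thesis using 1 2 3 by linarith
qed

text \<open>
  On the sphere \<open>div (\<rho>\<theta>) = \<theta> \<bullet> \<nabla>\<rho>\<close> when \<open>div \<theta> = 0\<close>, and \<open>\<nabla>\<rho>\<close> is the boundary slope times the unit normal. So the two
  functions under the gradient coincide at every point.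
\<close>

lemma lin_op_eq_lin_op_div:
  assumes \<theta>: "C1_on (cball 0 R) \<theta>" and bc: "\<And>z. z \<in> sphere 0 R \<Longrightarrow> div_on (cball 0 R) \<theta> z = 0"
  shows "lin_op \<gamma> R \<rho> \<theta> x = lin_op_div \<gamma> R \<rho> (liquid_slope R f) \<theta> x"
proof -
  let ?d = "div_on (cball 0 R) (\<lambda>z. \<rho> z *\<^sub>R \<theta> z)" and ?\<sigma> = "liquid_slope R f"
  have d: "inverse ?\<sigma> * ?d z = \<theta> z \<bullet> (z /\<^sub>R R)" if z: "norm z = R" for z
  proof -
    have zc: "z \<in> cball 0 R" using z by simp
    obtain v' where v': "(\<theta> has_derivative v') (at z within cball 0 R)" using C1_onD [OF \<theta>] zc by metis
    have "?d z = 1 / \<gamma> * (\<theta> z \<bullet> gravity z)"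
      using div_density_times [OF zc v'] bc [of z] z radius by (simp add: liquid_density_eq [OF zc])
    also have "\<dots> = ?\<sigma> * (\<theta> z \<bullet> (z /\<^sub>R R))"
      using z radius by (simp add: liquid_slope_eq gravity_def)
    finally show ?thesis using liquid_slope_neq_0 by simp
  qed
  have "sphere_flux R (\<lambda>z. \<theta> z /\<^sub>R norm (y - z)) = - inverse ?\<sigma> * Kpot_bdry R ?d y" for y
  proof -
    have "sphere_flux R (\<lambda>z. \<theta> z /\<^sub>R norm (y - z)) = sphere_integral R (\<lambda>z. inverse ?\<sigma> * (?d z / norm (y - z)))"
      unfolding sphere_flux_def
    proof (rule sphere_integral_cong)
      fix z :: "real^3" assume z: "norm z = R"
      show "(\<theta> z /\<^sub>R norm (y - z)) \<bullet> (z /\<^sub>R R) = inverse ?\<sigma> * (?d z / norm (y - z))"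
        using d [OF z] by (simp add: divide_inverse mult_ac)
    qed (use radius in simp)
    also have "\<dots> = inverse ?\<sigma> * sphere_integral R (\<lambda>z. ?d z / norm (y - z))"
      unfolding sphere_integral_def by (simp add: case_prod_unfold mult.assoc flip: set_integral_mult_right)
    finally show ?thesis by (simp add: Kpot_bdry_def)
  qed
  thus ?thesis unfolding lin_op_def lin_op_div_def by simp
qed

text \<open>
  Both sides are computed in components. The pressure contributes \<open>\<partial>\<^sub>k\<partial>\<^sub>i\<theta>\<^sup>k\<close> and the operator \<open>\<partial>\<^sub>i\<partial>\<^sub>k\<theta>\<^sup>k\<close>; these agree by
  symmetry of second derivatives. The gravitational part \<open>Q'\<close> is the same integral on both sides.
\<close>

lemma linearised_force:
  assumes \<theta>: "C2_on (cball 0 R) \<theta>" and x: "x \<in> ball 0 R"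
  shows "((\<lambda>\<epsilon>. pressure_term \<gamma> R \<rho> (flow_map (\<lambda>y. \<epsilon> *\<^sub>R \<theta> y)) x + gravity_term R \<rho> (flow_map (\<lambda>y. \<epsilon> *\<^sub>R \<theta> y)) x)
     has_vector_derivative lin_op \<gamma> R \<rho> \<theta> x) (at 0)"
proof -
  have xc: "x \<in> cball 0 R" using x by simp
  have \<rho>x: "0 < \<rho> x" by (rule liquid_density_pos [OF xc])
  obtain D :: "real^3 \<Rightarrow> (real^3) \<Rightarrow>\<^sub>L (real^3)" where D: "\<And>y. y \<in> cball 0 R \<Longrightarrow> (\<theta> has_derivative blinfun_apply (D y)) (at y within cball 0 R)"
    and CD: "C1_on (cball 0 R) D" using \<theta> unfolding C2_on_def by blast
  have cD: "continuous_on (cball 0 R) D" by (rule C1_on_imp_continuous_on [OF CD])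
  have C1: "C1_on (cball 0 R) \<theta>" using D cD unfolding C1_on_def by blast
  have c\<theta>: "continuous_on (cball 0 R) \<theta>" by (rule C1_on_imp_continuous_on [OF C1])
  obtain D2 where D2: "\<And>y. y \<in> cball 0 R \<Longrightarrow> (D has_derivative D2 y) (at y within cball 0 R)"
    using C1_onD [OF CD] by metis
  obtain L where L: "0 < L" and lip: "\<And>y z. y \<in> cball 0 R \<Longrightarrow> z \<in> cball 0 R \<Longrightarrow> norm (\<theta> y - \<theta> z) \<le> L * norm (y - z)"
  proof -
    obtain M where M: "0 \<le> M" "\<And>y. y \<in> cball 0 R \<Longrightarrow> norm (D y) \<le> M" using bounded_on_cball [OF cD] by blast
    have "norm (\<theta> y - \<theta> z) \<le> (M + 1) * norm (y - z)" if "y \<in> cball 0 R" "z \<in> cball 0 R" for y z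
    proof -
      have "norm (\<theta> y - \<theta> z) \<le> M * norm (y - z)"
        using M by (intro differentiable_bound [OF convex_cball D _ that]) (auto simp: norm_blinfun.rep_eq [symmetric])
      also have "\<dots> \<le> (M + 1) * norm (y - z)" by (intro mult_right_mono) auto
      finally show ?thesis .
    qed
    thus ?thesis using M(1) by (intro that [of "M + 1"]) auto
  qed
  define u where "u j y = blinfun_apply (D y) (axis j 1)" for j y
  define U where "U j h = blinfun_apply (D2 x h) (axis j 1)" for j h
  have U: "(u j has_derivative U j) (at x within cball 0 R)" for j
    unfolding u_def [abs_def] U_def [abs_def]
    by (rule bounded_linear.has_derivative [OF blinfun.bounded_linear_left D2 [OF xc]])
  define tr where "tr y = (\<Sum>j\<in>UNIV. u j y $ j)" for y
  have tr: "div_on (cball 0 R) \<theta> y = tr y" if "y \<in> cball 0 R" for y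
    using div_on_eq [OF R_pos that D [OF that]] by (simp add: tr_def u_def)
  have tr': "(tr has_derivative (\<lambda>h. \<Sum>j\<in>UNIV. U j h $ j)) (at x within cball 0 R)"
    unfolding tr_def by (intro has_derivative_sum bounded_linear.has_derivative [OF bounded_linear_vec_nth] U)
  have sym: "U i (axis k 1) $ k = U k (axis i 1) $ k" for i k
  proof -
    have at: "at y within cball 0 R = at y" if "y \<in> ball 0 R" for y :: "real^3" using that by (intro at_within_interior) simp
    obtain r where r: "0 < r" "ball x r \<subseteq> ball 0 R" using x open_ball openE by blast
    have "(\<lambda>h. U i h $ k) (axis k 1) = (\<lambda>h. U k h $ k) (axis i 1)"
    proof (rule second_derivative_symmetric [OF r(1), where g = "\<lambda>y. \<theta> y $ k" and g' = "\<lambda>y h. blinfun_apply (D y) h $ k"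
        and A = "\<lambda>h. U i h $ k" and B = "\<lambda>h. U k h $ k"])
      fix y assume "y \<in> ball x r"
      hence y: "y \<in> ball 0 R" using r(2) by blast
      show "((\<lambda>y. \<theta> y $ k) has_derivative (\<lambda>h. blinfun_apply (D y) h $ k)) (at y)"
        using bounded_linear.has_derivative [OF bounded_linear_vec_nth D [of y]] y by (simp add: at [OF y])
    next
      show "((\<lambda>y. blinfun_apply (D y) (axis i 1) $ k) has_derivative (\<lambda>h. U i h $ k)) (at x)"
        using bounded_linear.has_derivative [OF bounded_linear_vec_nth U] unfolding at [OF x] u_def by auto
      show "((\<lambda>y. blinfun_apply (D y) (axis k 1) $ k) has_derivative (\<lambda>h. U k h $ k)) (at x)"
        using bounded_linear.has_derivative [OF bounded_linear_vec_nth U] unfolding at [OF x] u_def by auto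
    qed
    thus ?thesis by simp
  qed
  obtain W where W: "(gravity has_derivative W) (at x)"
    using gravity_differentiable [of x] x radius by auto
  have \<rho>': "(\<rho> has_derivative (\<lambda>h. ((\<rho> x powr (2 - \<gamma>) / \<gamma>) *\<^sub>R gravity x) \<bullet> h)) (at x within cball 0 R)"
    by (rule liquid_density_has_derivative [OF xc])
  have pow: "((\<lambda>y. \<rho> y powr s) has_derivative (\<lambda>h. ((\<rho> x powr (2 - \<gamma>) / \<gamma>) *\<^sub>R gravity x) \<bullet> h * (s * \<rho> x powr (s - 1)))) (at x within cball 0 R)" for s
    using \<rho>x by (intro DERIV_compose_FDERIV [OF _ \<rho>']) (auto intro!: derivative_eq_intros)
  have p\<gamma>: "((\<lambda>y. \<rho> y powr \<gamma>) has_derivative (\<lambda>h. \<rho> x * (gravity x \<bullet> h))) (at x within cball 0 R)"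
  proof -
    have "\<rho> x powr (2 - \<gamma>) * \<rho> x powr (\<gamma> - 1) = \<rho> x" using powr_product [OF \<rho>x, of "2 - \<gamma>" "\<gamma> - 1"] \<rho>x by simp
    hence eq: "(\<lambda>h. ((\<rho> x powr (2 - \<gamma>) / \<gamma>) *\<^sub>R gravity x) \<bullet> h * (\<gamma> * \<rho> x powr (\<gamma> - 1))) = (\<lambda>h. \<rho> x * (gravity x \<bullet> h))"
      using gamma by (simp add: fun_eq_iff mult_ac)
    show ?thesis using pow [of \<gamma>] unfolding eq .
  qed
  have p\<gamma>1: "((\<lambda>y. \<rho> y powr (\<gamma> - 1)) has_derivative (\<lambda>h. (\<gamma> - 1) / \<gamma> * (gravity x \<bullet> h))) (at x within cball 0 R)"
  proof -
    have "\<rho> x powr (2 - \<gamma>) * \<rho> x powr (\<gamma> - 1 - 1) = 1" using powr_product [OF \<rho>x, of "2 - \<gamma>" "\<gamma> - 1 - 1"] \<rho>x by simp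
    hence eq: "(\<lambda>h. ((\<rho> x powr (2 - \<gamma>) / \<gamma>) *\<^sub>R gravity x) \<bullet> h * ((\<gamma> - 1) * \<rho> x powr (\<gamma> - 1 - 1)))
        = (\<lambda>h. (\<gamma> - 1) / \<gamma> * (gravity x \<bullet> h))"
      using gamma by (simp add: fun_eq_iff mult_ac)
    show ?thesis using pow [of "\<gamma> - 1"] unfolding eq .
  qed
  define Q' where "Q' = (LBINT z:ball 0 R. \<rho> z *\<^sub>R tidal (x - z) (\<theta> x - \<theta> z))"
  define PV where "PV = inverse (\<rho> x) *\<^sub>R (\<Sum>k\<in>UNIV.
        (\<rho> x * (gravity x \<bullet> axis k 1)) *\<^sub>R (((1 - \<gamma>) * tr x) *\<^sub>R axis k 1 - (\<chi> i. u i x $ k))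
      + \<rho> x powr \<gamma> *\<^sub>R (((1 - \<gamma>) * (\<Sum>j\<in>UNIV. U j (axis k 1) $ j)) *\<^sub>R axis k 1 - (\<chi> i. U i (axis k 1) $ k)))"
  have "((\<lambda>\<epsilon>. pressure_term \<gamma> R \<rho> (flow_map (\<lambda>y. \<epsilon> *\<^sub>R \<theta> y)) x) has_vector_derivative PV) (at 0)"
    using pressure_term_derivative [OF R_pos xc D U [unfolded u_def [abs_def]] p\<gamma>]
    by (simp add: PV_def tr_def u_def)
  moreover have "((\<lambda>\<epsilon>. gravity_term R \<rho> (flow_map (\<lambda>y. \<epsilon> *\<^sub>R \<theta> y)) x) has_vector_derivative Q') (at 0)"
    unfolding Q'_def by (rule gravity_term_derivative [OF R_pos \<rho>_continuous xc D lip L])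
  ultimately have sum: "((\<lambda>\<epsilon>. pressure_term \<gamma> R \<rho> (flow_map (\<lambda>y. \<epsilon> *\<^sub>R \<theta> y)) x + gravity_term R \<rho> (flow_map (\<lambda>y. \<epsilon> *\<^sub>R \<theta> y)) x)
     has_vector_derivative PV + Q') (at 0)" by (rule has_vector_derivative_add)
  let ?Q = "\<lambda>y. LBINT z:ball 0 R. \<rho> z * (newton_force (y - z) \<bullet> (\<theta> x - \<theta> z))"
  let ?\<Psi> = "\<lambda>y. \<gamma> * \<rho> y powr (\<gamma> - 2) * div_on (cball 0 R) (\<lambda>z. \<rho> z *\<^sub>R \<theta> z) y
           + Kpot R (div_on (cball 0 R) (\<lambda>z. \<rho> z *\<^sub>R \<theta> z)) y
           + sphere_flux R (\<lambda>z. \<theta> z /\<^sub>R norm (y - z))"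
  have Q: "(?Q has_derivative (\<lambda>h. Q' \<bullet> h)) (at x within cball 0 R)"
    unfolding Q'_def by (rule force_against_displacement_has_derivative [OF R_pos \<rho>_continuous c\<theta> lip xc]) (use L in auto)
  have "((\<lambda>y. \<gamma> * (\<rho> y powr (\<gamma> - 1) * tr y) + (\<theta> y - \<theta> x) \<bullet> gravity y - ?Q y) has_derivative
      (\<lambda>h. \<gamma> * (\<rho> x powr (\<gamma> - 1) * (\<Sum>j\<in>UNIV. U j h $ j) + (\<gamma> - 1) / \<gamma> * (gravity x \<bullet> h) * tr x)
         + ((\<theta> x - \<theta> x) \<bullet> W h + (D x h - 0) \<bullet> gravity x) - Q' \<bullet> h)) (at x within cball 0 R)"
    by (intro has_derivative_add has_derivative_diff has_derivative_mult_right has_derivative_mult has_derivative_inner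
        has_derivative_const p\<gamma>1 tr' D xc has_derivative_at_withinI [OF W] Q)
  hence "(?\<Psi> has_derivative
      (\<lambda>h. \<gamma> * (\<rho> x powr (\<gamma> - 1) * (\<Sum>j\<in>UNIV. U j h $ j) + (\<gamma> - 1) / \<gamma> * (gravity x \<bullet> h) * tr x)
         + ((\<theta> x - \<theta> x) \<bullet> W h + (D x h - 0) \<bullet> gravity x) - Q' \<bullet> h)) (at x within cball 0 R)"
  proof (rule has_derivative_transform_eventually [OF _ _ _ xc])
    have eq: "\<gamma> * (\<rho> y powr (\<gamma> - 1) * tr y) + (\<theta> y - \<theta> x) \<bullet> gravity y - ?Q y = ?\<Psi> y" if "y \<in> ball 0 R" for y
      unfolding lin_op_potential [OF C1 that xc] using that by (simp add: tr)
    show "\<forall>\<^sub>F y in at x within cball 0 R. \<gamma> * (\<rho> y powr (\<gamma> - 1) * tr y) + (\<theta> y - \<theta> x) \<bullet> gravity y - ?Q y = ?\<Psi> y"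
    proof -
      have "\<forall>\<^sub>F y in at x within cball 0 R. y \<in> ball 0 R" using eventually_nhds_in_open [OF open_ball x] by (auto simp: eventually_at_filter elim: eventually_mono)
      thus ?thesis by eventually_elim (rule eq)
    qed
    show "\<gamma> * (\<rho> x powr (\<gamma> - 1) * tr x) + (\<theta> x - \<theta> x) \<bullet> gravity x - ?Q x = ?\<Psi> x" by (rule eq [OF x])
  qed
  from partial_on_eq [OF R_pos xc this]
  have L_i: "lin_op \<gamma> R \<rho> \<theta> x $ i = - (\<gamma> * \<rho> x powr (\<gamma> - 1) * (\<Sum>j\<in>UNIV. U j (axis i 1) $ j) + (\<gamma> - 1) * (gravity x $ i) * tr x
      + u i x \<bullet> gravity x - Q' $ i)" for i
    using gamma by (simp add: lin_op_def grad_on_def u_def inner_axis distrib_left)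
  have PV_i: "PV $ i = (1 - \<gamma>) * tr x * gravity x $ i - u i x \<bullet> gravity x
      - \<gamma> * \<rho> x powr (\<gamma> - 1) * (\<Sum>j\<in>UNIV. U j (axis i 1) $ j)" for i
  proof -
    have p: "inverse (\<rho> x) * \<rho> x powr \<gamma> = \<rho> x powr (\<gamma> - 1)"
      using powr_product [OF \<rho>x, of "-1" \<gamma>] \<rho>x by (simp add: powr_minus)
    have s: "(\<Sum>k\<in>UNIV. U i (axis k 1) $ k) = (\<Sum>k\<in>UNIV. U k (axis i 1) $ k)" by (simp add: sym)
    define S where "S k = (\<Sum>j\<in>UNIV. U j (axis k 1) $ j)" for k
    have ga: "gravity x \<bullet> axis k 1 = gravity x $ k" for k by (simp add: inner_axis)
    have ax: "axis k (1::real) $ i = (if i = k then 1 else 0)" for k by (simp add: axis_def)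
    have c: "inverse (\<rho> x) * (\<rho> x * t) = t" for t using \<rho>x by simp
    have "PV $ i = (\<Sum>k\<in>UNIV. (gravity x $ k) * ((1 - \<gamma>) * tr x * (if i = k then 1 else 0) - u i x $ k)
        + (inverse (\<rho> x) * \<rho> x powr \<gamma>) * ((1 - \<gamma>) * S k * (if i = k then 1 else 0) - U i (axis k 1) $ k))"
      unfolding PV_def S_def [symmetric] ga
      by (simp add: ax sum_distrib_left distrib_left mult.assoc c)
    also have "\<dots> = (1 - \<gamma>) * tr x * gravity x $ i - (\<Sum>k\<in>UNIV. gravity x $ k * u i x $ k)
        + \<rho> x powr (\<gamma> - 1) * ((1 - \<gamma>) * S i - (\<Sum>k\<in>UNIV. U i (axis k 1) $ k))"
      unfolding p using exhaust_3 [of i] by (auto simp: sum_3 algebra_simps)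
    finally show ?thesis unfolding s S_def by (simp add: inner_vec_def mult.commute algebra_simps)
  qed
  have "PV + Q' = lin_op \<gamma> R \<rho> \<theta> x"
    unfolding vec_eq_iff vector_add_component L_i PV_i by (simp add: algebra_simps)
  thus ?thesis using sum by simp
qed

end

theorem lemma2p2:
  fixes \<gamma> \<rho>0 a R :: real
    and f0 :: "real \<Rightarrow> real"
    and T :: "real set"
    and \<theta> :: "real \<Rightarrow> real^3 \<Rightarrow> real^3"
  defines "\<rho> \<equiv> liquid_density R f0"
  assumes gamma: "1 \<le> \<gamma>" "\<gamma> \<le> 2"
    and central: "1 < \<rho>0"
    and profile: "lane_emden \<gamma> \<rho>0 a f0"
    and radius: "0 < R" "R < a" "f0 R = 1"
    and time: "open T"
    and space_regular: "\<And>t. t \<in> T \<Longrightarrow> C2_on (cball 0 R) (\<theta> t)"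
    and time_regular: "\<And>x. x \<in> ball 0 R \<Longrightarrow> (\<lambda>t. \<theta> t x) twice_differentiable_on T"
  shows "\<forall>t\<in>T.
      (\<forall>x\<in>ball 0 R.
        ((\<lambda>\<epsilon>. momentum_lhs \<gamma> R \<rho> (\<lambda>s y. \<epsilon> *\<^sub>R \<theta> s y) t x) has_vector_derivative
           time_deriv2 (\<lambda>s. \<theta> s x) t + lin_op \<gamma> R \<rho> (\<theta> t) x) (at 0)) \<and>
      (\<forall>x\<in>sphere 0 R.
        ((\<lambda>\<epsilon>. jac_det R (flow_map (\<lambda>y. \<epsilon> *\<^sub>R \<theta> t y)) x - 1) has_real_derivative
           div_on (cball 0 R) (\<theta> t) x) (at 0)) \<and>
      ((\<forall>x\<in>sphere 0 R. div_on (cball 0 R) (\<theta> t) x = 0) \<longrightarrow>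
        (\<forall>x\<in>ball 0 R. lin_op \<gamma> R \<rho> (\<theta> t) x = lin_op_div \<gamma> R \<rho> (liquid_slope R f0) (\<theta> t) x))"
proof
  fix t assume t: "t \<in> T"
  interpret liquid_star \<gamma> \<rho>0 a R f0
    using gamma central profile radius by unfold_locales
  have C2: "C2_on (cball 0 R) (\<theta> t)" by (rule space_regular [OF t])
  then obtain D where D: "\<And>y. y \<in> cball 0 R \<Longrightarrow> (\<theta> t has_derivative blinfun_apply (D y)) (at y within cball 0 R)"
    and CD: "C1_on (cball 0 R) D" unfolding C2_on_def by blast
  have C1: "C1_on (cball 0 R) (\<theta> t)" using D C1_on_imp_continuous_on [OF CD] unfolding C1_on_def by blast
  show "(\<forall>x\<in>ball 0 R.
        ((\<lambda>\<epsilon>. momentum_lhs \<gamma> R \<rho> (\<lambda>s y. \<epsilon> *\<^sub>R \<theta> s y) t x) has_vector_derivative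
           time_deriv2 (\<lambda>s. \<theta> s x) t + lin_op \<gamma> R \<rho> (\<theta> t) x) (at 0)) \<and>
      (\<forall>x\<in>sphere 0 R.
        ((\<lambda>\<epsilon>. jac_det R (flow_map (\<lambda>y. \<epsilon> *\<^sub>R \<theta> t y)) x - 1) has_real_derivative
           div_on (cball 0 R) (\<theta> t) x) (at 0)) \<and>
      ((\<forall>x\<in>sphere 0 R. div_on (cball 0 R) (\<theta> t) x = 0) \<longrightarrow>
        (\<forall>x\<in>ball 0 R. lin_op \<gamma> R \<rho> (\<theta> t) x = lin_op_div \<gamma> R \<rho> (liquid_slope R f0) (\<theta> t) x))"
  proof (intro conjI ballI impI)
    fix x :: "real^3" assume x: "x \<in> ball 0 R"
    have "((\<lambda>\<epsilon>. \<epsilon> *\<^sub>R time_deriv2 (\<lambda>s. \<theta> s x) t) has_vector_derivative time_deriv2 (\<lambda>s. \<theta> s x) t) (at 0)"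
      by (rule has_vector_derivative_scaled_continuous) simp
    from has_vector_derivative_add [OF this linearised_force [OF C2 x]]
    show "((\<lambda>\<epsilon>. momentum_lhs \<gamma> R \<rho> (\<lambda>s y. \<epsilon> *\<^sub>R \<theta> s y) t x) has_vector_derivative
           time_deriv2 (\<lambda>s. \<theta> s x) t + lin_op \<gamma> R \<rho> (\<theta> t) x) (at 0)"
      unfolding momentum_lhs_def \<rho>_def time_deriv2_scaleR [OF time t time_regular [OF x]]
      by (simp add: add.assoc)
  next
    fix x :: "real^3" assume "x \<in> sphere 0 R"
    hence x: "x \<in> cball 0 R" by simp
    show "((\<lambda>\<epsilon>. jac_det R (flow_map (\<lambda>y. \<epsilon> *\<^sub>R \<theta> t y)) x - 1) has_real_derivative
           div_on (cball 0 R) (\<theta> t) x) (at 0)"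
      using DERIV_diff [OF jac_det_perturbation_derivative [OF radius(1) x D [OF x]] DERIV_const] by simp
  next
    fix x :: "real^3" assume "\<forall>x\<in>sphere 0 R. div_on (cball 0 R) (\<theta> t) x = 0"
    thus "lin_op \<gamma> R \<rho> (\<theta> t) x = lin_op_div \<gamma> R \<rho> (liquid_slope R f0) (\<theta> t) x"
      unfolding \<rho>_def by (intro lin_op_eq_lin_op_div C1) auto
  qed
qed

end
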